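(* Let $G$ be a group, let $R$ be a $G$-graded ring, let $E$ be an injective cogenerator of the category $\mathsf{Mod}(R)$ of $G$-graded $R$-modules, and let $M$ be a $G$-graded $R$-module. Then $M$ is flat if and only if the $G$-graded $R$-module $\mathrm{Hom}_R(M,E)$ is injective (in $\mathsf{Mod}(R)$).
   Context: Groups are commutative and written additively; rings are commutative with $1$. A $G$-graded ring is a ring $R$ with a family $(R_g)_{g\in G}$ of additive subgroups whose direct sum is $R$ and with $R_gR_h\subseteq R_{g+h}$. A $G$-graded $R$-module is an $R$-module $M$ with a family $(M_g)_{g\in G}$ of additive subgroups whose direct sum is $M$ and with $R_gM_h\subseteq M_{g+h}$. $\mathsf{Mod}(R)$ is the category of $G$-graded $R$-modules, with morphisms the $R$-linear maps $u\colon M\to N$ with $u(M_g)\subseteq N_g$ for all $g$. For $g\in G$, the shift $M(g)$ is the $R$-module $M$ with graduation $M(g)_h=M_{g+h}$. The graded Hom module is $\mathrm{Hom}_R(M,N):=\bigoplus_{g\in G}\mathrm{Hom}_{\mathsf{Mod}(R)}(M,N(g))$, with its natural structure of $G$-graded $R$-module (the summand for $g$ being the component of degree $g$). The tensor product of $G$-graded $R$-modules carries its usual $G$-graduation, and a $G$-graded $R$-module $M$ is flat if $\bullet\otimes_RM\colon\mathsf{Mod}(R)\to\mathsf{Mod}(R)$ is exact. A cogenerator of an abelian category $\mathsf C$ is an object $E$ such that the contravariant functor $\mathrm{Hom}_{\mathsf C}(\bullet,E)$ to abelian groups is faithful. *)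

theory Defs
  imports
    "HOL-Algebra.Module"
    "HOL-Algebra.AbelCoset"
    "HOL-Algebra.Generated_Groups"
    "HOL-Algebra.Free_Abelian_Groups"
begin

text \<open>
  The grading group is a commutative group in the sense of HOL-Algebra and hence written
  multiplicatively: \<open>g \<otimes>\<^bsub>G\<^esub> h\<close> stands for $g + h$, and \<open>inv\<^bsub>G\<^esub> g\<close> for $-g$.
\<close>

section \<open>Graded rings and modules\<close>

record ('a, 'g) gring = "'a ring" +
  ring_comp :: "'g \<Rightarrow> 'a set"

record ('a, 'b, 'g) gmodule = "('a, 'b) module" +
  mod_comp :: "'g \<Rightarrow> 'b set"

definition fin_families ::
  "'i set \<Rightarrow> ('b, 'k) ring_scheme \<Rightarrow> ('i \<Rightarrow> 'b set) \<Rightarrow> ('i \<Rightarrow> 'b) set" where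
  "fin_families I M C = {c \<in> (\<Pi>\<^sub>E i\<in>I. C i). finite {i \<in> I. c i \<noteq> \<zero>\<^bsub>M\<^esub>}}"

text \<open>
  Since \<open>gfinprod\<close> runs over the support of its argument, the following says that every
  element of \<open>M\<close> is the sum of exactly one finitely supported family of elements of the
  \<open>C i\<close>.
\<close>

definition is_direct_sum :: "'i set \<Rightarrow> ('b, 'k) ring_scheme \<Rightarrow> ('i \<Rightarrow> 'b set) \<Rightarrow> bool" where
  "is_direct_sum I M C \<longleftrightarrow>
     (\<forall>i\<in>I. additive_subgroup (C i) M) \<and>
     bij_betw (\<lambda>c. gfinprod (add_monoid M) c I) (fin_families I M C) (carrier M)"

definition component ::
  "'i set \<Rightarrow> ('b, 'k) ring_scheme \<Rightarrow> ('i \<Rightarrow> 'b set) \<Rightarrow> 'b \<Rightarrow> 'i \<Rightarrow> 'b" where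
  "component I M C x = inv_into (fin_families I M C) (\<lambda>c. gfinprod (add_monoid M) c I) x"

locale graded_ring = G?: comm_group G + R?: cring R
  for G :: "('g, 'j) monoid_scheme" and R :: "('r, 'g, 'k) gring_scheme" +
  assumes ring_direct_sum: "is_direct_sum (carrier G) R (ring_comp R)"
    and ring_comp_mult:
      "\<lbrakk>g \<in> carrier G; h \<in> carrier G; a \<in> ring_comp R g; b \<in> ring_comp R h\<rbrakk>
        \<Longrightarrow> a \<otimes>\<^bsub>R\<^esub> b \<in> ring_comp R (g \<otimes>\<^bsub>G\<^esub> h)"

locale graded_module = graded_ring G R + module R M
  for G :: "('g, 'j) monoid_scheme" and R :: "('r, 'g, 'k) gring_scheme"
    and M :: "('r, 'm, 'g, 'l) gmodule_scheme" +
  assumes mod_direct_sum: "is_direct_sum (carrier G) M (mod_comp M)"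
    and mod_comp_smult:
      "\<lbrakk>g \<in> carrier G; h \<in> carrier G; a \<in> ring_comp R g; x \<in> mod_comp M h\<rbrakk>
        \<Longrightarrow> a \<odot>\<^bsub>M\<^esub> x \<in> mod_comp M (g \<otimes>\<^bsub>G\<^esub> h)"

text \<open>Morphisms are extensional functions, so that equality of morphisms is equality in HOL.\<close>

definition gr_hom ::
  "('g, 'j) monoid_scheme \<Rightarrow> ('r, 'g, 'k) gring_scheme \<Rightarrow> ('r, 'm, 'g) gmodule \<Rightarrow>
   ('r, 'n, 'g) gmodule \<Rightarrow> ('m \<Rightarrow> 'n) set" where
  "gr_hom G R M N =
     {u \<in> carrier M \<rightarrow>\<^sub>E carrier N.
        (\<forall>x\<in>carrier M. \<forall>y\<in>carrier M. u (x \<oplus>\<^bsub>M\<^esub> y) = u x \<oplus>\<^bsub>N\<^esub> u y) \<and>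
        (\<forall>a\<in>carrier R. \<forall>x\<in>carrier M. u (a \<odot>\<^bsub>M\<^esub> x) = a \<odot>\<^bsub>N\<^esub> u x) \<and>
        (\<forall>g\<in>carrier G. u ` mod_comp M g \<subseteq> mod_comp N g)}"

definition shift ::
  "('g, 'j) monoid_scheme \<Rightarrow> 'g \<Rightarrow> ('r, 'm, 'g) gmodule \<Rightarrow> ('r, 'm, 'g) gmodule" where
  "shift G g M = M\<lparr>mod_comp := (\<lambda>h. mod_comp M (g \<otimes>\<^bsub>G\<^esub> h))\<rparr>"

section \<open>The graded Hom module\<close>

text \<open>
  An element of the direct sum is the family \<open>\<phi>\<close> of its components
  \<open>\<phi> g \<in> Hom(M, N(g))\<close>.  A homogeneous \<open>a\<close> of degree $h$ sends a morphism $u$ of degree $g$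
  to the morphism $x \mapsto a u(x)$ of degree $h + g$; extended to arbitrary \<open>a\<close>, the
  component of degree $k$ of $a\varphi$ is $x \mapsto \sum_h a_h \varphi_{k-h}(x)$.
  The ring fields \<open>mult\<close> and \<open>one\<close>, which every module record inherits, carry no
  meaning for modules.
\<close>

definition gr_Hom ::
  "('g, 'j) monoid_scheme \<Rightarrow> ('r, 'g, 'k) gring_scheme \<Rightarrow> ('r, 'm, 'g) gmodule \<Rightarrow>
   ('r, 'n, 'g) gmodule \<Rightarrow> ('r, 'g \<Rightarrow> 'm \<Rightarrow> 'n, 'g) gmodule" where
  "gr_Hom G R M N =
    (let H = {\<phi> \<in> (\<Pi>\<^sub>E g\<in>carrier G. gr_hom G R M (shift G g N)).
                finite {g \<in> carrier G. \<exists>x\<in>carrier M. \<phi> g x \<noteq> \<zero>\<^bsub>N\<^esub>}}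
     in \<lparr>carrier = H,
         monoid.mult = undefined,
         one = undefined,
         ring.zero = (\<lambda>g\<in>carrier G. \<lambda>x\<in>carrier M. \<zero>\<^bsub>N\<^esub>),
         ring.add = (\<lambda>\<phi> \<psi>. \<lambda>g\<in>carrier G. \<lambda>x\<in>carrier M. \<phi> g x \<oplus>\<^bsub>N\<^esub> \<psi> g x),
         smult = (\<lambda>a \<phi>. \<lambda>k\<in>carrier G. \<lambda>x\<in>carrier M.
           gfinprod (add_monoid N)
             (\<lambda>h. component (carrier G) R (ring_comp R) a h \<odot>\<^bsub>N\<^esub> \<phi> (k \<otimes>\<^bsub>G\<^esub> inv\<^bsub>G\<^esub> h) x)
             (carrier G)),
         mod_comp = (\<lambda>g. {\<phi> \<in> H. \<forall>h\<in>carrier G. h \<noteq> g \<longrightarrow>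
                                      (\<forall>x\<in>carrier M. \<phi> h x = \<zero>\<^bsub>N\<^esub>)})\<rparr>)"

section \<open>The graded tensor product\<close>

definition tensor_free ::
  "('r, 'n, 'g) gmodule \<Rightarrow> ('r, 'm, 'g) gmodule \<Rightarrow> ('n \<times> 'm \<Rightarrow>\<^sub>0 int) monoid" where
  "tensor_free N M = free_Abelian_group (carrier N \<times> carrier M)"

definition tensor_rel ::
  "('r, 'g, 'k) gring_scheme \<Rightarrow> ('r, 'n, 'g) gmodule \<Rightarrow> ('r, 'm, 'g) gmodule \<Rightarrow>
   ('n \<times> 'm \<Rightarrow>\<^sub>0 int) set" where
  "tensor_rel R N M = generate (tensor_free N M)
     ({frag_of (x \<oplus>\<^bsub>N\<^esub> x', y) - frag_of (x, y) - frag_of (x', y) | x x' y.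
         x \<in> carrier N \<and> x' \<in> carrier N \<and> y \<in> carrier M} \<union>
      {frag_of (x, y \<oplus>\<^bsub>M\<^esub> y') - frag_of (x, y) - frag_of (x, y') | x y y'.
         x \<in> carrier N \<and> y \<in> carrier M \<and> y' \<in> carrier M} \<union>
      {frag_of (a \<odot>\<^bsub>N\<^esub> x, y) - frag_of (x, a \<odot>\<^bsub>M\<^esub> y) | a x y.
         a \<in> carrier R \<and> x \<in> carrier N \<and> y \<in> carrier M})"

definition tensor_group ::
  "('r, 'g, 'k) gring_scheme \<Rightarrow> ('r, 'n, 'g) gmodule \<Rightarrow> ('r, 'm, 'g) gmodule \<Rightarrow>
   ('n \<times> 'm \<Rightarrow>\<^sub>0 int) set monoid" where
  "tensor_group R N M = tensor_free N M Mod tensor_rel R N M"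

definition tensor_class ::
  "('r, 'g, 'k) gring_scheme \<Rightarrow> ('r, 'n, 'g) gmodule \<Rightarrow> ('r, 'm, 'g) gmodule \<Rightarrow>
   ('n \<times> 'm \<Rightarrow>\<^sub>0 int) \<Rightarrow> ('n \<times> 'm \<Rightarrow>\<^sub>0 int) set" where
  "tensor_class R N M c = tensor_rel R N M #>\<^bsub>tensor_free N M\<^esub> c"

text \<open>
  Elements of the tensor product are cosets \<open>X\<close>; a map on cosets is given as the union of
  the cosets of the images of all representatives \<open>c \<in> X\<close>, all of which coincide when the
  map is well defined.
\<close>

definition gr_tensor ::
  "('g, 'j) monoid_scheme \<Rightarrow> ('r, 'g, 'k) gring_scheme \<Rightarrow> ('r, 'n, 'g) gmodule \<Rightarrow>
   ('r, 'm, 'g) gmodule \<Rightarrow> ('r, ('n \<times> 'm \<Rightarrow>\<^sub>0 int) set, 'g) gmodule" where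
  "gr_tensor G R N M =
     \<lparr>carrier = carrier (tensor_group R N M),
      monoid.mult = undefined,
      one = undefined,
      ring.zero = \<one>\<^bsub>tensor_group R N M\<^esub>,
      ring.add = monoid.mult (tensor_group R N M),
      smult = (\<lambda>a X. \<Union>c\<in>X. tensor_class R N M
                       (frag_extend (\<lambda>(x, y). frag_of (a \<odot>\<^bsub>N\<^esub> x, y)) c)),
      mod_comp = (\<lambda>g. generate (tensor_group R N M)
        {tensor_class R N M (frag_of (x, y)) | x y h k.
           h \<in> carrier G \<and> k \<in> carrier G \<and> h \<otimes>\<^bsub>G\<^esub> k = g \<and>
           x \<in> mod_comp N h \<and> y \<in> mod_comp M k})\<rparr>"

definition tensor_map ::
  "('r, 'g, 'k) gring_scheme \<Rightarrow> ('r, 'n, 'g) gmodule \<Rightarrow> ('r, 'p, 'g) gmodule \<Rightarrow>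
   ('r, 'm, 'g) gmodule \<Rightarrow> ('n \<Rightarrow> 'p) \<Rightarrow>
   ('n \<times> 'm \<Rightarrow>\<^sub>0 int) set \<Rightarrow> ('p \<times> 'm \<Rightarrow>\<^sub>0 int) set" where
  "tensor_map R N P M u =
     (\<lambda>X\<in>carrier (tensor_group R N M).
        \<Union>c\<in>X. tensor_class R P M (frag_extend (\<lambda>(x, y). frag_of (u x, y)) c))"

section \<open>Exactness, flatness, injectivity, cogenerators\<close>

definition gr_short_exact ::
  "('g, 'j) monoid_scheme \<Rightarrow> ('r, 'g, 'k) gring_scheme \<Rightarrow> ('r, 'a, 'g) gmodule \<Rightarrow>
   ('r, 'b, 'g) gmodule \<Rightarrow> ('r, 'c, 'g) gmodule \<Rightarrow> ('a \<Rightarrow> 'b) \<Rightarrow> ('b \<Rightarrow> 'c) \<Rightarrow> bool" where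
  "gr_short_exact G R A B C u v \<longleftrightarrow>
     graded_module G R A \<and> graded_module G R B \<and> graded_module G R C \<and>
     u \<in> gr_hom G R A B \<and> v \<in> gr_hom G R B C \<and>
     inj_on u (carrier A) \<and>
     u ` carrier A = {y \<in> carrier B. v y = \<zero>\<^bsub>C\<^esub>} \<and>
     v ` carrier B = carrier C"

text \<open>
  HOL cannot quantify over types inside a formula, so the objects of the category of graded
  modules over which the following three notions quantify are those with carrier in a type
  \<open>'u\<close>, passed as an argument.  When \<open>R\<close> embeds into \<open>'u\<close>, being injective, being flat
  and being an injective cogenerator do not depend on the choice of \<open>'u\<close>: up to
  isomorphism all subquotients of the shifts of \<open>R\<close> then have carrier in \<open>'u\<close>, and these
  suffice as test objects (Baer's criterion and its analogue for flatness; cyclic modules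
  for injective cogenerators).
\<close>

definition gr_flat ::
  "'u itself \<Rightarrow> ('g, 'j) monoid_scheme \<Rightarrow> ('r, 'g, 'k) gring_scheme \<Rightarrow>
   ('r, 'm, 'g) gmodule \<Rightarrow> bool" where
  "gr_flat U G R M \<longleftrightarrow> graded_module G R M \<and>
     (\<forall>(A :: ('r, 'u, 'g) gmodule) (B :: ('r, 'u, 'g) gmodule) (C :: ('r, 'u, 'g) gmodule) u v.
        gr_short_exact G R A B C u v \<longrightarrow>
        gr_short_exact G R (gr_tensor G R A M) (gr_tensor G R B M) (gr_tensor G R C M)
          (tensor_map R A B M u) (tensor_map R B C M v))"

definition gr_injective ::
  "'u itself \<Rightarrow> ('g, 'j) monoid_scheme \<Rightarrow> ('r, 'g, 'k) gring_scheme \<Rightarrow>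
   ('r, 'e, 'g) gmodule \<Rightarrow> bool" where
  "gr_injective U G R E \<longleftrightarrow> graded_module G R E \<and>
     (\<forall>(A :: ('r, 'u, 'g) gmodule) (B :: ('r, 'u, 'g) gmodule).
        graded_module G R A \<longrightarrow> graded_module G R B \<longrightarrow>
        (\<forall>u\<in>gr_hom G R A B. inj_on u (carrier A) \<longrightarrow>
          (\<forall>f\<in>gr_hom G R A E. \<exists>h\<in>gr_hom G R B E. compose (carrier A) h u = f)))"

text \<open>
  Faithfulness of $\mathrm{Hom}(\bullet, E)$: the assignment sending $f \colon A \to B$ to
  $(h \mapsto h \circ f) \colon \mathrm{Hom}(B, E) \to \mathrm{Hom}(A, E)$ is injective.
\<close>

definition gr_cogenerator ::
  "'u itself \<Rightarrow> ('g, 'j) monoid_scheme \<Rightarrow> ('r, 'g, 'k) gring_scheme \<Rightarrow>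
   ('r, 'e, 'g) gmodule \<Rightarrow> bool" where
  "gr_cogenerator U G R E \<longleftrightarrow> graded_module G R E \<and>
     (\<forall>(A :: ('r, 'u, 'g) gmodule) (B :: ('r, 'u, 'g) gmodule).
        graded_module G R A \<longrightarrow> graded_module G R B \<longrightarrow>
        inj_on (\<lambda>f. \<lambda>h\<in>gr_hom G R B E. compose (carrier A) h f) (gr_hom G R A B))"

end

theory Submission
  imports Defs
begin

text \<open>
  The proof rests on the adjunction between $\bullet \otimes M$ and $\mathrm{Hom}(M, \bullet)$: graded
  morphisms from $A \otimes M$ to \<open>E\<close> are the same as graded morphisms from \<open>A\<close> to the graded Hom
  module from \<open>M\<close> to \<open>E\<close> (\<open>untranspose\<close>, \<open>transpose_gr_hom\<close>, \<open>total_transpose\<close>). Hence the Hom module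
  is injective if and only if every morphism from $A \otimes M$ to \<open>E\<close> extends along $u \otimes 1$ for
  every monomorphism \<open>u\<close> from \<open>A\<close> to \<open>B\<close>. If \<open>M\<close> is flat, $u \otimes 1$ is a monomorphism and the
  extension exists because \<open>E\<close> is injective (\<open>Hom_injective_if_flat\<close>). Conversely, if such extensions
  exist, every morphism from $A \otimes M$ to \<open>E\<close> vanishes on the kernel of $u \otimes 1$; since \<open>E\<close> is an
  injective cogenerator, the kernel is zero (\<open>flat_if_Hom_injective\<close>). The rest of exactness is the
  right exactness of the tensor product (\<open>tensor_right_exact\<close>), which holds for every \<open>M\<close>.

  A point special to this setting is that the hypotheses on \<open>E\<close> are tested on modules in one fixed
  type, but they are applied to tensor products, which have elements in another type. Baer's
  criterion bridges the gap: extending a morphism by one homogeneous generator only involves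
  graded ideals of \<open>R\<close>, and these have copies in the type of test modules, so \<open>E\<close> is injective
  with respect to modules of every type (\<open>gr_injective_extend\<close>). Similarly, a nonzero homogeneous
  element generates a cyclic module, which has a copy in that type, so \<open>E\<close> separates the elements of
  all graded modules (\<open>gr_cogenerator_separates\<close>).

  Most verifications follow one pattern. An identity that is additive in each argument is reduced
  to homogeneous arguments, where the sums over degrees have at most one nonzero term.
\<close>


section \<open>Direct sums and homogeneous components\<close>

lemma (in comm_monoid) gfinprod_single:
  assumes "c i \<in> carrier G" "i \<in> I" "\<And>j. \<lbrakk>j \<in> I; j \<noteq> i\<rbrakk> \<Longrightarrow> c j = \<one>"
  shows "gfinprod G c I = c i"
proof -
  have c_cl: "c j \<in> carrier G" if "j \<in> I" for j
    using assms that by (cases "j = i") auto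
  have "gfinprod G c I = gfinprod G c {i}"
    by (rule gfinprod_mono_neutral_cong_right) (use assms in \<open>auto simp: c_cl\<close>)
  then show ?thesis
    using assms by (simp add: Pi_def)
qed

locale direct_sum = abelian_group M
  for M :: "('b, 'k) ring_scheme" (structure) and I :: "'i set" and C :: "'i \<Rightarrow> 'b set" +
  assumes is_direct_sum: "is_direct_sum I M C"
begin

abbreviation cmp :: "'b \<Rightarrow> 'i \<Rightarrow> 'b" where "cmp \<equiv> component I M C"

abbreviation gsum :: "('i \<Rightarrow> 'b) \<Rightarrow> 'b" where "gsum c \<equiv> gfinprod (add_monoid M) c I"

lemma comp_subgroup: "i \<in> I \<Longrightarrow> additive_subgroup (C i) M"
  using is_direct_sum by (auto simp: is_direct_sum_def)

lemma comp_sub [simp, intro]: "\<lbrakk>x \<in> C i; i \<in> I\<rbrakk> \<Longrightarrow> x \<in> carrier M"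
  using additive_subgroup.a_subset[OF comp_subgroup] by auto

lemma comp_zero [simp]: "i \<in> I \<Longrightarrow> \<zero> \<in> C i"
  by (rule additive_subgroup.zero_closed[OF comp_subgroup])

lemma comp_add: "\<lbrakk>i \<in> I; x \<in> C i; y \<in> C i\<rbrakk> \<Longrightarrow> x \<oplus> y \<in> C i"
  by (rule additive_subgroup.a_closed[OF comp_subgroup])

lemma comp_minus: "\<lbrakk>i \<in> I; x \<in> C i\<rbrakk> \<Longrightarrow> \<ominus> x \<in> C i"
  unfolding a_inv_def
  using subgroup.m_inv_closed[OF additive_subgroup.a_subgroup[OF comp_subgroup], of i x] by blast

lemma bij_sum: "bij_betw gsum (fin_families I M C) (carrier M)"
  using is_direct_sum by (auto simp: is_direct_sum_def)

lemma cmp_family: "x \<in> carrier M \<Longrightarrow> cmp x \<in> fin_families I M C"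
  unfolding component_def using bij_sum by (auto simp: bij_betw_def intro!: inv_into_into)

lemma cmp_in: "\<lbrakk>x \<in> carrier M; i \<in> I\<rbrakk> \<Longrightarrow> cmp x i \<in> C i"
  using cmp_family by (force simp: fin_families_def)

lemma cmp_closed [simp, intro]: "\<lbrakk>x \<in> carrier M; i \<in> I\<rbrakk> \<Longrightarrow> cmp x i \<in> carrier M"
  using cmp_in by blast

lemma cmp_finite: "x \<in> carrier M \<Longrightarrow> finite {i \<in> I. cmp x i \<noteq> \<zero>}"
  using cmp_family by (force simp: fin_families_def)

lemma gsum_cmp: "x \<in> carrier M \<Longrightarrow> gsum (cmp x) = x"
  unfolding component_def using bij_sum by (rule bij_betw_inv_into_right)

lemma cmp_unique:
  assumes "\<And>i. i \<in> I \<Longrightarrow> c i \<in> C i" "finite {i \<in> I. c i \<noteq> \<zero>}" "i \<in> I"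
  shows "cmp (gsum c) i = c i"
proof -
  let ?c = "restrict c I"
  have f: "?c \<in> fin_families I M C"
    using assms by (auto simp: fin_families_def cong: conj_cong)
  have "gsum ?c = gsum c"
    using assms comp_sub by (intro add.gfinprod_cong) (auto simp: simp_implies_def)
  then have "cmp (gsum c) = ?c"
    unfolding component_def using bij_sum f by (metis bij_betw_inv_into_left)
  then show ?thesis using \<open>i \<in> I\<close> by simp
qed

lemma cmp_add:
  assumes x: "x \<in> carrier M" and y: "y \<in> carrier M" and "i \<in> I"
  shows "cmp (x \<oplus> y) i = cmp x i \<oplus> cmp y i"
proof -
  have "gsum (\<lambda>i. cmp x i \<oplus> cmp y i) = gsum (cmp x) \<oplus> gsum (cmp y)"
    using add.gfinprod_distrib[of I "cmp x" "cmp y"] x y cmp_finite by (simp add: image_subset_iff)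
  then have *: "gsum (\<lambda>i. cmp x i \<oplus> cmp y i) = x \<oplus> y"
    by (simp add: gsum_cmp x y)
  have "finite {i \<in> I. cmp x i \<oplus> cmp y i \<noteq> \<zero>}"
    by (rule finite_subset[OF _ finite_UnI[OF cmp_finite[OF x] cmp_finite[OF y]]]) auto
  then show ?thesis
    using cmp_unique[of "\<lambda>i. cmp x i \<oplus> cmp y i" i] assms by (simp add: * comp_add cmp_in)
qed

lemma gsum_single:
  assumes "x \<in> carrier M" "i \<in> I" "c i = x" "\<And>j. j \<in> I \<Longrightarrow> j \<noteq> i \<Longrightarrow> c j = \<zero>"
  shows "gsum c = x"
  using add.gfinprod_single[of c i I] assms by simp

lemma cmp_homog:
  assumes "x \<in> C i" "i \<in> I" "j \<in> I"
  shows "cmp x j = (if j = i then x else \<zero>)"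
proof -
  let ?c = "\<lambda>j. if j = i then x else \<zero>"
  have "gsum ?c = x" using assms by (intro gsum_single) auto
  moreover have "finite {j \<in> I. ?c j \<noteq> \<zero>}"
    by (rule finite_subset[of _ "{i}"]) auto
  ultimately show ?thesis using cmp_unique[of ?c j] assms by simp
qed

lemma gsum_induct:
  assumes "\<And>i. i \<in> I \<Longrightarrow> c i \<in> carrier M" and "\<And>i. i \<in> I \<Longrightarrow> P (c i)" and "P \<zero>"
    and "\<And>x y. \<lbrakk>x \<in> carrier M; y \<in> carrier M; P x; P y\<rbrakk> \<Longrightarrow> P (x \<oplus> y)"
  shows "P (gsum c)"
proof -
  have "finsum M c J \<in> carrier M \<and> P (finsum M c J)" if "finite J" "J \<subseteq> I" for J
    using that
  proof (induction J rule: finite_induct)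
    case empty
    then show ?case using assms by simp
  next
    case (insert i J)
    then have "finsum M c (insert i J) = c i \<oplus> finsum M c J"
      using assms by (intro finsum_insert) auto
    with insert show ?case using assms by auto
  qed
  then show ?thesis
    using assms by (auto simp: gfinprod_def finsum_def)
qed

lemma cmp_induct:
  assumes "x \<in> carrier M" and "\<And>i. i \<in> I \<Longrightarrow> P (cmp x i)" and "P \<zero>"
    and "\<And>x y. \<lbrakk>x \<in> carrier M; y \<in> carrier M; P x; P y\<rbrakk> \<Longrightarrow> P (x \<oplus> y)"
  shows "P x"
  using gsum_induct[of "cmp x" P] assms by (simp add: gsum_cmp)

text \<open>
  Additive identities only have to be checked on homogeneous elements; this rule and
  \<open>additive_ext\<close> below replace computations with the finite sums of components.
\<close>

lemma homog_induct [consumes 1, case_names zero homog add]: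
  assumes "x \<in> carrier M" and "P \<zero>" and "\<And>i x. \<lbrakk>i \<in> I; x \<in> C i\<rbrakk> \<Longrightarrow> P x"
    and "\<And>x y. \<lbrakk>x \<in> carrier M; y \<in> carrier M; P x; P y\<rbrakk> \<Longrightarrow> P (x \<oplus> y)"
  shows "P x"
  using cmp_induct[of x P] assms cmp_in by blast

lemma cmp_zero [simp]: "i \<in> I \<Longrightarrow> cmp \<zero> i = \<zero>"
  using cmp_homog[of \<zero> i i] by simp

lemma cmp_minus:
  assumes x: "x \<in> carrier M" and i: "i \<in> I"
  shows "cmp (\<ominus> x) i = \<ominus> cmp x i"
proof -
  have "cmp (\<ominus> x) i \<oplus> cmp x i = \<zero>"
    using cmp_add[of "\<ominus> x" x i] x i by (simp add: l_neg)
  then show ?thesis using x i by (simp add: minus_equality)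
qed

lemma zero_if_cmp_zero:
  assumes "x \<in> carrier M" "\<And>i. i \<in> I \<Longrightarrow> cmp x i = \<zero>"
  shows "x = \<zero>"
  by (rule cmp_induct[of x "\<lambda>x. x = \<zero>"]) (use assms in auto)

lemma additive_ext:
  assumes L: "group L"
    and f: "\<And>x. x \<in> carrier M \<Longrightarrow> f x \<in> carrier L" "\<And>x. x \<in> carrier M \<Longrightarrow> f' x \<in> carrier L"
    and add: "\<And>x y. \<lbrakk>x \<in> carrier M; y \<in> carrier M\<rbrakk> \<Longrightarrow> f (x \<oplus> y) = f x \<otimes>\<^bsub>L\<^esub> f y"
      "\<And>x y. \<lbrakk>x \<in> carrier M; y \<in> carrier M\<rbrakk> \<Longrightarrow> f' (x \<oplus> y) = f' x \<otimes>\<^bsub>L\<^esub> f' y"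
    and homog: "\<And>i x. \<lbrakk>i \<in> I; x \<in> C i\<rbrakk> \<Longrightarrow> f x = f' x"
    and x: "x \<in> carrier M"
  shows "f x = f' x"
proof -
  interpret L: group L by fact
  have zero: "f \<zero> = \<one>\<^bsub>L\<^esub>" "f' \<zero> = \<one>\<^bsub>L\<^esub>"
    using add[of \<zero> \<zero>] f[of \<zero>] by (simp_all add: L.r_cancel_one')
  from x show ?thesis
    by (induction rule: homog_induct) (simp_all add: add homog zero)
qed

end

lemma (in abelian_group) additive_subgroupI:
  assumes "H \<subseteq> carrier G" "\<zero> \<in> H" "\<And>x y. \<lbrakk>x \<in> H; y \<in> H\<rbrakk> \<Longrightarrow> x \<oplus> y \<in> H"
    "\<And>x. x \<in> H \<Longrightarrow> \<ominus> x \<in> H"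
  shows "additive_subgroup H G"
  using assms by (intro additive_subgroup.intro add.subgroupI) (auto simp: a_inv_def)

text \<open>
  A direct sum can be recognised without handling families: it suffices to have additive
  projections that are right on homogeneous elements, and to know that these generate. That
  \<open>p i x\<close> lies in \<open>C i\<close>, vanishes for almost all \<open>i\<close> and sums to \<open>x\<close> then follows, since these
  properties hold for homogeneous elements and are stable under addition.
\<close>

lemma is_direct_sumI:
  fixes M (structure)
  assumes M: "abelian_group M"
    and sub: "\<And>i. i \<in> I \<Longrightarrow> additive_subgroup (C i) M"
    and p_closed: "\<And>i x. \<lbrakk>i \<in> I; x \<in> carrier M\<rbrakk> \<Longrightarrow> p i x \<in> carrier M"
    and p_add: "\<And>i x y. \<lbrakk>i \<in> I; x \<in> carrier M; y \<in> carrier M\<rbrakk> \<Longrightarrow> p i (x \<oplus> y) = p i x \<oplus> p i y"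
    and p_id: "\<And>i x. \<lbrakk>i \<in> I; x \<in> C i\<rbrakk> \<Longrightarrow> p i x = x"
    and p_zero: "\<And>i j x. \<lbrakk>i \<in> I; j \<in> I; x \<in> C i; j \<noteq> i\<rbrakk> \<Longrightarrow> p j x = \<zero>"
    and gen: "\<And>P x. \<lbrakk>x \<in> carrier M; P \<zero>; \<And>i x. \<lbrakk>i \<in> I; x \<in> C i\<rbrakk> \<Longrightarrow> P x;
        \<And>x y. \<lbrakk>x \<in> carrier M; y \<in> carrier M; P x; P y\<rbrakk> \<Longrightarrow> P (x \<oplus> y)\<rbrakk> \<Longrightarrow> P x"
  shows "is_direct_sum I M C \<and> (\<forall>i\<in>I. \<forall>x\<in>carrier M. component I M C x i = p i x)"
proof -
  interpret abelian_group M by fact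
  let ?s = "\<lambda>c. gfinprod (add_monoid M) c I"
  have C_sub: "x \<in> carrier M" if "x \<in> C i" "i \<in> I" for x i
    using additive_subgroup.a_subset[OF sub] that by auto
  have p0: "p i \<zero> = \<zero>" if "i \<in> I" for i
    using p_id[of i \<zero>] additive_subgroup.zero_closed[OF sub] that by auto
  have p_fin: "finite {i \<in> I. p i x \<noteq> \<zero>} \<and> (\<forall>i\<in>I. p i x \<in> C i) \<and> ?s (\<lambda>i. p i x) = x"
    if "x \<in> carrier M" for x
  proof (rule gen[OF that], goal_cases)
    case 1
    have "{i \<in> I. p i \<zero> \<noteq> \<one>\<^bsub>add_monoid M\<^esub>} = {}" using p0 by auto
    then have "?s (\<lambda>i. p i \<zero>) = \<zero>"
      unfolding gfinprod_def using finsum_empty[of "\<lambda>i. p i \<zero>"] by (simp only: finsum_def) simp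
    then show ?case
      using additive_subgroup.zero_closed[OF sub] by (auto simp: p0 cong: conj_cong)
  next
    case (2 i x)
    have "finite {j \<in> I. p j x \<noteq> \<zero>}"
      by (rule finite_subset[of _ "{i}"]) (use 2 p_zero in auto)
    moreover have "\<forall>j\<in>I. p j x \<in> C j"
    proof
      fix j assume "j \<in> I"
      then show "p j x \<in> C j"
        using 2 p_zero[of i j x] p_id[of i x] additive_subgroup.zero_closed[OF sub, of j]
        by (cases "j = i") auto
    qed
    moreover have "?s (\<lambda>i. p i x) = gfinprod (add_monoid M) (\<lambda>i. p i x) {i}"
      by (rule add.gfinprod_mono_neutral_cong_right) (use 2 p_zero p_closed[OF _ C_sub[OF 2(2,1)]] in auto)
    ultimately show ?case
      using 2 p_id C_sub by (simp add: Pi_def)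
  next
    case (3 x y)
    have "finite {i \<in> I. p i (x \<oplus> y) \<noteq> \<zero>}"
      by (rule finite_subset[of _ "{i \<in> I. p i x \<noteq> \<zero>} \<union> {i \<in> I. p i y \<noteq> \<zero>}"])
        (use 3 p_add p_closed in auto)
    moreover have "\<forall>i\<in>I. p i (x \<oplus> y) \<in> C i"
      using 3 p_add additive_subgroup.a_closed[OF sub] by simp
    moreover have "?s (\<lambda>i. p i (x \<oplus> y)) = ?s (\<lambda>i. p i x \<oplus> p i y)"
      using 3 p_add p_closed by (intro add.gfinprod_cong) (auto simp: simp_implies_def)
    moreover have "\<dots> = ?s (\<lambda>i. p i x) \<oplus> ?s (\<lambda>i. p i y)"
      using 3 p_closed add.gfinprod_distrib[of I "\<lambda>i. p i x" "\<lambda>i. p i y"] by (simp add: image_subset_iff)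
    ultimately show ?case using 3 by simp
  qed
  have p_sum: "p j (?s c) = c j" if c: "c \<in> fin_families I M C" and j: "j \<in> I" for c j
  proof -
    have cC: "c i \<in> C i" if "i \<in> I" for i
      using c that by (auto simp: fin_families_def)
    then have c_cl: "c i \<in> carrier M" if "i \<in> I" for i
      using that C_sub by blast
    have c_fin: "finite {i \<in> I. c i \<noteq> \<zero>}"
      using c by (auto simp: fin_families_def)
    have *: "finsum M c J \<in> carrier M \<and> p j (finsum M c J) = (if j \<in> J then c j else \<zero>)"
      if "finite J" "J \<subseteq> I" for J
      using that
    proof (induction J rule: finite_induct)
      case empty
      then show ?case by (simp add: p0 j)
    next
      case (insert i J)
      then have "finsum M c (insert i J) = c i \<oplus> finsum M c J"
        using c_cl by (intro finsum_insert) auto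
      moreover have "p j (c i) = (if j = i then c i else \<zero>)"
        using insert cC[of i] j p_id[of i] p_zero[of i j "c i"] by auto
      ultimately show ?case using insert c_cl j by (auto simp: p_add)
    qed
    have "p j (finsum M c {i \<in> I. c i \<noteq> \<zero>}) = c j"
      using *[OF c_fin] j by auto
    then show ?thesis
      using c_fin by (simp add: gfinprod_def finsum_def)
  qed
  have s_cl: "?s c \<in> carrier M" if "c \<in> fin_families I M C" for c
    using that C_sub by (intro add.gfinprod_closed[simplified]) (auto simp: fin_families_def)
  have p_fam: "(\<lambda>i\<in>I. p i x) \<in> fin_families I M C \<and> ?s (\<lambda>i\<in>I. p i x) = x" if "x \<in> carrier M" for x
  proof -
    have "?s (\<lambda>i\<in>I. p i x) = ?s (\<lambda>i. p i x)"
      using that p_closed by (intro add.gfinprod_cong) (auto simp: simp_implies_def)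
    then show ?thesis
      using p_fin[OF that] by (auto simp: fin_families_def cong: conj_cong)
  qed
  have inj: "inj_on ?s (fin_families I M C)"
  proof (rule inj_onI)
    fix c d assume cd: "c \<in> fin_families I M C" "d \<in> fin_families I M C" "?s c = ?s d"
    then have "c i = d i" if "i \<in> I" for i
      using p_sum[of c i] p_sum[of d i] that by simp
    then show "c = d"
      using cd(1,2) by (auto simp: fin_families_def intro: PiE_ext)
  qed
  have bij: "bij_betw ?s (fin_families I M C) (carrier M)"
    unfolding bij_betw_def
  proof (intro conjI inj equalityI subsetI)
    fix x assume "x \<in> carrier M"
    then show "x \<in> ?s ` fin_families I M C"
      using p_fam[of x] by (intro image_eqI[of _ _ "\<lambda>i\<in>I. p i x"]) auto
  qed (use s_cl in auto)
  then have "is_direct_sum I M C"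
    by (auto simp: is_direct_sum_def sub)
  moreover have "component I M C x i = p i x" if "i \<in> I" "x \<in> carrier M" for i x
    using that
    using inv_into_f_f[OF inj conjunct1[OF p_fam[of x]]] p_fam[of x]
    by (simp add: component_def)
  ultimately show ?thesis by blast
qed


section \<open>Graded modules and their morphisms\<close>

sublocale graded_ring \<subseteq> RD: direct_sum R "carrier G" "ring_comp R"
  by unfold_locales (rule ring_direct_sum)

sublocale graded_module \<subseteq> MD: direct_sum M "carrier G" "mod_comp M"
  by unfold_locales (rule mod_direct_sum)

lemma additive_map_component:
  assumes "direct_sum M I C" "direct_sum N I D"
    and u: "\<And>x. x \<in> carrier M \<Longrightarrow> u x \<in> carrier N"
    and u_add: "\<And>x y. \<lbrakk>x \<in> carrier M; y \<in> carrier M\<rbrakk> \<Longrightarrow> u (x \<oplus>\<^bsub>M\<^esub> y) = u x \<oplus>\<^bsub>N\<^esub> u y"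
    and u_comp: "\<And>i x. \<lbrakk>i \<in> I; x \<in> C i\<rbrakk> \<Longrightarrow> u x \<in> D i"
    and x: "x \<in> carrier M" and i: "i \<in> I"
  shows "u (component I M C x i) = component I N D (u x) i"
proof -
  interpret M: direct_sum M I C by fact
  interpret N: direct_sum N I D by fact
  have u0: "u \<zero>\<^bsub>M\<^esub> = \<zero>\<^bsub>N\<^esub>"
    using u_add[of "\<zero>\<^bsub>M\<^esub>" "\<zero>\<^bsub>M\<^esub>"] u[of "\<zero>\<^bsub>M\<^esub>"] by (simp add: N.add.r_cancel_one')
  from x show ?thesis
  proof (induction rule: M.homog_induct)
    case zero
    then show ?case using i by (simp add: u0)
  next
    case (homog j x)
    then show ?case using i u0 u_comp by (simp add: M.cmp_homog N.cmp_homog[of "u x" j i])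
  next
    case (add x y)
    then show ?case using i u u_add by (simp add: M.cmp_add N.cmp_add)
  qed
qed

context graded_ring
begin

abbreviation rcmp :: "'r \<Rightarrow> 'g \<Rightarrow> 'r" where
  "rcmp \<equiv> component (carrier G) R (ring_comp R)"

abbreviation mcmp :: "('r, 'm, 'g, 'l) gmodule_scheme \<Rightarrow> 'm \<Rightarrow> 'g \<Rightarrow> 'm" where
  "mcmp M \<equiv> component (carrier G) M (mod_comp M)"

abbreviation gmod :: "('r, 'm, 'g) gmodule \<Rightarrow> bool" where
  "gmod M \<equiv> graded_module G R M"

abbreviation ghom :: "('r, 'm, 'g) gmodule \<Rightarrow> ('r, 'n, 'g) gmodule \<Rightarrow> ('m \<Rightarrow> 'n) set" where
  "ghom M N \<equiv> gr_hom G R M N"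

lemma inv_cancel [simp]:
  "\<lbrakk>g \<in> carrier G; h \<in> carrier G\<rbrakk> \<Longrightarrow> inv\<^bsub>G\<^esub> h \<otimes>\<^bsub>G\<^esub> (h \<otimes>\<^bsub>G\<^esub> g) = g"
  "\<lbrakk>g \<in> carrier G; h \<in> carrier G\<rbrakk> \<Longrightarrow> h \<otimes>\<^bsub>G\<^esub> (inv\<^bsub>G\<^esub> h \<otimes>\<^bsub>G\<^esub> g) = g"
  "\<lbrakk>g \<in> carrier G; h \<in> carrier G\<rbrakk> \<Longrightarrow> (g \<otimes>\<^bsub>G\<^esub> inv\<^bsub>G\<^esub> h) \<otimes>\<^bsub>G\<^esub> h = g"
  "\<lbrakk>g \<in> carrier G; h \<in> carrier G\<rbrakk> \<Longrightarrow> (g \<otimes>\<^bsub>G\<^esub> h) \<otimes>\<^bsub>G\<^esub> inv\<^bsub>G\<^esub> h = g"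
  "\<lbrakk>g \<in> carrier G; h \<in> carrier G\<rbrakk> \<Longrightarrow> h \<otimes>\<^bsub>G\<^esub> (g \<otimes>\<^bsub>G\<^esub> inv\<^bsub>G\<^esub> h) = g"
  by (simp_all add: G.m_assoc[symmetric], simp_all add: G.m_assoc G.m_lcomm[of h g])

lemma shift_eq_iff:
  assumes "g \<in> carrier G" "h \<in> carrier G" "k \<in> carrier G"
  shows "k = h \<otimes>\<^bsub>G\<^esub> g \<longleftrightarrow> inv\<^bsub>G\<^esub> h \<otimes>\<^bsub>G\<^esub> k = g" "k \<otimes>\<^bsub>G\<^esub> inv\<^bsub>G\<^esub> h = g \<longleftrightarrow> k = h \<otimes>\<^bsub>G\<^esub> g"
proof -
  show "k = h \<otimes>\<^bsub>G\<^esub> g \<longleftrightarrow> inv\<^bsub>G\<^esub> h \<otimes>\<^bsub>G\<^esub> k = g"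
    using assms by (metis inv_cancel(1,2) G.inv_closed)
  show "k \<otimes>\<^bsub>G\<^esub> inv\<^bsub>G\<^esub> h = g \<longleftrightarrow> k = h \<otimes>\<^bsub>G\<^esub> g"
    using assms by (metis inv_cancel(3,4) G.m_comm)
qed

lemma graded_moduleI:
  assumes "abelian_group M"
    "\<And>a x. \<lbrakk>a \<in> carrier R; x \<in> carrier M\<rbrakk> \<Longrightarrow> a \<odot>\<^bsub>M\<^esub> x \<in> carrier M"
    "\<And>a b x. \<lbrakk>a \<in> carrier R; b \<in> carrier R; x \<in> carrier M\<rbrakk> \<Longrightarrow>
      (a \<oplus>\<^bsub>R\<^esub> b) \<odot>\<^bsub>M\<^esub> x = a \<odot>\<^bsub>M\<^esub> x \<oplus>\<^bsub>M\<^esub> b \<odot>\<^bsub>M\<^esub> x"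
    "\<And>a x y. \<lbrakk>a \<in> carrier R; x \<in> carrier M; y \<in> carrier M\<rbrakk> \<Longrightarrow>
      a \<odot>\<^bsub>M\<^esub> (x \<oplus>\<^bsub>M\<^esub> y) = a \<odot>\<^bsub>M\<^esub> x \<oplus>\<^bsub>M\<^esub> a \<odot>\<^bsub>M\<^esub> y"
    "\<And>a b x. \<lbrakk>a \<in> carrier R; b \<in> carrier R; x \<in> carrier M\<rbrakk> \<Longrightarrow>
      (a \<otimes>\<^bsub>R\<^esub> b) \<odot>\<^bsub>M\<^esub> x = a \<odot>\<^bsub>M\<^esub> (b \<odot>\<^bsub>M\<^esub> x)"
    "\<And>x. x \<in> carrier M \<Longrightarrow> \<one>\<^bsub>R\<^esub> \<odot>\<^bsub>M\<^esub> x = x"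
    "is_direct_sum (carrier G) M (mod_comp M)"
    "\<And>g h a x. \<lbrakk>g \<in> carrier G; h \<in> carrier G; a \<in> ring_comp R g; x \<in> mod_comp M h\<rbrakk>
        \<Longrightarrow> a \<odot>\<^bsub>M\<^esub> x \<in> mod_comp M (g \<otimes>\<^bsub>G\<^esub> h)"
  shows "graded_module G R M"
  using assms
  by (intro graded_module.intro graded_ring_axioms graded_module_axioms.intro moduleI R.is_cring)

lemma mult_cmp:
  assumes a: "a \<in> ring_comp R h" and h: "h \<in> carrier G" and x: "x \<in> carrier R" and g: "g \<in> carrier G"
  shows "rcmp (a \<otimes>\<^bsub>R\<^esub> x) g = a \<otimes>\<^bsub>R\<^esub> rcmp x (inv\<^bsub>G\<^esub> h \<otimes>\<^bsub>G\<^esub> g)"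
proof -
  have aR: "a \<in> carrier R" using a h by blast
  from x show ?thesis
  proof (induction rule: RD.homog_induct)
    case zero
    then show ?case using aR g h by simp
  next
    case (homog k x)
    then have "a \<otimes>\<^bsub>R\<^esub> x \<in> ring_comp R (h \<otimes>\<^bsub>G\<^esub> k)"
      using ring_comp_mult a h by blast
    then show ?case
      using homog aR g h RD.cmp_homog[of "a \<otimes>\<^bsub>R\<^esub> x" "h \<otimes>\<^bsub>G\<^esub> k" g]
        RD.cmp_homog[of x k "inv\<^bsub>G\<^esub> h \<otimes>\<^bsub>G\<^esub> g"] shift_eq_iff(1)[of k h g] by auto
  next
    case (add x y)
    then show ?case using aR g h by (simp add: RD.cmp_add R.r_distr)
  qed
qed

lemma one_homog: "\<one>\<^bsub>R\<^esub> \<in> ring_comp R \<one>\<^bsub>G\<^esub>"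
proof -
  let ?e = "rcmp \<one>\<^bsub>R\<^esub> \<one>\<^bsub>G\<^esub>"
  have e: "?e \<in> carrier R" by blast
  \<comment> \<open>The neutral component of 1 acts as 1 on homogeneous elements, hence on 1 itself.\<close>
  have "x \<otimes>\<^bsub>R\<^esub> ?e = x" if "x \<in> carrier R" for x
    using that
  proof (induction rule: RD.homog_induct)
    case (homog h x)
    then have x: "x \<in> carrier R" by blast
    have "x \<otimes>\<^bsub>R\<^esub> ?e = rcmp (x \<otimes>\<^bsub>R\<^esub> \<one>\<^bsub>R\<^esub>) h"
      using mult_cmp[OF homog(2,1) R.one_closed homog(1)] homog by simp
    then show ?case using x homog by (simp add: RD.cmp_homog)
  qed (use e in \<open>auto simp: R.l_distr\<close>)
  from this[of "\<one>\<^bsub>R\<^esub>"] have "?e = \<one>\<^bsub>R\<^esub>" using e by simp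
  then show ?thesis using RD.cmp_in[of "\<one>\<^bsub>R\<^esub>" "\<one>\<^bsub>G\<^esub>"] by simp
qed

end

context graded_module
begin

lemma smult_cmp:
  assumes a: "a \<in> ring_comp R h" and h: "h \<in> carrier G" and x: "x \<in> carrier M" and g: "g \<in> carrier G"
  shows "mcmp M (a \<odot>\<^bsub>M\<^esub> x) g = a \<odot>\<^bsub>M\<^esub> mcmp M x (inv\<^bsub>G\<^esub> h \<otimes>\<^bsub>G\<^esub> g)"
proof -
  have aR: "a \<in> carrier R" using a h by blast
  from x show ?thesis
  proof (induction rule: MD.homog_induct)
    case zero
    then show ?case using aR g h by simp
  next
    case (homog k x)
    then have "a \<odot>\<^bsub>M\<^esub> x \<in> mod_comp M (h \<otimes>\<^bsub>G\<^esub> k)"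
      using mod_comp_smult a h by blast
    then show ?case
      using homog aR g h MD.cmp_homog[of "a \<odot>\<^bsub>M\<^esub> x" "h \<otimes>\<^bsub>G\<^esub> k" g]
        MD.cmp_homog[of x k "inv\<^bsub>G\<^esub> h \<otimes>\<^bsub>G\<^esub> g"] shift_eq_iff(1)[of k h g] by auto
  next
    case (add x y)
    then show ?case using aR g h by (simp add: MD.cmp_add smult_r_distr)
  qed
qed

lemma smult_homog_cmp:
  assumes b: "b \<in> mod_comp M k" and k: "k \<in> carrier G" and r: "r \<in> carrier R" and g: "g \<in> carrier G"
  shows "mcmp M (r \<odot>\<^bsub>M\<^esub> b) g = rcmp r (inv\<^bsub>G\<^esub> k \<otimes>\<^bsub>G\<^esub> g) \<odot>\<^bsub>M\<^esub> b"
proof -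
  have bM: "b \<in> carrier M" using b k by blast
  from r show ?thesis
  proof (induction rule: RD.homog_induct)
    case zero
    then show ?case using bM g k by simp
  next
    case (homog h r)
    then have "r \<odot>\<^bsub>M\<^esub> b \<in> mod_comp M (h \<otimes>\<^bsub>G\<^esub> k)"
      using mod_comp_smult b k by blast
    then show ?case
      using homog bM g k MD.cmp_homog[of "r \<odot>\<^bsub>M\<^esub> b" "h \<otimes>\<^bsub>G\<^esub> k" g]
        RD.cmp_homog[of r h "inv\<^bsub>G\<^esub> k \<otimes>\<^bsub>G\<^esub> g"] shift_eq_iff(1)[of h k g] by (auto simp: G.m_comm)
  next
    case (add x y)
    then show ?case using bM g k by (simp add: RD.cmp_add MD.cmp_add smult_l_distr)
  qed
qed

lemma uminus_eq_smult: "x \<in> carrier M \<Longrightarrow> \<ominus>\<^bsub>M\<^esub> x = (\<ominus>\<^bsub>R\<^esub> \<one>\<^bsub>R\<^esub>) \<odot>\<^bsub>M\<^esub> x"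
  by (simp add: smult_l_minus)

end

lemma gr_homI:
  assumes "u \<in> extensional (carrier M)" "\<And>x. x \<in> carrier M \<Longrightarrow> u x \<in> carrier N"
    "\<And>x y. \<lbrakk>x \<in> carrier M; y \<in> carrier M\<rbrakk> \<Longrightarrow> u (x \<oplus>\<^bsub>M\<^esub> y) = u x \<oplus>\<^bsub>N\<^esub> u y"
    "\<And>a x. \<lbrakk>a \<in> carrier R; x \<in> carrier M\<rbrakk> \<Longrightarrow> u (a \<odot>\<^bsub>M\<^esub> x) = a \<odot>\<^bsub>N\<^esub> u x"
    "\<And>g x. \<lbrakk>g \<in> carrier G; x \<in> mod_comp M g\<rbrakk> \<Longrightarrow> u x \<in> mod_comp N g"
  shows "u \<in> gr_hom G R M N"
  using assms by (auto simp: gr_hom_def PiE_def)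

lemma gr_homD:
  assumes "u \<in> gr_hom G R M N"
  shows "u \<in> extensional (carrier M)"
    and "x \<in> carrier M \<Longrightarrow> u x \<in> carrier N"
    and "\<lbrakk>x \<in> carrier M; y \<in> carrier M\<rbrakk> \<Longrightarrow> u (x \<oplus>\<^bsub>M\<^esub> y) = u x \<oplus>\<^bsub>N\<^esub> u y"
    and "\<lbrakk>a \<in> carrier R; x \<in> carrier M\<rbrakk> \<Longrightarrow> u (a \<odot>\<^bsub>M\<^esub> x) = a \<odot>\<^bsub>N\<^esub> u x"
    and "\<lbrakk>g \<in> carrier G; x \<in> mod_comp M g\<rbrakk> \<Longrightarrow> u x \<in> mod_comp N g"
  using assms by (auto simp: gr_hom_def PiE_def image_subset_iff)

context graded_ring
begin

lemma gr_hom_zero: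
  assumes "gmod M" "gmod N" and u: "u \<in> ghom M N"
  shows "u \<zero>\<^bsub>M\<^esub> = \<zero>\<^bsub>N\<^esub>"
proof -
  interpret M: graded_module G R M by fact
  interpret N: graded_module G R N by fact
  show ?thesis
    using gr_homD(4)[OF u, of "\<zero>\<^bsub>R\<^esub>" "\<zero>\<^bsub>M\<^esub>"] gr_homD(2)[OF u, of "\<zero>\<^bsub>M\<^esub>"] by simp
qed

lemma gr_hom_minus:
  assumes "gmod M" "gmod N" and u: "u \<in> ghom M N" and x: "x \<in> carrier M"
  shows "u (\<ominus>\<^bsub>M\<^esub> x) = \<ominus>\<^bsub>N\<^esub> u x"
proof -
  interpret M: graded_module G R M by fact
  interpret N: graded_module G R N by fact
  show ?thesis
    using gr_homD(4)[OF u, of "\<ominus>\<^bsub>R\<^esub> \<one>\<^bsub>R\<^esub>" x] gr_homD(2)[OF u x] x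
    by (simp add: M.uminus_eq_smult N.uminus_eq_smult)
qed

lemma gr_hom_cmp:
  assumes "gmod M" "gmod N" and u: "u \<in> ghom M N" and "x \<in> carrier M" "g \<in> carrier G"
  shows "u (mcmp M x g) = mcmp N (u x) g"
proof -
  interpret M: graded_module G R M by fact
  interpret N: graded_module G R N by fact
  show ?thesis
    by (rule additive_map_component[OF M.MD.direct_sum_axioms N.MD.direct_sum_axioms])
      (use assms gr_homD[OF u] in auto)
qed

lemma gr_hom_inj_iff:
  assumes "gmod M" "gmod N" and u: "u \<in> ghom M N"
  shows "inj_on u (carrier M) \<longleftrightarrow> (\<forall>x\<in>carrier M. u x = \<zero>\<^bsub>N\<^esub> \<longrightarrow> x = \<zero>\<^bsub>M\<^esub>)"
proof -
  interpret M: graded_module G R M by fact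
  interpret N: graded_module G R N by fact
  note [simp] = gr_homD(2,3)[OF u] gr_hom_minus[OF assms] gr_hom_zero[OF assms]
  show ?thesis
  proof (intro iffI ballI impI inj_onI)
    fix x y assume *: "\<forall>x\<in>carrier M. u x = \<zero>\<^bsub>N\<^esub> \<longrightarrow> x = \<zero>\<^bsub>M\<^esub>"
      and xy: "x \<in> carrier M" "y \<in> carrier M" "u x = u y"
    then have "u (x \<oplus>\<^bsub>M\<^esub> \<ominus>\<^bsub>M\<^esub> y) = \<zero>\<^bsub>N\<^esub>"
      by (simp add: N.r_neg)
    then have "x \<oplus>\<^bsub>M\<^esub> \<ominus>\<^bsub>M\<^esub> y = \<zero>\<^bsub>M\<^esub>" using * xy by simp
    then show "x = y" using xy M.M.minus_equality[of x "\<ominus>\<^bsub>M\<^esub> y"] by simp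
  next
    fix x assume "inj_on u (carrier M)" "x \<in> carrier M" "u x = \<zero>\<^bsub>N\<^esub>"
    then show "x = \<zero>\<^bsub>M\<^esub>" using inj_onD[of u "carrier M" x "\<zero>\<^bsub>M\<^esub>"] by simp
  qed
qed

end

section \<open>Subquotients\<close>

text \<open>
  Quotients by cosets would leave the type of \<open>N\<close>, while injectivity and flatness are tested on
  modules in a fixed type. So the classes are named by the values of a map \<open>q\<close>, which may lie in
  any type. With an injective \<open>q\<close> this is a copy of the submodule \<open>S\<close>; with a choice of
  representatives for \<open>q\<close> it is a quotient.
\<close>

definition subquot :: "('r, 'n, 'g) gmodule \<Rightarrow> 'n set \<Rightarrow> ('n \<Rightarrow> 'q) \<Rightarrow> ('r, 'q, 'g) gmodule" where
  "subquot N S q =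
     \<lparr>carrier = q ` S, monoid.mult = undefined, one = undefined, ring.zero = q \<zero>\<^bsub>N\<^esub>,
      ring.add = (\<lambda>a b. q (inv_into S q a \<oplus>\<^bsub>N\<^esub> inv_into S q b)),
      smult = (\<lambda>r a. q (r \<odot>\<^bsub>N\<^esub> inv_into S q a)),
      mod_comp = (\<lambda>g. q ` (S \<inter> mod_comp N g))\<rparr>"

locale subquotient = graded_module G R N
  for G :: "('g, 'j) monoid_scheme" and R :: "('r, 'g, 'k) gring_scheme"
    and N :: "('r, 'n, 'g) gmodule" +
  fixes S :: "'n set" and q :: "'n \<Rightarrow> 'q"
  assumes S_sub: "S \<subseteq> carrier N"
    and S_zero: "\<zero>\<^bsub>N\<^esub> \<in> S"
    and S_add: "\<lbrakk>x \<in> S; y \<in> S\<rbrakk> \<Longrightarrow> x \<oplus>\<^bsub>N\<^esub> y \<in> S"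
    and S_smult: "\<lbrakk>a \<in> carrier R; x \<in> S\<rbrakk> \<Longrightarrow> a \<odot>\<^bsub>N\<^esub> x \<in> S"
    and S_cmp: "\<lbrakk>x \<in> S; g \<in> carrier G\<rbrakk> \<Longrightarrow> mcmp N x g \<in> S"
    and q_add: "\<lbrakk>x \<in> S; y \<in> S; z \<in> S; q x = q y\<rbrakk> \<Longrightarrow> q (x \<oplus>\<^bsub>N\<^esub> z) = q (y \<oplus>\<^bsub>N\<^esub> z)"
    and q_smult: "\<lbrakk>a \<in> carrier R; x \<in> S; y \<in> S; q x = q y\<rbrakk> \<Longrightarrow> q (a \<odot>\<^bsub>N\<^esub> x) = q (a \<odot>\<^bsub>N\<^esub> y)"
    and q_cmp: "\<lbrakk>x \<in> S; y \<in> S; g \<in> carrier G; q x = q y\<rbrakk> \<Longrightarrow> q (mcmp N x g) = q (mcmp N y g)"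
begin

abbreviation Q :: "('r, 'q, 'g) gmodule" where "Q \<equiv> subquot N S q"

lemma carrier_Q [simp]: "carrier Q = q ` S"
  and zero_Q [simp]: "\<zero>\<^bsub>Q\<^esub> = q \<zero>\<^bsub>N\<^esub>"
  and mod_comp_Q [simp]: "mod_comp Q g = q ` (S \<inter> mod_comp N g)"
  by (simp_all add: subquot_def)

lemma S_carrier [simp]: "x \<in> S \<Longrightarrow> x \<in> carrier N"
  using S_sub by blast

lemma rep: "x \<in> S \<Longrightarrow> inv_into S q (q x) \<in> S \<and> q (inv_into S q (q x)) = q x"
  by (simp add: inv_into_into f_inv_into_f)

lemma add_Q [simp]:
  assumes "x \<in> S" "y \<in> S"
  shows "q x \<oplus>\<^bsub>Q\<^esub> q y = q (x \<oplus>\<^bsub>N\<^esub> y)"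
proof -
  let ?x = "inv_into S q (q x)" and ?y = "inv_into S q (q y)"
  have "q (?x \<oplus>\<^bsub>N\<^esub> ?y) = q (x \<oplus>\<^bsub>N\<^esub> ?y)"
    using rep assms by (intro q_add) auto
  also have "\<dots> = q (?y \<oplus>\<^bsub>N\<^esub> x)"
    using rep[OF assms(2)] assms by (simp add: M.a_comm)
  also have "\<dots> = q (y \<oplus>\<^bsub>N\<^esub> x)"
    using rep assms by (intro q_add) auto
  finally show ?thesis
    using assms by (simp add: subquot_def M.a_comm)
qed

lemma smult_Q [simp]:
  assumes "a \<in> carrier R" "x \<in> S"
  shows "a \<odot>\<^bsub>Q\<^esub> q x = q (a \<odot>\<^bsub>N\<^esub> x)"
  using rep[OF assms(2)] assms by (auto simp: subquot_def intro: q_smult)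

lemma abelian_group_Q: "abelian_group Q"
proof (rule abelian_groupI)
  fix x assume "x \<in> carrier Q"
  then obtain s where s: "s \<in> S" "x = q s" by auto
  then have "\<ominus>\<^bsub>N\<^esub> s \<in> S" by (simp add: uminus_eq_smult S_smult)
  then show "\<exists>y\<in>carrier Q. y \<oplus>\<^bsub>Q\<^esub> x = \<zero>\<^bsub>Q\<^esub>"
    using s by (intro bexI[of _ "q (\<ominus>\<^bsub>N\<^esub> s)"]) (auto simp: M.l_neg)
qed (auto simp: S_add S_zero M.a_ac)

lemma graded_module_Q: "graded_module G R Q"
proof -
  interpret Q: abelian_group Q by (rule abelian_group_Q)
  let ?p = "\<lambda>g a. q (mcmp N (inv_into S q a) g)"
  have p: "?p g (q x) = q (mcmp N x g)" if "x \<in> S" "g \<in> carrier G" for x g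
    using that rep by (intro q_cmp) auto
  have *: "is_direct_sum (carrier G) Q (mod_comp Q) \<and>
    (\<forall>g\<in>carrier G. \<forall>a\<in>carrier Q. mcmp Q a g = ?p g a)"
  proof (rule is_direct_sumI[of Q "carrier G" "mod_comp Q" ?p])
    fix g assume g: "g \<in> carrier G"
    show "additive_subgroup (mod_comp Q g) Q"
    proof (rule Q.additive_subgroupI)
      fix a assume "a \<in> mod_comp Q g"
      then obtain x where x: "x \<in> S" "x \<in> mod_comp N g" "a = q x" by auto
      then have m: "\<ominus>\<^bsub>N\<^esub> x \<in> S" "\<ominus>\<^bsub>N\<^esub> x \<in> mod_comp N g"
        using g by (simp add: uminus_eq_smult S_smult) (simp add: MD.comp_minus x g)
      then have "\<ominus>\<^bsub>Q\<^esub> a = q (\<ominus>\<^bsub>N\<^esub> x)"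
        using x by (intro Q.minus_equality) (auto simp: M.l_neg)
      then show "\<ominus>\<^bsub>Q\<^esub> a \<in> mod_comp Q g" using m by auto
    next
      fix a b assume "a \<in> mod_comp Q g" "b \<in> mod_comp Q g"
      then show "a \<oplus>\<^bsub>Q\<^esub> b \<in> mod_comp Q g"
        using g by (auto simp: S_add MD.comp_add)
    qed (use g S_zero in auto)
  next
    fix P a assume a: "a \<in> carrier Q" and P0: "P \<zero>\<^bsub>Q\<^esub>"
      and Ph: "\<And>g x. \<lbrakk>g \<in> carrier G; x \<in> mod_comp Q g\<rbrakk> \<Longrightarrow> P x"
      and Pa: "\<And>x y. \<lbrakk>x \<in> carrier Q; y \<in> carrier Q; P x; P y\<rbrakk> \<Longrightarrow> P (x \<oplus>\<^bsub>Q\<^esub> y)"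
    from a obtain x where x: "x \<in> S" "a = q x" by auto
    have "x \<in> S \<and> P (q x)"
    proof (rule MD.cmp_induct[of x "\<lambda>x. x \<in> S \<and> P (q x)"])
      fix g assume "g \<in> carrier G"
      then show "mcmp N x g \<in> S \<and> P (q (mcmp N x g))"
        using x S_cmp MD.cmp_in by (auto intro!: Ph)
    next
      fix x y assume "x \<in> S \<and> P (q x)" "y \<in> S \<and> P (q y)"
      then show "x \<oplus>\<^bsub>N\<^esub> y \<in> S \<and> P (q (x \<oplus>\<^bsub>N\<^esub> y))"
        using Pa[of "q x" "q y"] by (auto simp: S_add)
    qed (use x P0 S_zero in auto)
    then show "P a" using x by simp
  qed (use abelian_group_Q in \<open>auto simp: p S_add S_cmp MD.cmp_add MD.cmp_homog\<close>)
  show ?thesis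
  proof (rule graded_moduleI)
    fix g h a x assume "g \<in> carrier G" "h \<in> carrier G" "a \<in> ring_comp R g" "x \<in> mod_comp Q h"
    then show "a \<odot>\<^bsub>Q\<^esub> x \<in> mod_comp Q (g \<otimes>\<^bsub>G\<^esub> h)"
      by (auto simp: S_smult mod_comp_smult)
  qed (use abelian_group_Q * in \<open>auto simp: S_smult S_add smult_l_distr smult_r_distr smult_assoc1\<close>)
qed

end

context graded_ring
begin

text \<open>This is $R(-g)$: its element 1 has degree $g$, so it maps to any homogeneous element of that degree.\<close>

definition regular :: "'g \<Rightarrow> ('r, 'r, 'g) gmodule" where
  "regular g = \<lparr>carrier = carrier R, monoid.mult = undefined, one = undefined,
     ring.zero = \<zero>\<^bsub>R\<^esub>, ring.add = ring.add R, smult = monoid.mult R,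
     mod_comp = (\<lambda>h. ring_comp R (inv\<^bsub>G\<^esub> g \<otimes>\<^bsub>G\<^esub> h))\<rparr>"

lemma regular_simps [simp]:
  "carrier (regular g) = carrier R" "\<zero>\<^bsub>regular g\<^esub> = \<zero>\<^bsub>R\<^esub>"
  "x \<oplus>\<^bsub>regular g\<^esub> y = x \<oplus>\<^bsub>R\<^esub> y" "x \<odot>\<^bsub>regular g\<^esub> y = x \<otimes>\<^bsub>R\<^esub> y"
  "mod_comp (regular g) h = ring_comp R (inv\<^bsub>G\<^esub> g \<otimes>\<^bsub>G\<^esub> h)"
  by (simp_all add: regular_def)

lemma
  assumes g: "g \<in> carrier G"
  shows graded_module_regular: "gmod (regular g)"
    and cmp_regular: "\<lbrakk>x \<in> carrier R; h \<in> carrier G\<rbrakk> \<Longrightarrow>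
      mcmp (regular g) x h = rcmp x (inv\<^bsub>G\<^esub> g \<otimes>\<^bsub>G\<^esub> h)"
proof -
  let ?N = "regular g"
  have ab: "abelian_group ?N"
    by (rule abelian_groupI) (auto simp: R.a_ac intro: R.l_neg)
  interpret N: abelian_group ?N by fact
  have minus: "\<ominus>\<^bsub>?N\<^esub> x = \<ominus>\<^bsub>R\<^esub> x" if "x \<in> carrier R" for x
    using that by (intro N.minus_equality) (auto simp: R.l_neg)
  have *: "is_direct_sum (carrier G) ?N (mod_comp ?N) \<and>
    (\<forall>h\<in>carrier G. \<forall>x\<in>carrier ?N. mcmp ?N x h = rcmp x (inv\<^bsub>G\<^esub> g \<otimes>\<^bsub>G\<^esub> h))"
  proof (rule is_direct_sumI[of ?N "carrier G" "mod_comp ?N" "\<lambda>h x. rcmp x (inv\<^bsub>G\<^esub> g \<otimes>\<^bsub>G\<^esub> h)"])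
    fix h assume "h \<in> carrier G"
    then have h: "inv\<^bsub>G\<^esub> g \<otimes>\<^bsub>G\<^esub> h \<in> carrier G" using g by simp
    show "additive_subgroup (mod_comp ?N h) ?N"
    proof (rule N.additive_subgroupI)
      show "\<And>x. x \<in> mod_comp ?N h \<Longrightarrow> \<ominus>\<^bsub>?N\<^esub> x \<in> mod_comp ?N h"
        using h RD.comp_sub by (simp add: minus RD.comp_minus)
    qed (use h in \<open>auto simp: RD.comp_add\<close>)
  next
    fix h k x assume "h \<in> carrier G" "k \<in> carrier G" "x \<in> mod_comp ?N h" "k \<noteq> h"
    then show "rcmp x (inv\<^bsub>G\<^esub> g \<otimes>\<^bsub>G\<^esub> k) = \<zero>\<^bsub>?N\<^esub>"
      using g RD.cmp_homog[of x "inv\<^bsub>G\<^esub> g \<otimes>\<^bsub>G\<^esub> h" "inv\<^bsub>G\<^esub> g \<otimes>\<^bsub>G\<^esub> k"]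
        inv_cancel(2)[of h g] inv_cancel(2)[of k g] by auto
  next
    fix P x assume x: "x \<in> carrier ?N" and P0: "P \<zero>\<^bsub>?N\<^esub>"
      and Ph: "\<And>h x. \<lbrakk>h \<in> carrier G; x \<in> mod_comp ?N h\<rbrakk> \<Longrightarrow> P x"
      and Pa: "\<And>x y. \<lbrakk>x \<in> carrier ?N; y \<in> carrier ?N; P x; P y\<rbrakk> \<Longrightarrow> P (x \<oplus>\<^bsub>?N\<^esub> y)"
    have "x \<in> carrier R" using x by simp
    then show "P x"
    proof (induction rule: RD.homog_induct)
      case (homog h x)
      then show ?case using Ph[of "g \<otimes>\<^bsub>G\<^esub> h" x] g by simp
    qed (use P0 Pa in auto)
  qed (use g ab in \<open>auto simp: RD.cmp_add RD.cmp_homog\<close>)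
  show "gmod ?N"
  proof (rule graded_moduleI)
    fix h k a x assume hk: "h \<in> carrier G" "k \<in> carrier G" "a \<in> ring_comp R h" "x \<in> mod_comp ?N k"
    then have "h \<otimes>\<^bsub>G\<^esub> (inv\<^bsub>G\<^esub> g \<otimes>\<^bsub>G\<^esub> k) = inv\<^bsub>G\<^esub> g \<otimes>\<^bsub>G\<^esub> (h \<otimes>\<^bsub>G\<^esub> k)"
      using g by (simp add: G.m_lcomm)
    then show "a \<odot>\<^bsub>?N\<^esub> x \<in> mod_comp ?N (h \<otimes>\<^bsub>G\<^esub> k)"
      using ring_comp_mult[of h "inv\<^bsub>G\<^esub> g \<otimes>\<^bsub>G\<^esub> k" a x] hk g by simp
  qed (use ab * in \<open>auto simp: R.m_assoc R.l_distr R.r_distr\<close>)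
  show "mcmp ?N x h = rcmp x (inv\<^bsub>G\<^esub> g \<otimes>\<^bsub>G\<^esub> h)" if "x \<in> carrier R" "h \<in> carrier G"
    using * that by simp
qed

end


section \<open>Baer's criterion\<close>

lemma (in subquotient) subquot_lift:
  assumes E: "graded_module G R E"
    and f: "\<And>x. x \<in> S \<Longrightarrow> f x \<in> carrier E"
    and f_eq: "\<And>x y. \<lbrakk>x \<in> S; y \<in> S; q x = q y\<rbrakk> \<Longrightarrow> f x = f y"
    and f_add: "\<And>x y. \<lbrakk>x \<in> S; y \<in> S\<rbrakk> \<Longrightarrow> f (x \<oplus>\<^bsub>N\<^esub> y) = f x \<oplus>\<^bsub>E\<^esub> f y"
    and f_smult: "\<And>a x. \<lbrakk>a \<in> carrier R; x \<in> S\<rbrakk> \<Longrightarrow> f (a \<odot>\<^bsub>N\<^esub> x) = a \<odot>\<^bsub>E\<^esub> f x"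
    and f_comp: "\<And>g x. \<lbrakk>g \<in> carrier G; x \<in> S; x \<in> mod_comp N g\<rbrakk> \<Longrightarrow> f x \<in> mod_comp E g"
  obtains h where "h \<in> gr_hom G R Q E" "\<And>x. x \<in> S \<Longrightarrow> h (q x) = f x"
proof
  let ?h = "\<lambda>a\<in>q ` S. f (inv_into S q a)"
  show h: "?h (q x) = f x" if "x \<in> S" for x
    using that rep[OF that] f_eq[of "inv_into S q (q x)" x] by simp
  show "?h \<in> gr_hom G R Q E"
  proof (rule gr_homI)
    fix a b assume "a \<in> carrier Q" "b \<in> carrier Q"
    then obtain x y where "a = q x" "b = q y" "x \<in> S" "y \<in> S" by auto
    then show "?h (a \<oplus>\<^bsub>Q\<^esub> b) = ?h a \<oplus>\<^bsub>E\<^esub> ?h b"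
      using h S_add f_add by simp
  next
    fix r a assume r: "r \<in> carrier R" and "a \<in> carrier Q"
    then obtain x where "a = q x" "x \<in> S" by auto
    then show "?h (r \<odot>\<^bsub>Q\<^esub> a) = r \<odot>\<^bsub>E\<^esub> ?h a"
      using h r S_smult f_smult by simp
  next
    fix g a assume g: "g \<in> carrier G" and "a \<in> mod_comp Q g"
    then obtain x where "a = q x" "x \<in> S" "x \<in> mod_comp N g" by auto
    then show "?h a \<in> mod_comp E g"
      using h g f_comp by simp
  next
    fix a assume "a \<in> carrier Q"
    then show "?h a \<in> carrier E" using h f by auto
  qed auto
qed

context graded_ring
begin

lemma gr_injectiveD:
  fixes A B :: "('r, 'u, 'g) gmodule"
  assumes "gr_injective TYPE('u) G R E" "gmod A" "gmod B" "u \<in> ghom A B" "inj_on u (carrier A)"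
    "f \<in> ghom A E"
  obtains h where "h \<in> ghom B E" "\<And>x. x \<in> carrier A \<Longrightarrow> h (u x) = f x"
proof -
  obtain h where h: "h \<in> ghom B E" "compose (carrier A) h u = f"
    using assms unfolding gr_injective_def by blast
  then have "h (u x) = f x" if "x \<in> carrier A" for x
    using that by (auto simp: compose_def)
  with h that show thesis by blast
qed

text \<open>
  This is the only use of injectivity in Baer's argument: both the ideal and the shifted ring are
  copied along an embedding of \<open>R\<close> into the type of test modules.
\<close>

lemma extend_from_graded_ideal:
  fixes E :: "('r, 'e, 'g) gmodule"
  assumes small: "carrier R \<lesssim> (UNIV :: 'u set)" and inj: "gr_injective TYPE('u) G R E"
    and g: "g \<in> carrier G"
    and I: "I \<subseteq> carrier R" "\<zero>\<^bsub>R\<^esub> \<in> I" "\<And>x y. \<lbrakk>x \<in> I; y \<in> I\<rbrakk> \<Longrightarrow> x \<oplus>\<^bsub>R\<^esub> y \<in> I"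
      "\<And>a x. \<lbrakk>a \<in> carrier R; x \<in> I\<rbrakk> \<Longrightarrow> a \<otimes>\<^bsub>R\<^esub> x \<in> I"
      "\<And>h x. \<lbrakk>h \<in> carrier G; x \<in> I\<rbrakk> \<Longrightarrow> rcmp x h \<in> I"
    and w: "\<And>x. x \<in> I \<Longrightarrow> w x \<in> carrier E"
      "\<And>x y. \<lbrakk>x \<in> I; y \<in> I\<rbrakk> \<Longrightarrow> w (x \<oplus>\<^bsub>R\<^esub> y) = w x \<oplus>\<^bsub>E\<^esub> w y"
      "\<And>a x. \<lbrakk>a \<in> carrier R; x \<in> I\<rbrakk> \<Longrightarrow> w (a \<otimes>\<^bsub>R\<^esub> x) = a \<odot>\<^bsub>E\<^esub> w x"
      "\<And>h x. \<lbrakk>h \<in> carrier G; x \<in> I; x \<in> ring_comp R (inv\<^bsub>G\<^esub> g \<otimes>\<^bsub>G\<^esub> h)\<rbrakk> \<Longrightarrow> w x \<in> mod_comp E h"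
  obtains v where "v \<in> ghom (regular g) E" "\<And>x. x \<in> I \<Longrightarrow> v x = w x"
proof -
  have E: "gmod E" using inj by (simp add: gr_injective_def)
  obtain \<iota> :: "'r \<Rightarrow> 'u" where \<iota>: "inj_on \<iota> (carrier R)"
    using small by (auto simp: lepoll_def)
  note inj_I = inj_on_subset[OF \<iota> I(1)]
  note [simp] = cmp_regular[OF g]
  interpret A: subquotient G R "regular g" I \<iota>
    using I inj_onD[OF inj_I] g
    by (intro subquotient.intro subquotient_axioms.intro graded_module_regular g) (auto dest: inj_onD[OF inj_I])
  interpret B: subquotient G R "regular g" "carrier R" \<iota>
    using g
    by (intro subquotient.intro subquotient_axioms.intro graded_module_regular) (auto dest: inj_onD[OF \<iota>])
  obtain u where u: "u \<in> ghom A.Q B.Q" "\<And>x. x \<in> I \<Longrightarrow> u (\<iota> x) = \<iota> x"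
    by (rule A.subquot_lift[OF B.graded_module_Q, of \<iota>]) (use I(1) in \<open>auto simp: subset_iff\<close>)
  obtain f where f: "f \<in> ghom A.Q E" "\<And>x. x \<in> I \<Longrightarrow> f (\<iota> x) = w x"
    by (rule A.subquot_lift[OF E, of w]) (use w in \<open>auto dest: inj_onD[OF inj_I]\<close>)
  have "inj_on u (carrier A.Q)"
    by (rule inj_onI) (auto simp: u(2))
  then obtain h where h: "h \<in> ghom B.Q E" "\<And>x. x \<in> carrier A.Q \<Longrightarrow> h (u x) = f x"
    using gr_injectiveD[OF inj A.graded_module_Q B.graded_module_Q u(1) _ f(1)] by blast
  let ?v = "\<lambda>r\<in>carrier R. h (\<iota> r)"
  show thesis
  proof (rule that)
    show "?v \<in> ghom (regular g) E"
    proof (rule gr_homI)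
      fix k x assume "k \<in> carrier G" "x \<in> mod_comp (regular g) k"
      then show "?v x \<in> mod_comp E k"
        using g gr_homD(5)[OF h(1), of k "\<iota> x"] RD.comp_sub[of x "inv\<^bsub>G\<^esub> g \<otimes>\<^bsub>G\<^esub> k"] by auto
    next
      fix x y assume "x \<in> carrier (regular g)" "y \<in> carrier (regular g)"
      then show "?v (x \<oplus>\<^bsub>regular g\<^esub> y) = ?v x \<oplus>\<^bsub>E\<^esub> ?v y"
        using gr_homD(3)[OF h(1), of "\<iota> x" "\<iota> y"] by simp
    next
      fix a x assume "a \<in> carrier R" "x \<in> carrier (regular g)"
      then show "?v (a \<odot>\<^bsub>regular g\<^esub> x) = a \<odot>\<^bsub>E\<^esub> ?v x"
        using gr_homD(4)[OF h(1), of a "\<iota> x"] by simp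
    qed (use gr_homD(2)[OF h(1)] in auto)
    show "?v x = w x" if "x \<in> I" for x
      using that I(1) h(2)[of "\<iota> x"] by (auto simp: u(2) f(2))
  qed
qed

text \<open>
  These are the graphs of graded linear maps to \<open>E\<close> defined on a graded submodule of \<open>B\<close>. Working
  with graphs turns extension into inclusion and upper bounds of chains into unions, as Zorn's
  lemma wants them.
\<close>

definition partial_graph :: "('r, 'b, 'g) gmodule \<Rightarrow> ('r, 'e, 'g) gmodule \<Rightarrow> ('b \<times> 'e) set \<Rightarrow> bool"
  where "partial_graph B E \<Gamma> \<longleftrightarrow> \<Gamma> \<subseteq> carrier B \<times> carrier E \<and>
    (\<forall>(b, e)\<in>\<Gamma>. \<forall>(b', e')\<in>\<Gamma>. (b \<oplus>\<^bsub>B\<^esub> b', e \<oplus>\<^bsub>E\<^esub> e') \<in> \<Gamma>) \<and>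
    (\<forall>a\<in>carrier R. \<forall>(b, e)\<in>\<Gamma>. (a \<odot>\<^bsub>B\<^esub> b, a \<odot>\<^bsub>E\<^esub> e) \<in> \<Gamma>) \<and>
    (\<forall>g\<in>carrier G. \<forall>(b, e)\<in>\<Gamma>. (mcmp B b g, mcmp E e g) \<in> \<Gamma>) \<and>
    (\<forall>e. (\<zero>\<^bsub>B\<^esub>, e) \<in> \<Gamma> \<longrightarrow> e = \<zero>\<^bsub>E\<^esub>)"

lemma partial_graphI:
  assumes "\<Gamma> \<subseteq> carrier B \<times> carrier E"
    "\<And>b e b' e'. \<lbrakk>(b, e) \<in> \<Gamma>; (b', e') \<in> \<Gamma>\<rbrakk> \<Longrightarrow> (b \<oplus>\<^bsub>B\<^esub> b', e \<oplus>\<^bsub>E\<^esub> e') \<in> \<Gamma>"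
    "\<And>a b e. \<lbrakk>a \<in> carrier R; (b, e) \<in> \<Gamma>\<rbrakk> \<Longrightarrow> (a \<odot>\<^bsub>B\<^esub> b, a \<odot>\<^bsub>E\<^esub> e) \<in> \<Gamma>"
    "\<And>g b e. \<lbrakk>g \<in> carrier G; (b, e) \<in> \<Gamma>\<rbrakk> \<Longrightarrow> (mcmp B b g, mcmp E e g) \<in> \<Gamma>"
    "\<And>e. (\<zero>\<^bsub>B\<^esub>, e) \<in> \<Gamma> \<Longrightarrow> e = \<zero>\<^bsub>E\<^esub>"
  shows "partial_graph B E \<Gamma>"
  unfolding partial_graph_def
  by (intro conjI assms(1)) (auto intro: assms(2-5))

lemma partial_graphD:
  assumes "partial_graph B E \<Gamma>"
  shows "(b, e) \<in> \<Gamma> \<Longrightarrow> b \<in> carrier B \<and> e \<in> carrier E"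
    "\<lbrakk>(b, e) \<in> \<Gamma>; (b', e') \<in> \<Gamma>\<rbrakk> \<Longrightarrow> (b \<oplus>\<^bsub>B\<^esub> b', e \<oplus>\<^bsub>E\<^esub> e') \<in> \<Gamma>"
    "\<lbrakk>a \<in> carrier R; (b, e) \<in> \<Gamma>\<rbrakk> \<Longrightarrow> (a \<odot>\<^bsub>B\<^esub> b, a \<odot>\<^bsub>E\<^esub> e) \<in> \<Gamma>"
    "\<lbrakk>g \<in> carrier G; (b, e) \<in> \<Gamma>\<rbrakk> \<Longrightarrow> (mcmp B b g, mcmp E e g) \<in> \<Gamma>"
    "(\<zero>\<^bsub>B\<^esub>, e) \<in> \<Gamma> \<Longrightarrow> e = \<zero>\<^bsub>E\<^esub>"
proof -
  have *: "\<Gamma> \<subseteq> carrier B \<times> carrier E"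
    "\<forall>(b, e)\<in>\<Gamma>. \<forall>(b', e')\<in>\<Gamma>. (b \<oplus>\<^bsub>B\<^esub> b', e \<oplus>\<^bsub>E\<^esub> e') \<in> \<Gamma>"
    "\<forall>a\<in>carrier R. \<forall>(b, e)\<in>\<Gamma>. (a \<odot>\<^bsub>B\<^esub> b, a \<odot>\<^bsub>E\<^esub> e) \<in> \<Gamma>"
    "\<forall>g\<in>carrier G. \<forall>(b, e)\<in>\<Gamma>. (mcmp B b g, mcmp E e g) \<in> \<Gamma>"
    "\<forall>e. (\<zero>\<^bsub>B\<^esub>, e) \<in> \<Gamma> \<longrightarrow> e = \<zero>\<^bsub>E\<^esub>"
    using assms by (simp_all add: partial_graph_def)
  show "(b, e) \<in> \<Gamma> \<Longrightarrow> b \<in> carrier B \<and> e \<in> carrier E" using *(1) by blast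
  show "\<lbrakk>(b, e) \<in> \<Gamma>; (b', e') \<in> \<Gamma>\<rbrakk> \<Longrightarrow> (b \<oplus>\<^bsub>B\<^esub> b', e \<oplus>\<^bsub>E\<^esub> e') \<in> \<Gamma>"
    by (drule bspec[OF *(2)], simp, drule (1) bspec, simp)
  show "\<lbrakk>a \<in> carrier R; (b, e) \<in> \<Gamma>\<rbrakk> \<Longrightarrow> (a \<odot>\<^bsub>B\<^esub> b, a \<odot>\<^bsub>E\<^esub> e) \<in> \<Gamma>"
    by (drule bspec[OF *(3)], drule (1) bspec, simp)
  show "\<lbrakk>g \<in> carrier G; (b, e) \<in> \<Gamma>\<rbrakk> \<Longrightarrow> (mcmp B b g, mcmp E e g) \<in> \<Gamma>"
    by (drule bspec[OF *(4)], drule (1) bspec, simp)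
  show "(\<zero>\<^bsub>B\<^esub>, e) \<in> \<Gamma> \<Longrightarrow> e = \<zero>\<^bsub>E\<^esub>" using *(5) by blast
qed

lemma partial_graph_unique:
  assumes "gmod B" "gmod E" and \<Gamma>: "partial_graph B E \<Gamma>" and e: "(b, e) \<in> \<Gamma>" "(b, e') \<in> \<Gamma>"
  shows "e = e'"
proof -
  interpret B: graded_module G R B by fact
  interpret E: graded_module G R E by fact
  note D = partial_graphD[OF \<Gamma>]
  have c: "b \<in> carrier B" "e \<in> carrier E" "e' \<in> carrier E" using D(1) e by blast+
  have "(\<ominus>\<^bsub>B\<^esub> b, \<ominus>\<^bsub>E\<^esub> e') \<in> \<Gamma>"
    using D(3)[of "\<ominus>\<^bsub>R\<^esub> \<one>\<^bsub>R\<^esub>", OF _ e(2)] c by (simp add: B.uminus_eq_smult E.uminus_eq_smult)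
  from D(2)[OF e(1) this] have "(\<zero>\<^bsub>B\<^esub>, e \<oplus>\<^bsub>E\<^esub> \<ominus>\<^bsub>E\<^esub> e') \<in> \<Gamma>"
    using c by (simp add: B.M.r_neg)
  then have "e \<oplus>\<^bsub>E\<^esub> \<ominus>\<^bsub>E\<^esub> e' = \<zero>\<^bsub>E\<^esub>" by (rule D(5))
  then show ?thesis using c E.M.minus_equality[of e "\<ominus>\<^bsub>E\<^esub> e'"] by simp
qed

text \<open>
  For \<open>b\<close> homogeneous of degree \<open>g\<close>, the ideal of all \<open>r\<close> with \<open>r b\<close> in the domain is graded inside
  $R(-g)$, and the partial map gives a morphism \<open>w\<close> on it. An extension \<open>v\<close> of \<open>w\<close> to $R(-g)$ tells
  where to send \<open>r b\<close>, namely to \<open>v r\<close>; the agreement of \<open>v\<close> with the partial map on the ideal is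
  exactly what makes the larger graph single-valued.
\<close>

lemma partial_graph_extend:
  assumes small: "carrier R \<lesssim> (UNIV :: 'u set)" and inj: "gr_injective TYPE('u) G R E"
    and B: "gmod B" and \<Gamma>: "partial_graph B E \<Gamma>" and ne: "\<Gamma> \<noteq> {}"
    and g: "g \<in> carrier G" and b: "b \<in> mod_comp B g"
  obtains \<Gamma>' where "partial_graph B E \<Gamma>'" "\<Gamma> \<subseteq> \<Gamma>'" "b \<in> fst ` \<Gamma>'"
proof -
  have E: "gmod E" using inj by (simp add: gr_injective_def)
  interpret B: graded_module G R B by fact
  interpret E: graded_module G R E by fact
  note D = partial_graphD[OF \<Gamma>]
  note uniq = partial_graph_unique[OF B E \<Gamma>]
  have bB: "b \<in> carrier B" using b g by blast
  have zero: "(\<zero>\<^bsub>B\<^esub>, \<zero>\<^bsub>E\<^esub>) \<in> \<Gamma>"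
  proof -
    obtain d e where "(d, e) \<in> \<Gamma>" using ne by auto
    with D(1)[OF this] D(3)[of "\<zero>\<^bsub>R\<^esub>" d e] show ?thesis by simp
  qed
  define I where "I = {r \<in> carrier R. r \<odot>\<^bsub>B\<^esub> b \<in> fst ` \<Gamma>}"
  define w where "w r = (THE e. (r \<odot>\<^bsub>B\<^esub> b, e) \<in> \<Gamma>)" for r
  have w_eq: "w r = e" if "(r \<odot>\<^bsub>B\<^esub> b, e) \<in> \<Gamma>" for r e
    unfolding w_def using that uniq by blast
  have w: "(r \<odot>\<^bsub>B\<^esub> b, w r) \<in> \<Gamma>" if "r \<in> I" for r
    using that w_eq by (auto simp: I_def)
  have I_intro: "r \<in> I" if "r \<in> carrier R" "(r \<odot>\<^bsub>B\<^esub> b, e) \<in> \<Gamma>" for r e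
    using that by (force simp: I_def)
  have IR: "r \<in> carrier R" if "r \<in> I" for r
    using that by (simp add: I_def)
  have add: "((r \<oplus>\<^bsub>R\<^esub> s) \<odot>\<^bsub>B\<^esub> b, w r \<oplus>\<^bsub>E\<^esub> w s) \<in> \<Gamma>" if "r \<in> I" "s \<in> I" for r s
    using D(2)[OF w[OF that(1)] w[OF that(2)]] that bB IR by (simp add: B.smult_l_distr)
  have mult: "((a \<otimes>\<^bsub>R\<^esub> r) \<odot>\<^bsub>B\<^esub> b, a \<odot>\<^bsub>E\<^esub> w r) \<in> \<Gamma>" if "a \<in> carrier R" "r \<in> I" for a r
    using D(3)[OF that(1) w[OF that(2)]] that bB IR by (simp add: B.smult_assoc1)
  have cmp: "(rcmp r (inv\<^bsub>G\<^esub> g \<otimes>\<^bsub>G\<^esub> h) \<odot>\<^bsub>B\<^esub> b, mcmp E (w r) h) \<in> \<Gamma>"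
    if "r \<in> I" "h \<in> carrier G" for r h
    using D(4)[OF that(2) w[OF that(1)]] that b g IR by (simp add: B.smult_homog_cmp)
  obtain v where v: "v \<in> ghom (regular g) E" and vw: "\<And>r. r \<in> I \<Longrightarrow> v r = w r"
  proof (rule extend_from_graded_ideal[OF small inj g, of I w])
    show "w r \<in> carrier E" if "r \<in> I" for r using D(1)[OF w[OF that]] by simp
    show "w (r \<oplus>\<^bsub>R\<^esub> s) = w r \<oplus>\<^bsub>E\<^esub> w s" if "r \<in> I" "s \<in> I" for r s
      using w_eq[OF add[OF that]] .
    show "w (a \<otimes>\<^bsub>R\<^esub> r) = a \<odot>\<^bsub>E\<^esub> w r" if "a \<in> carrier R" "r \<in> I" for a r
      using w_eq[OF mult[OF that]] .
    show "w r \<in> mod_comp E h" if h: "h \<in> carrier G" "r \<in> I" "r \<in> ring_comp R (inv\<^bsub>G\<^esub> g \<otimes>\<^bsub>G\<^esub> h)" for r h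
    proof -
      have "rcmp r (inv\<^bsub>G\<^esub> g \<otimes>\<^bsub>G\<^esub> h) = r" using h g by (simp add: RD.cmp_homog)
      then have "w r = mcmp E (w r) h" using w_eq[of r "mcmp E (w r) h"] cmp[OF h(2,1)] by simp
      then show ?thesis using D(1)[OF w[OF h(2)]] E.MD.cmp_in[of "w r" h] h by simp
    qed
    show "rcmp r h \<in> I" if h: "h \<in> carrier G" "r \<in> I" for r h
    proof (rule I_intro)
      show "(rcmp r h \<odot>\<^bsub>B\<^esub> b, mcmp E (w r) (g \<otimes>\<^bsub>G\<^esub> h)) \<in> \<Gamma>"
        using cmp[OF h(2), of "g \<otimes>\<^bsub>G\<^esub> h"] h g by simp
    qed (use IR h in blast)
    show "I \<subseteq> carrier R" using IR by blast
    show "\<zero>\<^bsub>R\<^esub> \<in> I" by (rule I_intro[of _ "\<zero>\<^bsub>E\<^esub>"]) (use zero bB in auto)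
  qed (use I_intro[OF _ add] I_intro[OF _ mult] IR that in auto)
  note vD = gr_homD[OF v, simplified]
  define \<Gamma>' where "\<Gamma>' = {(d \<oplus>\<^bsub>B\<^esub> r \<odot>\<^bsub>B\<^esub> b, e \<oplus>\<^bsub>E\<^esub> v r) | d e r. (d, e) \<in> \<Gamma> \<and> r \<in> carrier R}"
  have \<Gamma>'I: "(x, y) \<in> \<Gamma>'"
    if "(d, e) \<in> \<Gamma>" "r \<in> carrier R" "x = d \<oplus>\<^bsub>B\<^esub> r \<odot>\<^bsub>B\<^esub> b" "y = e \<oplus>\<^bsub>E\<^esub> v r" for x y d e r
    using that by (auto simp: \<Gamma>'_def)
  have v0: "v \<zero>\<^bsub>R\<^esub> = \<zero>\<^bsub>E\<^esub>"
    using gr_hom_zero[OF graded_module_regular[OF g] E v] by simp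
  show thesis
  proof (rule that)
    show "\<Gamma> \<subseteq> \<Gamma>'"
    proof (rule subrelI)
      fix d e assume "(d, e) \<in> \<Gamma>"
      with D(1)[OF this] show "(d, e) \<in> \<Gamma>'"
        using bB by (intro \<Gamma>'I[of d e "\<zero>\<^bsub>R\<^esub>"]) (auto simp: v0)
    qed
    have "(b, v \<one>\<^bsub>R\<^esub>) \<in> \<Gamma>'"
      using bB vD(2)[of "\<one>\<^bsub>R\<^esub>"] by (intro \<Gamma>'I[OF zero, of "\<one>\<^bsub>R\<^esub>"]) auto
    then show "b \<in> fst ` \<Gamma>'" by force
    show "partial_graph B E \<Gamma>'"
    proof (rule partial_graphI)
      show "\<Gamma>' \<subseteq> carrier B \<times> carrier E"
        using D(1) vD(2) bB by (auto simp: \<Gamma>'_def)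
    next
      fix x y x' y' assume "(x, y) \<in> \<Gamma>'" "(x', y') \<in> \<Gamma>'"
      then obtain d e r d' e' r' where
        *: "(d, e) \<in> \<Gamma>" "r \<in> carrier R" "x = d \<oplus>\<^bsub>B\<^esub> r \<odot>\<^bsub>B\<^esub> b" "y = e \<oplus>\<^bsub>E\<^esub> v r"
        "(d', e') \<in> \<Gamma>" "r' \<in> carrier R" "x' = d' \<oplus>\<^bsub>B\<^esub> r' \<odot>\<^bsub>B\<^esub> b" "y' = e' \<oplus>\<^bsub>E\<^esub> v r'"
        by (auto simp: \<Gamma>'_def)
      then show "(x \<oplus>\<^bsub>B\<^esub> x', y \<oplus>\<^bsub>E\<^esub> y') \<in> \<Gamma>'"
        using D(1)[OF *(1)] D(1)[OF *(5)] bB vD(2)[of r] vD(2)[of r'] vD(3)[of r r']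
        by (intro \<Gamma>'I[OF D(2)[OF *(1,5)], of "r \<oplus>\<^bsub>R\<^esub> r'"]) (auto simp: B.smult_l_distr B.M.a_ac E.M.a_ac)
    next
      fix a x y assume a: "a \<in> carrier R" and "(x, y) \<in> \<Gamma>'"
      then obtain d e r where
        *: "(d, e) \<in> \<Gamma>" "r \<in> carrier R" "x = d \<oplus>\<^bsub>B\<^esub> r \<odot>\<^bsub>B\<^esub> b" "y = e \<oplus>\<^bsub>E\<^esub> v r"
        by (auto simp: \<Gamma>'_def)
      then show "(a \<odot>\<^bsub>B\<^esub> x, a \<odot>\<^bsub>E\<^esub> y) \<in> \<Gamma>'"
        using a D(1)[OF *(1)] bB vD(2)[of r] vD(4)[of a r]
        by (intro \<Gamma>'I[OF D(3)[OF a *(1)], of "a \<otimes>\<^bsub>R\<^esub> r"])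
          (auto simp: B.smult_r_distr E.smult_r_distr B.smult_assoc1)
    next
      fix h x y assume h: "h \<in> carrier G" and "(x, y) \<in> \<Gamma>'"
      then obtain d e r where
        *: "(d, e) \<in> \<Gamma>" "r \<in> carrier R" "x = d \<oplus>\<^bsub>B\<^esub> r \<odot>\<^bsub>B\<^esub> b" "y = e \<oplus>\<^bsub>E\<^esub> v r"
        by (auto simp: \<Gamma>'_def)
      have "mcmp E (v r) h = v (rcmp r (inv\<^bsub>G\<^esub> g \<otimes>\<^bsub>G\<^esub> h))"
        using gr_hom_cmp[OF graded_module_regular[OF g] E v, of r h] cmp_regular[OF g] * h by simp
      then show "(mcmp B x h, mcmp E y h) \<in> \<Gamma>'"
        using * h g D(1)[OF *(1)] b bB vD(2)[of r]
        by (intro \<Gamma>'I[OF D(4)[OF h *(1)], of "rcmp r (inv\<^bsub>G\<^esub> g \<otimes>\<^bsub>G\<^esub> h)"])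
          (auto simp: B.MD.cmp_add E.MD.cmp_add B.smult_homog_cmp)
    next
      fix y assume "(\<zero>\<^bsub>B\<^esub>, y) \<in> \<Gamma>'"
      then obtain d e r where
        *: "(d, e) \<in> \<Gamma>" "r \<in> carrier R" "\<zero>\<^bsub>B\<^esub> = d \<oplus>\<^bsub>B\<^esub> r \<odot>\<^bsub>B\<^esub> b" "y = e \<oplus>\<^bsub>E\<^esub> v r"
        by (auto simp: \<Gamma>'_def)
      have de: "d \<in> carrier B" "e \<in> carrier E" using D(1)[OF *(1)] by auto
      have "r \<odot>\<^bsub>B\<^esub> b = \<ominus>\<^bsub>B\<^esub> d"
        using * de bB B.M.minus_equality[of "r \<odot>\<^bsub>B\<^esub> b" d] by (simp add: B.M.a_comm)
      then have "(r \<odot>\<^bsub>B\<^esub> b, \<ominus>\<^bsub>E\<^esub> e) \<in> \<Gamma>"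
        using D(3)[of "\<ominus>\<^bsub>R\<^esub> \<one>\<^bsub>R\<^esub>", OF _ *(1)] de by (simp add: B.uminus_eq_smult E.uminus_eq_smult)
      then have "v r = \<ominus>\<^bsub>E\<^esub> e"
        using vw[OF I_intro[OF *(2)]] w_eq by simp
      then show "y = \<zero>\<^bsub>E\<^esub>" using * de by (simp add: E.M.r_neg)
    qed
  qed
qed

text \<open>
  Baer's argument: testing against modules in a type into which \<open>R\<close> embeds suffices for
  extension along monomorphisms of arbitrary types.
\<close>

proposition gr_injective_extend:
  fixes A :: "('r, 'a, 'g) gmodule" and B :: "('r, 'b, 'g) gmodule" and E :: "('r, 'e, 'g) gmodule"
  assumes small: "carrier R \<lesssim> (UNIV :: 'u set)" and inj: "gr_injective TYPE('u) G R E"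
    and A: "gmod A" and B: "gmod B" and u: "u \<in> ghom A B" "inj_on u (carrier A)" and f: "f \<in> ghom A E"
  obtains h where "h \<in> ghom B E" "\<And>x. x \<in> carrier A \<Longrightarrow> h (u x) = f x"
proof -
  have E: "gmod E" using inj by (simp add: gr_injective_def)
  interpret A: graded_module G R A by fact
  interpret B: graded_module G R B by fact
  interpret E: graded_module G R E by fact
  define \<Gamma>\<^sub>0 where "\<Gamma>\<^sub>0 = (\<lambda>x. (u x, f x)) ` carrier A"
  note uD = gr_homD[OF u(1)] and fD = gr_homD[OF f]
  have \<Gamma>0: "partial_graph B E \<Gamma>\<^sub>0"
  proof (rule partial_graphI)
    fix e assume "(\<zero>\<^bsub>B\<^esub>, e) \<in> \<Gamma>\<^sub>0"
    then show "e = \<zero>\<^bsub>E\<^esub>"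
      using gr_hom_inj_iff[OF A B u(1)] u(2) gr_hom_zero[OF A E f] by (auto simp: \<Gamma>\<^sub>0_def)
  next
    fix g b e assume "g \<in> carrier G" "(b, e) \<in> \<Gamma>\<^sub>0"
    then show "(mcmp B b g, mcmp E e g) \<in> \<Gamma>\<^sub>0"
      using gr_hom_cmp[OF A B u(1)] gr_hom_cmp[OF A E f]
      by (auto simp: \<Gamma>\<^sub>0_def intro!: image_eqI[of _ _ "mcmp A _ g"])
  next
    fix b e b' e' assume "(b, e) \<in> \<Gamma>\<^sub>0" "(b', e') \<in> \<Gamma>\<^sub>0"
    then obtain x y where "x \<in> carrier A" "y \<in> carrier A" "b = u x" "e = f x" "b' = u y" "e' = f y"
      by (auto simp: \<Gamma>\<^sub>0_def)
    then show "(b \<oplus>\<^bsub>B\<^esub> b', e \<oplus>\<^bsub>E\<^esub> e') \<in> \<Gamma>\<^sub>0"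
      using uD(3) fD(3) by (auto simp: \<Gamma>\<^sub>0_def intro!: image_eqI[of _ _ "x \<oplus>\<^bsub>A\<^esub> y"])
  next
    fix a b e assume a: "a \<in> carrier R" and "(b, e) \<in> \<Gamma>\<^sub>0"
    then obtain x where "x \<in> carrier A" "b = u x" "e = f x"
      by (auto simp: \<Gamma>\<^sub>0_def)
    then show "(a \<odot>\<^bsub>B\<^esub> b, a \<odot>\<^bsub>E\<^esub> e) \<in> \<Gamma>\<^sub>0"
      using a uD(4) fD(4) by (auto simp: \<Gamma>\<^sub>0_def intro!: image_eqI[of _ _ "a \<odot>\<^bsub>A\<^esub> x"])
  qed (use uD(2) fD(2) in \<open>auto simp: \<Gamma>\<^sub>0_def\<close>)
  let ?Z = "{\<Gamma>. partial_graph B E \<Gamma> \<and> \<Gamma>\<^sub>0 \<subseteq> \<Gamma>}"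
  have "\<exists>\<Gamma>\<in>?Z. \<forall>X\<in>?Z. \<Gamma> \<subseteq> X \<longrightarrow> X = \<Gamma>"
  proof (rule subset_Zorn_nonempty)
    show "?Z \<noteq> {}" using \<Gamma>0 by blast
  next
    fix \<C> assume ne: "\<C> \<noteq> {}" and ch: "subset.chain ?Z \<C>"
    have pg: "partial_graph B E \<Gamma>" "\<Gamma>\<^sub>0 \<subseteq> \<Gamma>" if "\<Gamma> \<in> \<C>" for \<Gamma>
      using ch that by (auto simp: subset_chain_def)
    have "partial_graph B E (\<Union>\<C>)"
    proof (rule partial_graphI)
      fix b e b' e' assume "(b, e) \<in> \<Union>\<C>" "(b', e') \<in> \<Union>\<C>"
      then obtain X Y where XY: "(b, e) \<in> X" "(b', e') \<in> Y" "X \<in> \<C>" "Y \<in> \<C>" by blast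
      with ch have "X \<subseteq> Y \<or> Y \<subseteq> X" by (auto simp: subset_chain_def)
      then obtain W where "(b, e) \<in> W" "(b', e') \<in> W" "W \<in> \<C>" using XY by blast
      then show "(b \<oplus>\<^bsub>B\<^esub> b', e \<oplus>\<^bsub>E\<^esub> e') \<in> \<Union>\<C>"
        using partial_graphD(2)[OF pg(1)[of W]] by blast
    next
      show "\<Union>\<C> \<subseteq> carrier B \<times> carrier E"
      proof (rule subrelI)
        fix b e assume "(b, e) \<in> \<Union>\<C>"
        then obtain X where "(b, e) \<in> X" "X \<in> \<C>" by blast
        then show "(b, e) \<in> carrier B \<times> carrier E"
          using partial_graphD(1)[OF pg(1)[of X]] by blast
      qed
    next
      fix a b e assume a: "a \<in> carrier R" and "(b, e) \<in> \<Union>\<C>"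
      then obtain X where "(b, e) \<in> X" "X \<in> \<C>" by blast
      then show "(a \<odot>\<^bsub>B\<^esub> b, a \<odot>\<^bsub>E\<^esub> e) \<in> \<Union>\<C>"
        using partial_graphD(3)[OF pg(1)[of X] a] by blast
    next
      fix g b e assume g: "g \<in> carrier G" and "(b, e) \<in> \<Union>\<C>"
      then obtain X where "(b, e) \<in> X" "X \<in> \<C>" by blast
      then show "(mcmp B b g, mcmp E e g) \<in> \<Union>\<C>"
        using partial_graphD(4)[OF pg(1)[of X] g] by blast
    next
      fix e assume "(\<zero>\<^bsub>B\<^esub>, e) \<in> \<Union>\<C>"
      then obtain X where "(\<zero>\<^bsub>B\<^esub>, e) \<in> X" "X \<in> \<C>" by blast
      then show "e = \<zero>\<^bsub>E\<^esub>"
        using partial_graphD(5)[OF pg(1)[of X]] by blast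
    qed
    then show "\<Union>\<C> \<in> ?Z" using ne pg(2) by blast
  qed
  then obtain \<Gamma> where \<Gamma>: "partial_graph B E \<Gamma>" "\<Gamma>\<^sub>0 \<subseteq> \<Gamma>"
    and max: "\<And>X. \<lbrakk>partial_graph B E X; \<Gamma> \<subseteq> X\<rbrakk> \<Longrightarrow> X = \<Gamma>"
    by (auto dest: subset_trans)
  note D = partial_graphD[OF \<Gamma>(1)]
  note uniq = partial_graph_unique[OF B E \<Gamma>(1)]
  have "(u \<zero>\<^bsub>A\<^esub>, f \<zero>\<^bsub>A\<^esub>) \<in> \<Gamma>\<^sub>0" by (simp add: \<Gamma>\<^sub>0_def)
  then have ne: "\<Gamma> \<noteq> {}" and zero: "(\<zero>\<^bsub>B\<^esub>, \<zero>\<^bsub>E\<^esub>) \<in> \<Gamma>"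
    using \<Gamma>(2) by (auto simp: gr_hom_zero[OF A B u(1)] gr_hom_zero[OF A E f])
  have total: "b \<in> fst ` \<Gamma>" if "b \<in> carrier B" for b
    using that
  proof (induction rule: B.MD.homog_induct)
    case zero
    then show ?case using \<open>(\<zero>\<^bsub>B\<^esub>, \<zero>\<^bsub>E\<^esub>) \<in> \<Gamma>\<close> by force
  next
    case (homog g b)
    then show ?case
      using partial_graph_extend[OF small inj B \<Gamma>(1) ne, of g b] max by metis
  next
    case (add x y)
    then show ?case using D(2) by (force simp: image_iff)
  qed
  define h where "h = (\<lambda>b\<in>carrier B. THE e. (b, e) \<in> \<Gamma>)"
  have h_eq: "h b = e" if "(b, e) \<in> \<Gamma>" for b e
    using that D(1)[OF that] uniq by (auto simp: h_def)
  have h_in: "(b, h b) \<in> \<Gamma>" if "b \<in> carrier B" for b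
    using total[OF that] h_eq by auto
  show thesis
  proof (rule that)
    show "h (u x) = f x" if "x \<in> carrier A" for x
      using that \<Gamma>(2) by (intro h_eq) (auto simp: \<Gamma>\<^sub>0_def)
    show "h \<in> ghom B E"
    proof (rule gr_homI)
      fix g b assume gb: "g \<in> carrier G" "b \<in> mod_comp B g"
      then have b: "b \<in> carrier B" by blast
      have "h (mcmp B b g) = mcmp E (h b) g"
        using h_eq[OF D(4)[OF gb(1) h_in[OF b]]] .
      then show "h b \<in> mod_comp E g"
        using gb b D(1)[OF h_in[OF b]] E.MD.cmp_in[of "h b" g] by (simp add: B.MD.cmp_homog)
    next
      show "h (x \<oplus>\<^bsub>B\<^esub> y) = h x \<oplus>\<^bsub>E\<^esub> h y" if "x \<in> carrier B" "y \<in> carrier B" for x y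
        using that by (intro h_eq D(2) h_in)
      show "h (a \<odot>\<^bsub>B\<^esub> x) = a \<odot>\<^bsub>E\<^esub> h x" if "a \<in> carrier R" "x \<in> carrier B" for a x
        using that by (intro h_eq D(3) h_in)
      show "h x \<in> carrier E" if "x \<in> carrier B" for x
        using D(1)[OF h_in[OF that]] by simp
    qed (simp add: h_def)
  qed
qed

text \<open>
  The cyclic module generated by \<open>x\<close> is a quotient of $R(-g)$, hence lives in any type into
  which \<open>R\<close> embeds; the cogenerator detects it, and injectivity carries the resulting
  morphism over to all of \<open>N\<close>.
\<close>

proposition gr_cogenerator_separates:
  fixes N :: "('r, 'n, 'g) gmodule" and E :: "('r, 'e, 'g) gmodule"
  assumes small: "carrier R \<lesssim> (UNIV :: 'u set)" and inj: "gr_injective TYPE('u) G R E"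
    and cogen: "gr_cogenerator TYPE('u) G R E"
    and N: "gmod N" and g: "g \<in> carrier G" and x: "x \<in> mod_comp N g" "x \<noteq> \<zero>\<^bsub>N\<^esub>"
  obtains h where "h \<in> ghom N E" "h x \<noteq> \<zero>\<^bsub>E\<^esub>"
proof -
  have E: "gmod E" using inj by (simp add: gr_injective_def)
  interpret N: graded_module G R N by fact
  interpret E: graded_module G R E by fact
  have xN: "x \<in> carrier N" using x g by blast
  obtain \<iota> :: "'r \<Rightarrow> 'u" where \<iota>: "inj_on \<iota> (carrier R)"
    using small by (auto simp: lepoll_def)
  define s where "s r = (SOME r'. r' \<in> carrier R \<and> r' \<odot>\<^bsub>N\<^esub> x = r \<odot>\<^bsub>N\<^esub> x)" for r
  define q where "q r = \<iota> (s r)" for r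
  have s: "s r \<in> carrier R \<and> s r \<odot>\<^bsub>N\<^esub> x = r \<odot>\<^bsub>N\<^esub> x" if "r \<in> carrier R" for r
    unfolding s_def by (rule someI) (use that in auto)
  have q_iff: "q r = q r' \<longleftrightarrow> r \<odot>\<^bsub>N\<^esub> x = r' \<odot>\<^bsub>N\<^esub> x" if "r \<in> carrier R" "r' \<in> carrier R" for r r'
  proof
    assume "q r = q r'"
    then have "s r = s r'" using s that inj_onD[OF \<iota>] by (auto simp: q_def)
    then show "r \<odot>\<^bsub>N\<^esub> x = r' \<odot>\<^bsub>N\<^esub> x" using s that by metis
  qed (simp add: q_def s_def)
  note [simp] = cmp_regular[OF g]
  have cmp_x: "rcmp r (inv\<^bsub>G\<^esub> g \<otimes>\<^bsub>G\<^esub> h) \<odot>\<^bsub>N\<^esub> x = mcmp N (r \<odot>\<^bsub>N\<^esub> x) h"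
    if "r \<in> carrier R" "h \<in> carrier G" for r h
    using N.smult_homog_cmp[OF x(1) g that] by simp
  interpret K: subquotient G R "regular g" "carrier R" q
    using g xN
    by (intro subquotient.intro subquotient_axioms.intro graded_module_regular)
      (auto simp: q_iff N.smult_l_distr N.smult_assoc1 cmp_x)
  obtain j where j: "j \<in> ghom K.Q N" "\<And>r. r \<in> carrier R \<Longrightarrow> j (q r) = r \<odot>\<^bsub>N\<^esub> x"
  proof (rule K.subquot_lift[OF N, of "\<lambda>r. r \<odot>\<^bsub>N\<^esub> x"])
    fix h r assume h: "h \<in> carrier G" "r \<in> mod_comp (regular g) h"
    have "(inv\<^bsub>G\<^esub> g \<otimes>\<^bsub>G\<^esub> h) \<otimes>\<^bsub>G\<^esub> g = h" using g h by (simp add: G.m_ac)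
    then show "r \<odot>\<^bsub>N\<^esub> x \<in> mod_comp N h"
      using N.mod_comp_smult[of "inv\<^bsub>G\<^esub> g \<otimes>\<^bsub>G\<^esub> h" g r x] g h x by simp
  qed (use xN that in \<open>auto simp: q_iff N.smult_l_distr N.smult_assoc1\<close>)
  have K: "gmod K.Q" by (rule K.graded_module_Q)
  interpret KQ: graded_module G R K.Q by fact
  let ?id = "\<lambda>a\<in>carrier K.Q. a" and ?zero = "\<lambda>a\<in>carrier K.Q. \<zero>\<^bsub>K.Q\<^esub>"
  have id: "?id \<in> ghom K.Q K.Q"
    by (rule gr_homI) (use KQ.MD.comp_sub in \<open>auto simp del: K.carrier_Q K.mod_comp_Q\<close>)
  have zero: "?zero \<in> ghom K.Q K.Q"
    by (rule gr_homI) (use KQ.MD.comp_sub KQ.MD.comp_zero in \<open>auto simp del: K.carrier_Q K.mod_comp_Q K.zero_Q\<close>)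
  have "q \<one>\<^bsub>R\<^esub> \<noteq> q \<zero>\<^bsub>R\<^esub>" using x xN by (simp add: q_iff)
  then have "?id \<noteq> ?zero"
    by (metis K.carrier_Q K.zero_Q R.one_closed imageI regular_simps(2) restrict_apply')
  moreover have "inj_on (\<lambda>f. \<lambda>h\<in>ghom K.Q E. compose (carrier K.Q) h f) (ghom K.Q K.Q)"
    using cogen K unfolding gr_cogenerator_def by blast
  \<comment> \<open>Faithfulness distinguishes the identity from the zero map, so some morphism to \<open>E\<close> is nonzero
    on the cyclic module and therefore on its generator.\<close>
  ultimately have "(\<lambda>h\<in>ghom K.Q E. compose (carrier K.Q) h ?id) \<noteq> (\<lambda>h\<in>ghom K.Q E. compose (carrier K.Q) h ?zero)"
    using id zero by (auto dest: inj_onD)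
  then obtain h a where h: "h \<in> ghom K.Q E" and a: "a \<in> carrier K.Q" "h a \<noteq> h \<zero>\<^bsub>K.Q\<^esub>"
    by (auto simp: fun_eq_iff compose_def restrict_def split: if_splits)
  then obtain r where r: "r \<in> carrier R" "a = q r" by auto
  have "inj_on j (carrier K.Q)"
    by (rule inj_onI) (auto simp: j(2) q_iff)
  then obtain h' where h': "h' \<in> ghom N E" "\<And>x. x \<in> carrier K.Q \<Longrightarrow> h' (j x) = h x"
    using gr_injective_extend[OF small inj K N j(1) _ h] by blast
  have "r \<odot>\<^bsub>E\<^esub> h' x = h a"
    using h'(2)[OF a(1)] r j(2) xN gr_homD(4)[OF h'(1), of r x] by simp
  moreover have "h a \<noteq> \<zero>\<^bsub>E\<^esub>" using a(2) gr_hom_zero[OF K E h] by simp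
  ultimately have "h' x \<noteq> \<zero>\<^bsub>E\<^esub>" using r by auto
  with h' that show thesis by blast
qed

end


section \<open>The graded Hom module\<close>

lemma gr_hom_shift_iff:
  "u \<in> gr_hom G R M (shift G g N) \<longleftrightarrow> u \<in> extensional (carrier M) \<and>
     (\<forall>x\<in>carrier M. u x \<in> carrier N) \<and>
     (\<forall>x\<in>carrier M. \<forall>y\<in>carrier M. u (x \<oplus>\<^bsub>M\<^esub> y) = u x \<oplus>\<^bsub>N\<^esub> u y) \<and>
     (\<forall>a\<in>carrier R. \<forall>x\<in>carrier M. u (a \<odot>\<^bsub>M\<^esub> x) = a \<odot>\<^bsub>N\<^esub> u x) \<and>
     (\<forall>h\<in>carrier G. \<forall>x\<in>mod_comp M h. u x \<in> mod_comp N (g \<otimes>\<^bsub>G\<^esub> h))"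
  by (auto simp: gr_hom_def shift_def PiE_def Pi_def image_subset_iff)

locale graded_module_pair = M: graded_module G R M + E: graded_module G R E
  for G :: "('g, 'j) monoid_scheme" and R :: "('r, 'g, 'k) gring_scheme"
    and M :: "('r, 'm, 'g) gmodule" and E :: "('r, 'e, 'g) gmodule"
begin

abbreviation "Hom \<equiv> gr_Hom G R M E"

lemma carrier_Hom_iff:
  "\<phi> \<in> carrier Hom \<longleftrightarrow> \<phi> \<in> extensional (carrier G) \<and>
     (\<forall>g\<in>carrier G. \<phi> g \<in> gr_hom G R M (shift G g E)) \<and>
     finite {g \<in> carrier G. \<exists>x\<in>carrier M. \<phi> g x \<noteq> \<zero>\<^bsub>E\<^esub>}"
  by (auto simp: gr_Hom_def Let_def PiE_def Pi_def)

lemma HomD: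
  assumes "\<phi> \<in> carrier Hom"
  shows "\<phi> \<in> extensional (carrier G)"
    and "g \<in> carrier G \<Longrightarrow> \<phi> g \<in> extensional (carrier M)"
    and "\<lbrakk>g \<in> carrier G; x \<in> carrier M\<rbrakk> \<Longrightarrow> \<phi> g x \<in> carrier E"
    and "\<lbrakk>g \<in> carrier G; x \<in> carrier M; y \<in> carrier M\<rbrakk> \<Longrightarrow> \<phi> g (x \<oplus>\<^bsub>M\<^esub> y) = \<phi> g x \<oplus>\<^bsub>E\<^esub> \<phi> g y"
    and "\<lbrakk>g \<in> carrier G; a \<in> carrier R; x \<in> carrier M\<rbrakk> \<Longrightarrow> \<phi> g (a \<odot>\<^bsub>M\<^esub> x) = a \<odot>\<^bsub>E\<^esub> \<phi> g x"
    and "\<lbrakk>g \<in> carrier G; h \<in> carrier G; x \<in> mod_comp M h\<rbrakk> \<Longrightarrow> \<phi> g x \<in> mod_comp E (g \<otimes>\<^bsub>G\<^esub> h)"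
    and "finite {g \<in> carrier G. \<exists>x\<in>carrier M. \<phi> g x \<noteq> \<zero>\<^bsub>E\<^esub>}"
  using assms by (simp_all add: carrier_Hom_iff gr_hom_shift_iff)

lemma HomI:
  assumes "\<phi> \<in> extensional (carrier G)"
    and "\<And>g. g \<in> carrier G \<Longrightarrow> \<phi> g \<in> extensional (carrier M)"
    and "\<And>g x. \<lbrakk>g \<in> carrier G; x \<in> carrier M\<rbrakk> \<Longrightarrow> \<phi> g x \<in> carrier E"
    and "\<And>g x y. \<lbrakk>g \<in> carrier G; x \<in> carrier M; y \<in> carrier M\<rbrakk> \<Longrightarrow>
      \<phi> g (x \<oplus>\<^bsub>M\<^esub> y) = \<phi> g x \<oplus>\<^bsub>E\<^esub> \<phi> g y"
    and "\<And>g a x. \<lbrakk>g \<in> carrier G; a \<in> carrier R; x \<in> carrier M\<rbrakk> \<Longrightarrow>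
      \<phi> g (a \<odot>\<^bsub>M\<^esub> x) = a \<odot>\<^bsub>E\<^esub> \<phi> g x"
    and "\<And>g h x. \<lbrakk>g \<in> carrier G; h \<in> carrier G; x \<in> mod_comp M h\<rbrakk> \<Longrightarrow>
      \<phi> g x \<in> mod_comp E (g \<otimes>\<^bsub>G\<^esub> h)"
    and "finite {g \<in> carrier G. \<exists>x\<in>carrier M. \<phi> g x \<noteq> \<zero>\<^bsub>E\<^esub>}"
  shows "\<phi> \<in> carrier Hom"
  using assms by (simp add: carrier_Hom_iff gr_hom_shift_iff)

lemma Hom_eqI:
  assumes "\<phi> \<in> extensional (carrier G)" "\<psi> \<in> extensional (carrier G)"
    and "\<And>g. g \<in> carrier G \<Longrightarrow> \<phi> g \<in> extensional (carrier M)"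
    and "\<And>g. g \<in> carrier G \<Longrightarrow> \<psi> g \<in> extensional (carrier M)"
    and "\<And>g x. \<lbrakk>g \<in> carrier G; x \<in> carrier M\<rbrakk> \<Longrightarrow> \<phi> g x = \<psi> g x"
  shows "\<phi> = \<psi>"
  by (rule extensionalityI[OF assms(1,2)], rule extensionalityI[OF assms(3,4)]) (use assms(5) in auto)

lemma Hom_simps [simp]:
  "\<zero>\<^bsub>Hom\<^esub> = (\<lambda>g\<in>carrier G. \<lambda>x\<in>carrier M. \<zero>\<^bsub>E\<^esub>)"
  "\<phi> \<oplus>\<^bsub>Hom\<^esub> \<psi> = (\<lambda>g\<in>carrier G. \<lambda>x\<in>carrier M. \<phi> g x \<oplus>\<^bsub>E\<^esub> \<psi> g x)"
  "mod_comp Hom g = {\<phi> \<in> carrier Hom. \<forall>h\<in>carrier G. h \<noteq> g \<longrightarrow> (\<forall>x\<in>carrier M. \<phi> h x = \<zero>\<^bsub>E\<^esub>)}"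
  by (simp_all add: gr_Hom_def Let_def)

lemma smult_Hom:
  "a \<odot>\<^bsub>Hom\<^esub> \<phi> = (\<lambda>k\<in>carrier G. \<lambda>x\<in>carrier M.
     E.MD.gsum (\<lambda>h. M.rcmp a h \<odot>\<^bsub>E\<^esub> \<phi> (k \<otimes>\<^bsub>G\<^esub> inv\<^bsub>G\<^esub> h) x))"
  by (simp add: gr_Hom_def Let_def)

lemma Hom_zero_closed: "\<zero>\<^bsub>Hom\<^esub> \<in> carrier Hom"
  by (rule HomI) (auto simp: M.MD.comp_sub)

lemma Hom_add_closed:
  assumes "\<phi> \<in> carrier Hom" "\<psi> \<in> carrier Hom"
  shows "\<phi> \<oplus>\<^bsub>Hom\<^esub> \<psi> \<in> carrier Hom"
proof -
  note D = HomD[OF assms(1)] and D' = HomD[OF assms(2)]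
  show ?thesis
  proof (rule HomI)
    show "finite {g \<in> carrier G. \<exists>x\<in>carrier M. (\<phi> \<oplus>\<^bsub>Hom\<^esub> \<psi>) g x \<noteq> \<zero>\<^bsub>E\<^esub>}"
      by (rule finite_subset[OF _ finite_UnI[OF D(7) D'(7)]]) (use D(3) D'(3) in fastforce)
  qed (use D(3-6) D'(3-6) in
      \<open>auto simp: M.MD.comp_sub E.smult_r_distr E.M.a_ac intro: E.MD.comp_add\<close>)
qed

lemma Hom_abelian_group: "abelian_group Hom"
proof (rule abelian_groupI)
  fix \<phi> assume \<phi>: "\<phi> \<in> carrier Hom"
  note D = HomD[OF \<phi>]
  let ?\<psi> = "\<lambda>g\<in>carrier G. \<lambda>x\<in>carrier M. \<ominus>\<^bsub>E\<^esub> \<phi> g x"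
  have "?\<psi> \<in> carrier Hom"
  proof (rule HomI)
    show "finite {g \<in> carrier G. \<exists>x\<in>carrier M. ?\<psi> g x \<noteq> \<zero>\<^bsub>E\<^esub>}"
      by (rule finite_subset[OF _ D(7)]) (use D(3) in \<open>auto simp: E.M.add.inv_eq_1_iff\<close>)
  qed (use D(3-6) in \<open>auto simp: M.MD.comp_sub E.smult_r_minus E.M.minus_add intro: E.MD.comp_minus\<close>)
  moreover have "?\<psi> \<oplus>\<^bsub>Hom\<^esub> \<phi> = \<zero>\<^bsub>Hom\<^esub>"
    using D(3) by (intro Hom_eqI) (auto simp: E.M.l_neg)
  ultimately show "\<exists>\<psi>\<in>carrier Hom. \<psi> \<oplus>\<^bsub>Hom\<^esub> \<phi> = \<zero>\<^bsub>Hom\<^esub>" by blast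
next
  fix \<phi> \<psi> \<chi> assume "\<phi> \<in> carrier Hom" "\<psi> \<in> carrier Hom" "\<chi> \<in> carrier Hom"
  then show "\<phi> \<oplus>\<^bsub>Hom\<^esub> \<psi> \<oplus>\<^bsub>Hom\<^esub> \<chi> = \<phi> \<oplus>\<^bsub>Hom\<^esub> (\<psi> \<oplus>\<^bsub>Hom\<^esub> \<chi>)"
    using HomD(3) by (intro Hom_eqI) (auto simp: E.M.a_assoc)
next
  fix \<phi> \<psi> assume "\<phi> \<in> carrier Hom" "\<psi> \<in> carrier Hom"
  then show "\<phi> \<oplus>\<^bsub>Hom\<^esub> \<psi> = \<psi> \<oplus>\<^bsub>Hom\<^esub> \<phi>"
    using HomD(3) by (intro Hom_eqI) (auto simp: E.M.a_comm)
next
  fix \<phi> assume "\<phi> \<in> carrier Hom"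
  then show "\<zero>\<^bsub>Hom\<^esub> \<oplus>\<^bsub>Hom\<^esub> \<phi> = \<phi>"
    using HomD(1-3) by (intro Hom_eqI) auto
qed (use Hom_zero_closed Hom_add_closed in blast)+

lemma smult_summand_closed:
  assumes "a \<in> carrier R" "\<phi> \<in> carrier Hom" "k \<in> carrier G" "x \<in> carrier M" "h \<in> carrier G"
  shows "M.rcmp a h \<odot>\<^bsub>E\<^esub> \<phi> (k \<otimes>\<^bsub>G\<^esub> inv\<^bsub>G\<^esub> h) x \<in> carrier E"
  using HomD(3)[OF assms(2)] assms by simp

lemma smult_summand_finite:
  assumes "a \<in> carrier R" "\<phi> \<in> carrier Hom" "k \<in> carrier G" "x \<in> carrier M"
  shows "finite {h \<in> carrier G. M.rcmp a h \<odot>\<^bsub>E\<^esub> \<phi> (k \<otimes>\<^bsub>G\<^esub> inv\<^bsub>G\<^esub> h) x \<noteq> \<zero>\<^bsub>E\<^esub>}"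
  using HomD(3)[OF assms(2)] assms by (intro finite_subset[OF _ M.RD.cmp_finite[OF assms(1)]]) auto

text \<open>
  For homogeneous scalars the convolution sum in the definition has a single term. The other
  properties of the scalar multiplication are reduced to this case by additivity.
\<close>

lemma smult_Hom_homog:
  assumes a: "a \<in> ring_comp R h" "h \<in> carrier G" and \<phi>: "\<phi> \<in> carrier Hom"
    and k: "k \<in> carrier G" and x: "x \<in> carrier M"
  shows "(a \<odot>\<^bsub>Hom\<^esub> \<phi>) k x = a \<odot>\<^bsub>E\<^esub> \<phi> (k \<otimes>\<^bsub>G\<^esub> inv\<^bsub>G\<^esub> h) x"
proof -
  have aR: "a \<in> carrier R" using a by blast
  have "E.MD.gsum (\<lambda>h. M.rcmp a h \<odot>\<^bsub>E\<^esub> \<phi> (k \<otimes>\<^bsub>G\<^esub> inv\<^bsub>G\<^esub> h) x) = a \<odot>\<^bsub>E\<^esub> \<phi> (k \<otimes>\<^bsub>G\<^esub> inv\<^bsub>G\<^esub> h) x"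
    by (rule E.MD.gsum_single[of _ h])
      (use a aR k x HomD(3)[OF \<phi>] in \<open>auto simp: M.RD.cmp_homog\<close>)
  then show ?thesis using k x by (simp add: smult_Hom)
qed

lemma smult_Hom_l_distr:
  assumes a: "a \<in> carrier R" and b: "b \<in> carrier R" and \<phi>: "\<phi> \<in> carrier Hom"
  shows "(a \<oplus>\<^bsub>R\<^esub> b) \<odot>\<^bsub>Hom\<^esub> \<phi> = a \<odot>\<^bsub>Hom\<^esub> \<phi> \<oplus>\<^bsub>Hom\<^esub> b \<odot>\<^bsub>Hom\<^esub> \<phi>"
proof (rule Hom_eqI)
  fix k x assume k: "k \<in> carrier G" and x: "x \<in> carrier M"
  let ?s = "\<lambda>a h. M.rcmp a h \<odot>\<^bsub>E\<^esub> \<phi> (k \<otimes>\<^bsub>G\<^esub> inv\<^bsub>G\<^esub> h) x"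
  have "E.MD.gsum (?s (a \<oplus>\<^bsub>R\<^esub> b)) = E.MD.gsum (\<lambda>h. ?s a h \<oplus>\<^bsub>E\<^esub> ?s b h)"
    using a b k x HomD(3)[OF \<phi>]
    by (intro E.M.add.gfinprod_cong) (auto simp: simp_implies_def M.RD.cmp_add E.smult_l_distr)
  also have "\<dots> = E.MD.gsum (?s a) \<oplus>\<^bsub>E\<^esub> E.MD.gsum (?s b)"
    using smult_summand_finite[OF a \<phi> k x] smult_summand_finite[OF b \<phi> k x]
      smult_summand_closed[OF a \<phi> k x] smult_summand_closed[OF b \<phi> k x]
      E.M.add.gfinprod_distrib[of "carrier G" "?s a" "?s b"] by (simp add: image_subset_iff)
  finally show "((a \<oplus>\<^bsub>R\<^esub> b) \<odot>\<^bsub>Hom\<^esub> \<phi>) k x = (a \<odot>\<^bsub>Hom\<^esub> \<phi> \<oplus>\<^bsub>Hom\<^esub> b \<odot>\<^bsub>Hom\<^esub> \<phi>) k x"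
    using k x by (simp add: smult_Hom)
qed (auto simp: smult_Hom)

lemma smult_Hom_r_distr:
  assumes a: "a \<in> carrier R" and \<phi>: "\<phi> \<in> carrier Hom" and \<psi>: "\<psi> \<in> carrier Hom"
  shows "a \<odot>\<^bsub>Hom\<^esub> (\<phi> \<oplus>\<^bsub>Hom\<^esub> \<psi>) = a \<odot>\<^bsub>Hom\<^esub> \<phi> \<oplus>\<^bsub>Hom\<^esub> a \<odot>\<^bsub>Hom\<^esub> \<psi>"
proof (rule Hom_eqI)
  fix k x assume k: "k \<in> carrier G" and x: "x \<in> carrier M"
  let ?s = "\<lambda>\<phi> h. M.rcmp a h \<odot>\<^bsub>E\<^esub> \<phi> (k \<otimes>\<^bsub>G\<^esub> inv\<^bsub>G\<^esub> h) x"
  have "E.MD.gsum (?s (\<phi> \<oplus>\<^bsub>Hom\<^esub> \<psi>)) = E.MD.gsum (\<lambda>h. ?s \<phi> h \<oplus>\<^bsub>E\<^esub> ?s \<psi> h)"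
    using a k x HomD(3)[OF \<phi>] HomD(3)[OF \<psi>]
    by (intro E.M.add.gfinprod_cong) (auto simp: simp_implies_def E.smult_r_distr)
  also have "\<dots> = E.MD.gsum (?s \<phi>) \<oplus>\<^bsub>E\<^esub> E.MD.gsum (?s \<psi>)"
    using smult_summand_finite[OF a \<phi> k x] smult_summand_finite[OF a \<psi> k x]
      smult_summand_closed[OF a \<phi> k x] smult_summand_closed[OF a \<psi> k x]
      E.M.add.gfinprod_distrib[of "carrier G" "?s \<phi>" "?s \<psi>"] by (simp add: image_subset_iff)
  finally show "(a \<odot>\<^bsub>Hom\<^esub> (\<phi> \<oplus>\<^bsub>Hom\<^esub> \<psi>)) k x = (a \<odot>\<^bsub>Hom\<^esub> \<phi> \<oplus>\<^bsub>Hom\<^esub> a \<odot>\<^bsub>Hom\<^esub> \<psi>) k x"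
    using k x by (simp add: smult_Hom)
qed (auto simp: smult_Hom)

lemma smult_Hom_ext:
  "a \<odot>\<^bsub>Hom\<^esub> \<phi> \<in> extensional (carrier G)"
  "g \<in> carrier G \<Longrightarrow> (a \<odot>\<^bsub>Hom\<^esub> \<phi>) g \<in> extensional (carrier M)"
  by (auto simp: smult_Hom)

lemma smult_Hom_closed:
  assumes "a \<in> carrier R" and \<phi>: "\<phi> \<in> carrier Hom"
  shows "a \<odot>\<^bsub>Hom\<^esub> \<phi> \<in> carrier Hom"
  using assms(1)
proof (induction rule: M.RD.homog_induct)
  case zero
  have z: "\<zero>\<^bsub>R\<^esub> \<odot>\<^bsub>Hom\<^esub> \<phi> = \<zero>\<^bsub>Hom\<^esub>"
    using HomD(3)[OF \<phi>] smult_Hom_homog[OF M.RD.comp_zero M.G.one_closed \<phi>, OF M.G.one_closed]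
    by (intro Hom_eqI smult_Hom_ext) auto
  show ?case unfolding z by (rule Hom_zero_closed)
next
  case (homog h a)
  then have a: "a \<in> carrier R" by blast
  note D = HomD[OF \<phi>] and eq = smult_Hom_homog[OF homog(2,1) \<phi>]
  show ?case
  proof (rule HomI)
    show "finite {g \<in> carrier G. \<exists>x\<in>carrier M. (a \<odot>\<^bsub>Hom\<^esub> \<phi>) g x \<noteq> \<zero>\<^bsub>E\<^esub>}"
    proof (rule finite_subset[OF _ finite_imageI[OF D(7), of "\<lambda>g. g \<otimes>\<^bsub>G\<^esub> h"]], rule subsetI)
      fix g assume "g \<in> {g \<in> carrier G. \<exists>x\<in>carrier M. (a \<odot>\<^bsub>Hom\<^esub> \<phi>) g x \<noteq> \<zero>\<^bsub>E\<^esub>}"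
      then have g: "g \<in> carrier G" "\<exists>x\<in>carrier M. \<phi> (g \<otimes>\<^bsub>G\<^esub> inv\<^bsub>G\<^esub> h) x \<noteq> \<zero>\<^bsub>E\<^esub>"
        using a homog(1) by (auto simp: eq) (metis E.smult_r_null)
      then show "g \<in> (\<lambda>g. g \<otimes>\<^bsub>G\<^esub> h) ` {g \<in> carrier G. \<exists>x\<in>carrier M. \<phi> g x \<noteq> \<zero>\<^bsub>E\<^esub>}"
        using homog(1) by (intro image_eqI[of _ _ "g \<otimes>\<^bsub>G\<^esub> inv\<^bsub>G\<^esub> h"]) auto
    qed
  next
    fix g k x assume gk: "g \<in> carrier G" "k \<in> carrier G" "x \<in> mod_comp M k"
    then have x: "x \<in> carrier M" by blast
    have "h \<otimes>\<^bsub>G\<^esub> (g \<otimes>\<^bsub>G\<^esub> inv\<^bsub>G\<^esub> h \<otimes>\<^bsub>G\<^esub> k) = g \<otimes>\<^bsub>G\<^esub> k"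
      using gk homog(1) by (simp add: M.G.m_assoc M.G.m_lcomm[of h g])
    then show "(a \<odot>\<^bsub>Hom\<^esub> \<phi>) g x \<in> mod_comp E (g \<otimes>\<^bsub>G\<^esub> k)"
      using E.mod_comp_smult[OF homog(1) _ homog(2) D(6)[OF _ gk(2,3)], of "g \<otimes>\<^bsub>G\<^esub> inv\<^bsub>G\<^esub> h"] gk homog(1)
      by (simp add: eq x)
  next
    fix g r x assume "g \<in> carrier G" "r \<in> carrier R" "x \<in> carrier M"
    then show "(a \<odot>\<^bsub>Hom\<^esub> \<phi>) g (r \<odot>\<^bsub>M\<^esub> x) = r \<odot>\<^bsub>E\<^esub> (a \<odot>\<^bsub>Hom\<^esub> \<phi>) g x"
      using a homog(1) D(3,5) M.R.m_comm[of a r] by (simp add: eq E.smult_assoc1[symmetric])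
  qed (use a homog(1) D(3,4) in \<open>auto simp: eq E.smult_r_distr smult_Hom_ext\<close>)
next
  case (add a b)
  then show ?case using smult_Hom_l_distr[OF _ _ \<phi>] Hom_add_closed by metis
qed

lemma smult_Hom_assoc:
  assumes a: "a \<in> carrier R" and b: "b \<in> carrier R" and \<phi>: "\<phi> \<in> carrier Hom"
  shows "(a \<otimes>\<^bsub>R\<^esub> b) \<odot>\<^bsub>Hom\<^esub> \<phi> = a \<odot>\<^bsub>Hom\<^esub> (b \<odot>\<^bsub>Hom\<^esub> \<phi>)"
proof -
  have hom_assoc: "(a \<otimes>\<^bsub>R\<^esub> b) \<odot>\<^bsub>Hom\<^esub> \<phi> = a \<odot>\<^bsub>Hom\<^esub> (b \<odot>\<^bsub>Hom\<^esub> \<phi>)"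
    if a: "a \<in> ring_comp R h" "h \<in> carrier G" and b: "b \<in> ring_comp R k" "k \<in> carrier G" for a b h k
  proof (rule Hom_eqI)
    fix g x assume g: "g \<in> carrier G" and x: "x \<in> carrier M"
    have ab: "a \<in> carrier R" "b \<in> carrier R" using a b by blast+
    have "inv\<^bsub>G\<^esub> (h \<otimes>\<^bsub>G\<^esub> k) = inv\<^bsub>G\<^esub> h \<otimes>\<^bsub>G\<^esub> inv\<^bsub>G\<^esub> k" using a b by (simp add: M.G.inv_mult)
    then have "g \<otimes>\<^bsub>G\<^esub> inv\<^bsub>G\<^esub> (h \<otimes>\<^bsub>G\<^esub> k) = g \<otimes>\<^bsub>G\<^esub> inv\<^bsub>G\<^esub> h \<otimes>\<^bsub>G\<^esub> inv\<^bsub>G\<^esub> k"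
      using a b g by (simp add: M.G.m_assoc)
    then show "((a \<otimes>\<^bsub>R\<^esub> b) \<odot>\<^bsub>Hom\<^esub> \<phi>) g x = (a \<odot>\<^bsub>Hom\<^esub> (b \<odot>\<^bsub>Hom\<^esub> \<phi>)) g x"
      using smult_Hom_homog[OF M.ring_comp_mult[OF a(2) b(2) a(1) b(1)] _ \<phi> g x] a b g x ab
        HomD(3)[OF \<phi>] smult_Hom_closed[OF ab(2) \<phi>]
      by (simp add: smult_Hom_homog[OF a] smult_Hom_homog[OF b \<phi>] E.smult_assoc1)
  qed (simp_all add: smult_Hom_ext)
  note l = smult_Hom_l_distr[OF _ _ \<phi>] and cl = smult_Hom_closed[OF _ \<phi>]
  show ?thesis
    using b
  proof (induction rule: M.RD.homog_induct)
    case zero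
    from a show ?case
    proof (induction rule: M.RD.homog_induct)
      case zero
      show ?case by (rule hom_assoc[of _ "\<one>\<^bsub>G\<^esub>" _ "\<one>\<^bsub>G\<^esub>"]) auto
    next
      case (homog h a)
      then show ?case by (intro hom_assoc[of _ h _ "\<one>\<^bsub>G\<^esub>"]) auto
    next
      case (add x y)
      then show ?case using smult_Hom_l_distr[OF _ _ cl[OF M.R.zero_closed]] l
        by (simp add: M.R.l_distr del: Hom_simps M.R.l_null M.R.r_null)
    qed
  next
    case (homog k b)
    then have bR: "b \<in> carrier R" by blast
    from a show ?case
    proof (induction rule: M.RD.homog_induct)
      case zero
      then show ?case using homog by (intro hom_assoc[of _ "\<one>\<^bsub>G\<^esub>" _ k]) auto
    next
      case (homog h a)
      then show ?case using \<open>k \<in> carrier G\<close> \<open>b \<in> ring_comp R k\<close> by (intro hom_assoc[of _ h _ k]) auto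
    next
      case (add x y)
      then show ?case using smult_Hom_l_distr[OF _ _ cl[OF bR]] l bR
        by (simp add: M.R.l_distr del: Hom_simps)
    qed
  next
    case (add x y)
    then show ?case using a l cl smult_Hom_r_distr[OF a]
      by (simp add: M.R.r_distr del: Hom_simps)
  qed
qed

lemma
  shows graded_module_Hom: "graded_module G R Hom"
    and cmp_Hom: "\<lbrakk>\<phi> \<in> carrier Hom; g \<in> carrier G; x \<in> carrier M\<rbrakk> \<Longrightarrow> M.mcmp Hom \<phi> g g x = \<phi> g x"
proof -
  interpret H: abelian_group Hom by (rule Hom_abelian_group)
  let ?p = "\<lambda>g \<phi>. \<lambda>h\<in>carrier G. if h = g then \<phi> g else (\<lambda>x\<in>carrier M. \<zero>\<^bsub>E\<^esub>)"
  \<comment> \<open>The remainder after splitting off the component of degree \<open>g\<close>; its support is smaller, which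
    drives the induction showing that homogeneous elements generate.\<close>
  let ?r = "\<lambda>g \<phi>. \<lambda>h\<in>carrier G. if h = g then (\<lambda>x\<in>carrier M. \<zero>\<^bsub>E\<^esub>) else \<phi> h"
  have p: "?p g \<phi> \<in> carrier Hom" if "\<phi> \<in> carrier Hom" "g \<in> carrier G" for g \<phi>
  proof (rule HomI)
    show "finite {h \<in> carrier G. \<exists>x\<in>carrier M. ?p g \<phi> h x \<noteq> \<zero>\<^bsub>E\<^esub>}"
      by (rule finite_subset[OF _ HomD(7)[OF that(1)]]) auto
  qed (use HomD(2-6)[OF that(1)] that(2) in \<open>auto simp: M.MD.comp_sub\<close>)
  have r: "?r g \<phi> \<in> carrier Hom" if "\<phi> \<in> carrier Hom" "g \<in> carrier G" for g \<phi>
  proof (rule HomI)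
    show "finite {h \<in> carrier G. \<exists>x\<in>carrier M. ?r g \<phi> h x \<noteq> \<zero>\<^bsub>E\<^esub>}"
      by (rule finite_subset[OF _ HomD(7)[OF that(1)]]) auto
  qed (use HomD(2-6)[OF that(1)] that(2) in \<open>auto simp: M.MD.comp_sub\<close>)
  have *: "is_direct_sum (carrier G) Hom (mod_comp Hom) \<and>
    (\<forall>g\<in>carrier G. \<forall>\<phi>\<in>carrier Hom. M.mcmp Hom \<phi> g = ?p g \<phi>)"
  proof (rule is_direct_sumI[of Hom "carrier G" "mod_comp Hom" ?p])
    fix g assume g: "g \<in> carrier G"
    show "additive_subgroup (mod_comp Hom g) Hom"
    proof (rule H.additive_subgroupI)
      fix \<phi> assume \<phi>: "\<phi> \<in> mod_comp Hom g"
      then have "\<phi> \<oplus>\<^bsub>Hom\<^esub> \<ominus>\<^bsub>Hom\<^esub> \<phi> = \<zero>\<^bsub>Hom\<^esub>" "\<ominus>\<^bsub>Hom\<^esub> \<phi> \<in> carrier Hom"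
        using H.r_neg[of \<phi>] by (simp_all del: Hom_simps(1,2))
      then have "\<phi> h x \<oplus>\<^bsub>E\<^esub> (\<ominus>\<^bsub>Hom\<^esub> \<phi>) h x = \<zero>\<^bsub>E\<^esub>" if "h \<in> carrier G" "x \<in> carrier M" for h x
        using that by (auto simp: fun_eq_iff restrict_def split: if_splits)
      then have "(\<ominus>\<^bsub>Hom\<^esub> \<phi>) h x = \<zero>\<^bsub>E\<^esub>" if "h \<in> carrier G" "x \<in> carrier M" "h \<noteq> g" for h x
        using \<phi> HomD(3)[OF \<open>\<ominus>\<^bsub>Hom\<^esub> \<phi> \<in> carrier Hom\<close>, of h x] that by force
      then show "\<ominus>\<^bsub>Hom\<^esub> \<phi> \<in> mod_comp Hom g"
        using \<open>\<ominus>\<^bsub>Hom\<^esub> \<phi> \<in> carrier Hom\<close> by simp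
    next
      show "\<zero>\<^bsub>Hom\<^esub> \<in> mod_comp Hom g" using Hom_zero_closed by auto
    next
      fix \<phi> \<psi> assume "\<phi> \<in> mod_comp Hom g" "\<psi> \<in> mod_comp Hom g"
      then show "\<phi> \<oplus>\<^bsub>Hom\<^esub> \<psi> \<in> mod_comp Hom g"
        using Hom_add_closed[of \<phi> \<psi>] by auto
    qed auto
  next
    fix g \<phi> \<psi> assume "g \<in> carrier G" "\<phi> \<in> carrier Hom" "\<psi> \<in> carrier Hom"
    then show "?p g (\<phi> \<oplus>\<^bsub>Hom\<^esub> \<psi>) = ?p g \<phi> \<oplus>\<^bsub>Hom\<^esub> ?p g \<psi>"
      by (intro Hom_eqI) (auto simp: HomD(2))
  next
    fix g \<phi> assume "g \<in> carrier G" "\<phi> \<in> mod_comp Hom g"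
    then show "?p g \<phi> = \<phi>"
      by (intro Hom_eqI) (auto simp: HomD(1,2))
  next
    fix g h \<phi> assume "g \<in> carrier G" "h \<in> carrier G" "\<phi> \<in> mod_comp Hom g" "h \<noteq> g"
    then show "?p h \<phi> = \<zero>\<^bsub>Hom\<^esub>"
      by (intro Hom_eqI) (auto simp: HomD(1,2))
  next
    fix P \<phi> assume \<phi>: "\<phi> \<in> carrier Hom" and P0: "P \<zero>\<^bsub>Hom\<^esub>"
      and Ph: "\<And>g \<phi>. \<lbrakk>g \<in> carrier G; \<phi> \<in> mod_comp Hom g\<rbrakk> \<Longrightarrow> P \<phi>"
      and Pa: "\<And>\<phi> \<psi>. \<lbrakk>\<phi> \<in> carrier Hom; \<psi> \<in> carrier Hom; P \<phi>; P \<psi>\<rbrakk> \<Longrightarrow> P (\<phi> \<oplus>\<^bsub>Hom\<^esub> \<psi>)"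
    have "P \<phi>" if "finite F" "\<phi> \<in> carrier Hom" "\<And>g x. \<lbrakk>g \<in> carrier G; x \<in> carrier M; \<phi> g x \<noteq> \<zero>\<^bsub>E\<^esub>\<rbrakk> \<Longrightarrow> g \<in> F" for F \<phi>
      using that
    proof (induction F arbitrary: \<phi> rule: finite_induct)
      case empty
      then have "\<phi> = \<zero>\<^bsub>Hom\<^esub>"
        using HomD(1,2)[OF empty(1)] by (intro Hom_eqI) auto
      then show ?case using P0 by (simp only:)
    next
      case (insert g F)
      show ?case
      proof (cases "g \<in> carrier G")
        case True
        have "P (?r g \<phi>)"
        proof (rule insert(3)[OF r[OF insert(4) True]])
          fix h x assume "h \<in> carrier G" "x \<in> carrier M" "?r g \<phi> h x \<noteq> \<zero>\<^bsub>E\<^esub>"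
          then show "h \<in> F"
            using insert(5)[of h x] by (auto split: if_splits)
        qed
        moreover have "P (?p g \<phi>)"
        proof (rule Ph[OF True])
          show "?p g \<phi> \<in> mod_comp Hom g"
            unfolding Hom_simps(3) using p[OF insert(4) True] by (intro CollectI conjI) auto
        qed
        moreover have "?p g \<phi> \<oplus>\<^bsub>Hom\<^esub> ?r g \<phi> = \<phi>"
          using HomD(1-3)[OF insert(4)] by (intro Hom_eqI) auto
        ultimately show ?thesis
          using Pa[OF p[OF insert(4) True] r[OF insert(4) True]] by simp
      next
        case False
        then show ?thesis using insert by blast
      qed
    qed
    from this[OF HomD(7)[OF \<phi>] \<phi>] show "P \<phi>" by auto
  qed (use p Hom_abelian_group in auto)
  show "graded_module G R Hom"
  proof (rule M.graded_moduleI)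
    fix g h a \<phi> assume gh: "g \<in> carrier G" "h \<in> carrier G" "a \<in> ring_comp R g" "\<phi> \<in> mod_comp Hom h"
    then have \<phi>: "\<phi> \<in> carrier Hom" and a: "a \<in> carrier R" by auto
    have "(a \<odot>\<^bsub>Hom\<^esub> \<phi>) k x = \<zero>\<^bsub>E\<^esub>" if "k \<in> carrier G" "x \<in> carrier M" "k \<noteq> g \<otimes>\<^bsub>G\<^esub> h" for k x
      using that gh a M.shift_eq_iff(2)[of h g k] by (simp add: smult_Hom_homog[OF gh(3,1) \<phi>])
    then show "a \<odot>\<^bsub>Hom\<^esub> \<phi> \<in> mod_comp Hom (g \<otimes>\<^bsub>G\<^esub> h)"
      using smult_Hom_closed[OF a \<phi>] by simp
  next
    fix \<phi> assume \<phi>: "\<phi> \<in> carrier Hom"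
    show "\<one>\<^bsub>R\<^esub> \<odot>\<^bsub>Hom\<^esub> \<phi> = \<phi>"
      using HomD(1-3)[OF \<phi>] smult_Hom_homog[OF M.one_homog _ \<phi>]
      by (intro Hom_eqI smult_Hom_ext) auto
  qed (use Hom_abelian_group * smult_Hom_closed smult_Hom_l_distr smult_Hom_r_distr smult_Hom_assoc in
      \<open>simp_all del: Hom_simps\<close>)
  show "M.mcmp Hom \<phi> g g x = \<phi> g x" if "\<phi> \<in> carrier Hom" "g \<in> carrier G" "x \<in> carrier M"
    using * that by simp
qed

declare Hom_simps [simp del]

text \<open>
  Summing the components of \<open>\<phi>\<close> gives the linear map, in general without degree, that \<open>\<phi>\<close>
  stands for. It turns the convolution product into the pointwise one.
\<close>

definition total :: "('g \<Rightarrow> 'm \<Rightarrow> 'e) \<Rightarrow> 'm \<Rightarrow> 'e" where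
  "total \<phi> y = E.MD.gsum (\<lambda>g. \<phi> g y)"

lemma total_homog:
  assumes "\<phi> \<in> mod_comp Hom g" "g \<in> carrier G" "y \<in> carrier M"
  shows "total \<phi> y = \<phi> g y"
  unfolding total_def by (rule E.MD.gsum_single) (use assms HomD(3)[of \<phi>] in \<open>auto simp: Hom_simps(3)\<close>)

lemma total_closed: "\<lbrakk>\<phi> \<in> carrier Hom; y \<in> carrier M\<rbrakk> \<Longrightarrow> total \<phi> y \<in> carrier E"
  unfolding total_def using HomD(3)[of \<phi>] by (intro E.M.add.gfinprod_closed[simplified]) auto

lemma total_finite: "\<lbrakk>\<phi> \<in> carrier Hom; y \<in> carrier M\<rbrakk> \<Longrightarrow> finite {g \<in> carrier G. \<phi> g y \<noteq> \<zero>\<^bsub>E\<^esub>}"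
  using HomD(7)[of \<phi>] by (rule finite_subset[rotated]) auto

lemma total_add_left:
  assumes \<phi>: "\<phi> \<in> carrier Hom" and \<psi>: "\<psi> \<in> carrier Hom" and y: "y \<in> carrier M"
  shows "total (\<phi> \<oplus>\<^bsub>Hom\<^esub> \<psi>) y = total \<phi> y \<oplus>\<^bsub>E\<^esub> total \<psi> y"
proof -
  have "total (\<phi> \<oplus>\<^bsub>Hom\<^esub> \<psi>) y = E.MD.gsum (\<lambda>g. \<phi> g y \<oplus>\<^bsub>E\<^esub> \<psi> g y)"
    unfolding total_def using HomD(3)[OF \<phi>] HomD(3)[OF \<psi>] y
    by (intro E.M.add.gfinprod_cong) (auto simp: simp_implies_def Hom_simps(2))
  also have "\<dots> = total \<phi> y \<oplus>\<^bsub>E\<^esub> total \<psi> y"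
    using total_finite[OF \<phi> y] total_finite[OF \<psi> y] HomD(3)[OF \<phi>] HomD(3)[OF \<psi>] y
      E.M.add.gfinprod_distrib[of "carrier G" "\<lambda>g. \<phi> g y" "\<lambda>g. \<psi> g y"]
    by (simp add: image_subset_iff total_def)
  finally show ?thesis .
qed

lemma total_add_right:
  assumes \<phi>: "\<phi> \<in> carrier Hom" and y: "y \<in> carrier M" "z \<in> carrier M"
  shows "total \<phi> (y \<oplus>\<^bsub>M\<^esub> z) = total \<phi> y \<oplus>\<^bsub>E\<^esub> total \<phi> z"
proof -
  have "total \<phi> (y \<oplus>\<^bsub>M\<^esub> z) = E.MD.gsum (\<lambda>g. \<phi> g y \<oplus>\<^bsub>E\<^esub> \<phi> g z)"
    unfolding total_def using HomD(3,4)[OF \<phi>] y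
    by (intro E.M.add.gfinprod_cong) (auto simp: simp_implies_def)
  also have "\<dots> = total \<phi> y \<oplus>\<^bsub>E\<^esub> total \<phi> z"
    using total_finite[OF \<phi>] HomD(3)[OF \<phi>] y
      E.M.add.gfinprod_distrib[of "carrier G" "\<lambda>g. \<phi> g y" "\<lambda>g. \<phi> g z"]
    by (simp add: image_subset_iff total_def)
  finally show ?thesis .
qed

lemma total_smult:
  assumes \<phi>: "\<phi> \<in> carrier Hom" and a: "a \<in> carrier R" and y: "y \<in> carrier M"
  shows "total \<phi> (a \<odot>\<^bsub>M\<^esub> y) = a \<odot>\<^bsub>E\<^esub> total \<phi> y" and "total (a \<odot>\<^bsub>Hom\<^esub> \<phi>) y = a \<odot>\<^bsub>E\<^esub> total \<phi> y"
proof -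
  interpret H: graded_module G R Hom by (rule graded_module_Hom)
  have total_zero: "total \<zero>\<^bsub>Hom\<^esub> x = \<zero>\<^bsub>E\<^esub>" if "x \<in> carrier M" for x
    using total_homog[OF H.MD.comp_zero[OF M.G.one_closed] M.G.one_closed that] that
    by (simp add: Hom_simps(1))
  have "total \<phi> (a \<odot>\<^bsub>M\<^esub> y) = a \<odot>\<^bsub>E\<^esub> total \<phi> y \<and> total (a \<odot>\<^bsub>Hom\<^esub> \<phi>) y = a \<odot>\<^bsub>E\<^esub> total \<phi> y"
    using \<phi>
  proof (induction rule: H.MD.homog_induct)
    case zero
    show ?case using a y by (simp add: total_zero)
  next
    case (homog g \<phi>)
    have \<phi>: "\<phi> \<in> carrier Hom" by (rule H.MD.comp_sub[OF homog(2,1)])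
    have "total (a \<odot>\<^bsub>Hom\<^esub> \<phi>) y = a \<odot>\<^bsub>E\<^esub> total \<phi> y"
      using a
    proof (induction rule: M.RD.homog_induct)
      case zero
      show ?case using \<phi> y total_closed by (simp add: total_zero)
    next
      case (homog h a)
      then have "a \<odot>\<^bsub>Hom\<^esub> \<phi> \<in> mod_comp Hom (h \<otimes>\<^bsub>G\<^esub> g)"
        using H.mod_comp_smult \<open>g \<in> carrier G\<close> \<open>\<phi> \<in> mod_comp Hom g\<close> by blast
      then have "total (a \<odot>\<^bsub>Hom\<^esub> \<phi>) y = (a \<odot>\<^bsub>Hom\<^esub> \<phi>) (h \<otimes>\<^bsub>G\<^esub> g) y"
        using homog(1) \<open>g \<in> carrier G\<close> y by (intro total_homog) simp_all
      also have "\<dots> = a \<odot>\<^bsub>E\<^esub> \<phi> g y"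
        using homog \<open>g \<in> carrier G\<close> y \<phi> M.shift_eq_iff(2)[of g h "h \<otimes>\<^bsub>G\<^esub> g"] by (simp add: smult_Hom_homog)
      finally show ?case
        using total_homog[OF \<open>\<phi> \<in> mod_comp Hom g\<close> \<open>g \<in> carrier G\<close> y] by simp
    next
      case (add a b)
      then show ?case
        using \<phi> y total_closed by (simp add: H.smult_l_distr E.smult_l_distr total_add_left)
    qed
    moreover have "total \<phi> (a \<odot>\<^bsub>M\<^esub> y) = a \<odot>\<^bsub>E\<^esub> total \<phi> y"
      using homog a y HomD(5)[OF \<phi> homog(1)] by (simp add: total_homog[OF homog(2,1)])
    ultimately show ?case by simp
  next
    case (add \<phi> \<psi>)
    then show ?case
      using a y total_closed by (simp add: H.smult_r_distr E.smult_r_distr total_add_left)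
  qed
  then show "total \<phi> (a \<odot>\<^bsub>M\<^esub> y) = a \<odot>\<^bsub>E\<^esub> total \<phi> y" "total (a \<odot>\<^bsub>Hom\<^esub> \<phi>) y = a \<odot>\<^bsub>E\<^esub> total \<phi> y"
    by blast+
qed

end


section \<open>The graded tensor product\<close>

locale graded_tensor = N: graded_module G R N + M: graded_module G R M
  for G :: "('g, 'j) monoid_scheme" and R :: "('r, 'g, 'k) gring_scheme"
    and N :: "('r, 'n, 'g) gmodule" and M :: "('r, 'm, 'g) gmodule"
begin

abbreviation "F \<equiv> tensor_free N M"
abbreviation "K \<equiv> tensor_rel R N M"
abbreviation "T \<equiv> tensor_group R N M"
abbreviation "cls \<equiv> tensor_class R N M"
abbreviation "pure x y \<equiv> cls (frag_of (x, y))"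

lemma comm_group_F: "comm_group F"
  unfolding tensor_free_def by (rule abelian_free_Abelian_group)

lemma F_simps [simp]:
  "c \<in> carrier F \<longleftrightarrow> Poly_Mapping.keys c \<subseteq> carrier N \<times> carrier M"
  "c \<otimes>\<^bsub>F\<^esub> d = c + d" "\<one>\<^bsub>F\<^esub> = 0"
  "Poly_Mapping.keys c \<subseteq> carrier N \<times> carrier M \<Longrightarrow> inv\<^bsub>F\<^esub> c = - c"
  by (simp_all add: tensor_free_def)

lemma keys_add_sub: "\<lbrakk>Poly_Mapping.keys c \<subseteq> S; Poly_Mapping.keys d \<subseteq> S\<rbrakk> \<Longrightarrow> Poly_Mapping.keys (c + d) \<subseteq> S"
  using keys_add[of c d] by blast

lemma keys_diff_sub: "\<lbrakk>Poly_Mapping.keys c \<subseteq> S; Poly_Mapping.keys d \<subseteq> S\<rbrakk> \<Longrightarrow> Poly_Mapping.keys (c - d) \<subseteq> S"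
  using keys_diff[of c d] by blast

definition rels :: "('n \<times> 'm \<Rightarrow>\<^sub>0 int) set" where
  "rels = {frag_of (x \<oplus>\<^bsub>N\<^esub> x', y) - frag_of (x, y) - frag_of (x', y) | x x' y.
         x \<in> carrier N \<and> x' \<in> carrier N \<and> y \<in> carrier M} \<union>
      {frag_of (x, y \<oplus>\<^bsub>M\<^esub> y') - frag_of (x, y) - frag_of (x, y') | x y y'.
         x \<in> carrier N \<and> y \<in> carrier M \<and> y' \<in> carrier M} \<union>
      {frag_of (a \<odot>\<^bsub>N\<^esub> x, y) - frag_of (x, a \<odot>\<^bsub>M\<^esub> y) | a x y.
         a \<in> carrier R \<and> x \<in> carrier N \<and> y \<in> carrier M}"

lemma K_eq: "K = generate F rels"
  by (simp add: tensor_rel_def rels_def)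

lemma rels_sub: "rels \<subseteq> carrier F"
  unfolding rels_def
  by (intro subsetI, elim UnE CollectE exE conjE) (simp_all add: keys_diff_sub)

lemma subgroup_K: "subgroup K F"
  unfolding K_eq using rels_sub by (intro group.generate_is_subgroup comm_group.axioms(2)[OF comm_group_F])

lemma normal_K: "K \<lhd> F"
  using comm_group.subgroup_imp_normal[OF comm_group_F subgroup_K] .

lemma comm_group_T: "comm_group T"
  unfolding tensor_group_def by (rule comm_group.abelian_FactGroup[OF comm_group_F subgroup_K])

sublocale T: comm_group T by (rule comm_group_T)

lemma carrier_T: "carrier T = cls ` carrier F"
  by (simp add: tensor_group_def carrier_FactGroup tensor_class_def[abs_def])

lemma cls_hom: "cls \<in> hom F T"
  using normal.r_coset_hom_Mod[OF normal_K] by (simp add: tensor_group_def tensor_class_def[abs_def])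

lemma cls_closed: "Poly_Mapping.keys c \<subseteq> carrier N \<times> carrier M \<Longrightarrow> cls c \<in> carrier T"
  using hom_in_carrier[OF cls_hom, of c] by simp

lemma cls_add: "\<lbrakk>Poly_Mapping.keys c \<subseteq> carrier N \<times> carrier M; Poly_Mapping.keys d \<subseteq> carrier N \<times> carrier M\<rbrakk> \<Longrightarrow>
    cls (c + d) = cls c \<otimes>\<^bsub>T\<^esub> cls d"
  using hom_mult[OF cls_hom, of c d] by simp

lemma cls_zero: "cls 0 = \<one>\<^bsub>T\<^esub>"
  using hom_one[OF cls_hom] comm_group.axioms(2)[OF comm_group_F] T.is_group by simp

lemma cls_diff: "\<lbrakk>Poly_Mapping.keys c \<subseteq> carrier N \<times> carrier M; Poly_Mapping.keys d \<subseteq> carrier N \<times> carrier M\<rbrakk> \<Longrightarrow>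
    cls (c - d) = cls c \<otimes>\<^bsub>T\<^esub> inv\<^bsub>T\<^esub> cls d"
  using cls_add[of "c - d" d] keys_diff_sub[of c "carrier N \<times> carrier M" d]
  by (simp add: cls_closed T.inv_solve_right)

lemma mem_cls:
  assumes "c \<in> cls d" "Poly_Mapping.keys d \<subseteq> carrier N \<times> carrier M"
  shows "Poly_Mapping.keys c \<subseteq> carrier N \<times> carrier M" "cls c = cls d"
proof -
  interpret F: comm_group F by (rule comm_group_F)
  have "K \<subseteq> carrier F" by (rule subgroup.subset[OF subgroup_K])
  then have "c \<in> carrier F"
    using assms(1) F.r_coset_subset_G[of K d] iffD2[OF F_simps(1) assms(2)]
    unfolding tensor_class_def by blast
  then show "Poly_Mapping.keys c \<subseteq> carrier N \<times> carrier M" by simp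
  show "cls c = cls d"
    using F.repr_independence[OF _ _ subgroup_K, of c d] assms by (simp add: tensor_class_def)
qed

lemma self_mem_cls: "Poly_Mapping.keys d \<subseteq> carrier N \<times> carrier M \<Longrightarrow> d \<in> cls d"
  using group.rcos_self[OF comm_group.axioms(2)[OF comm_group_F] _ subgroup_K, of d]
  by (simp add: tensor_class_def)

lemma cls_rel: "r \<in> rels \<Longrightarrow> cls r = \<one>\<^bsub>T\<^esub>"
  using group.coset_join2[OF comm_group.axioms(2)[OF comm_group_F] _ subgroup_K, of r] rels_sub
  by (auto simp: tensor_class_def tensor_group_def K_eq generate.incl simp del: F_simps)

lemma pure_closed [simp, intro]: "\<lbrakk>x \<in> carrier N; y \<in> carrier M\<rbrakk> \<Longrightarrow> pure x y \<in> carrier T"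
  by (rule cls_closed) simp

lemma cls_eq_if_diff:
  assumes "cls (c - d) = \<one>\<^bsub>T\<^esub>" "Poly_Mapping.keys c \<subseteq> carrier N \<times> carrier M" "Poly_Mapping.keys d \<subseteq> carrier N \<times> carrier M"
  shows "cls c = cls d"
  using assms T.inv_equality[of "cls c" "inv\<^bsub>T\<^esub> cls d"] by (simp add: cls_diff cls_closed)

lemma pure_add_left:
  assumes "x \<in> carrier N" "x' \<in> carrier N" "y \<in> carrier M"
  shows "pure (x \<oplus>\<^bsub>N\<^esub> x') y = pure x y \<otimes>\<^bsub>T\<^esub> pure x' y"
proof -
  have "frag_of (x \<oplus>\<^bsub>N\<^esub> x', y) - frag_of (x, y) - frag_of (x', y) \<in> rels"
    using assms by (auto simp: rels_def)
  from cls_rel[OF this] have "cls (frag_of (x \<oplus>\<^bsub>N\<^esub> x', y) - (frag_of (x, y) + frag_of (x', y))) = \<one>\<^bsub>T\<^esub>"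
    by (simp add: diff_diff_eq)
  from cls_eq_if_diff[OF this] show ?thesis
    using assms by (simp add: cls_add keys_add_sub)
qed

lemma pure_add_right:
  assumes "x \<in> carrier N" "y \<in> carrier M" "y' \<in> carrier M"
  shows "pure x (y \<oplus>\<^bsub>M\<^esub> y') = pure x y \<otimes>\<^bsub>T\<^esub> pure x y'"
proof -
  have "frag_of (x, y \<oplus>\<^bsub>M\<^esub> y') - frag_of (x, y) - frag_of (x, y') \<in> rels"
    using assms by (auto simp: rels_def)
  from cls_rel[OF this] have "cls (frag_of (x, y \<oplus>\<^bsub>M\<^esub> y') - (frag_of (x, y) + frag_of (x, y'))) = \<one>\<^bsub>T\<^esub>"
    by (simp add: diff_diff_eq)
  from cls_eq_if_diff[OF this] show ?thesis
    using assms by (simp add: cls_add keys_add_sub)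
qed

lemma pure_smult:
  assumes "a \<in> carrier R" "x \<in> carrier N" "y \<in> carrier M"
  shows "pure (a \<odot>\<^bsub>N\<^esub> x) y = pure x (a \<odot>\<^bsub>M\<^esub> y)"
proof -
  have "frag_of (a \<odot>\<^bsub>N\<^esub> x, y) - frag_of (x, a \<odot>\<^bsub>M\<^esub> y) \<in> rels"
    using assms by (auto simp: rels_def)
  from cls_eq_if_diff[OF cls_rel[OF this]] show ?thesis
    using assms by simp
qed

lemma pure_zero_left: "y \<in> carrier M \<Longrightarrow> pure \<zero>\<^bsub>N\<^esub> y = \<one>\<^bsub>T\<^esub>"
  using pure_add_left[of "\<zero>\<^bsub>N\<^esub>" "\<zero>\<^bsub>N\<^esub>" y] by (simp add: T.r_cancel_one')

lemma pure_zero_right: "x \<in> carrier N \<Longrightarrow> pure x \<zero>\<^bsub>M\<^esub> = \<one>\<^bsub>T\<^esub>"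
  using pure_add_right[of x "\<zero>\<^bsub>M\<^esub>" "\<zero>\<^bsub>M\<^esub>"] by (simp add: T.r_cancel_one')

lemma pure_minus:
  assumes "x \<in> carrier N" "y \<in> carrier M"
  shows "inv\<^bsub>T\<^esub> pure x y = pure (\<ominus>\<^bsub>N\<^esub> x) y"
  using assms by (intro T.inv_equality) (simp_all add: pure_add_left[symmetric] N.M.l_neg pure_zero_left)

text \<open>
  Differences of generators reduce to sums since the inverse of $x \otimes y$ is $(-x) \otimes y$.
\<close>

lemma tensor_induct [consumes 1, case_names one pure mult]:
  assumes "X \<in> carrier T" and one: "P \<one>\<^bsub>T\<^esub>"
    and pure: "\<And>x y. \<lbrakk>x \<in> carrier N; y \<in> carrier M\<rbrakk> \<Longrightarrow> P (pure x y)"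
    and mult: "\<And>X Y. \<lbrakk>X \<in> carrier T; Y \<in> carrier T; P X; P Y\<rbrakk> \<Longrightarrow> P (X \<otimes>\<^bsub>T\<^esub> Y)"
  shows "P X"
proof -
  obtain c where c: "Poly_Mapping.keys c \<subseteq> carrier N \<times> carrier M" "X = cls c"
    using assms(1) by (auto simp: carrier_T)
  have "P (cls c) \<and> P (inv\<^bsub>T\<^esub> cls c)"
    using c(1)
  proof (induction c rule: free_Abelian_group_induct[consumes 1, case_names zero diff gen])
    case zero
    then show ?case by (simp add: cls_zero one)
  next
    case (diff c d)
    then show ?case
      using mult[of "cls c" "inv\<^bsub>T\<^esub> cls d"] mult[of "inv\<^bsub>T\<^esub> cls c" "cls d"]
      by (simp add: cls_diff cls_closed T.inv_mult)
  next
    case (gen a)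
    then show ?case by (auto simp: pure pure_minus)
  qed
  then show ?thesis by (simp add: c(2))
qed

text \<open>
  The target is an arbitrary commutative group because the proof of right exactness maps into a
  quotient group of a tensor product; linearity over \<open>R\<close> is recovered from additivity by
  \<open>tensor_induct\<close> where it matters.
\<close>

lemma tensor_universal:
  assumes L: "comm_group L"
    and cl: "\<And>x y. \<lbrakk>x \<in> carrier N; y \<in> carrier M\<rbrakk> \<Longrightarrow> \<beta> x y \<in> carrier L"
    and left: "\<And>x x' y. \<lbrakk>x \<in> carrier N; x' \<in> carrier N; y \<in> carrier M\<rbrakk> \<Longrightarrow>
      \<beta> (x \<oplus>\<^bsub>N\<^esub> x') y = \<beta> x y \<otimes>\<^bsub>L\<^esub> \<beta> x' y"
    and right: "\<And>x y y'. \<lbrakk>x \<in> carrier N; y \<in> carrier M; y' \<in> carrier M\<rbrakk> \<Longrightarrow>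
      \<beta> x (y \<oplus>\<^bsub>M\<^esub> y') = \<beta> x y \<otimes>\<^bsub>L\<^esub> \<beta> x y'"
    and bal: "\<And>a x y. \<lbrakk>a \<in> carrier R; x \<in> carrier N; y \<in> carrier M\<rbrakk> \<Longrightarrow>
      \<beta> (a \<odot>\<^bsub>N\<^esub> x) y = \<beta> x (a \<odot>\<^bsub>M\<^esub> y)"
  obtains \<phi> where "\<phi> \<in> hom T L" "\<And>x y. \<lbrakk>x \<in> carrier N; y \<in> carrier M\<rbrakk> \<Longrightarrow> \<phi> (pure x y) = \<beta> x y"
proof -
  interpret L: comm_group L by fact
  interpret F: comm_group F by (rule comm_group_F)
  have "(\<lambda>(x, y). \<beta> x y) ` (carrier N \<times> carrier M) \<subseteq> carrier L" using cl by auto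
  then obtain h where h: "h \<in> hom F L" "\<And>x y. \<lbrakk>x \<in> carrier N; y \<in> carrier M\<rbrakk> \<Longrightarrow> h (frag_of (x, y)) = \<beta> x y"
    unfolding tensor_free_def by (rule L.free_Abelian_group_universal) auto
  interpret h: group_hom F L h
    by (intro group_hom.intro group_hom_axioms.intro h(1) F.is_group L.is_group)
  have diff: "h (c - d) = h c \<otimes>\<^bsub>L\<^esub> inv\<^bsub>L\<^esub> h d"
    if "Poly_Mapping.keys c \<subseteq> carrier N \<times> carrier M" "Poly_Mapping.keys d \<subseteq> carrier N \<times> carrier M" for c d
    using h.hom_mult[of c "inv\<^bsub>F\<^esub> d"] h.hom_inv[of d] that by simp
  \<comment> \<open>The map on the free group kills the defining relations and so factors through the quotient.\<close>
  have "h r = \<one>\<^bsub>L\<^esub>" if "r \<in> rels" for r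
  proof -
    have cancel: "u \<otimes>\<^bsub>L\<^esub> v \<otimes>\<^bsub>L\<^esub> inv\<^bsub>L\<^esub> u \<otimes>\<^bsub>L\<^esub> inv\<^bsub>L\<^esub> v = \<one>\<^bsub>L\<^esub>" if "u \<in> carrier L" "v \<in> carrier L" for u v
    proof -
      have "u \<otimes>\<^bsub>L\<^esub> v \<otimes>\<^bsub>L\<^esub> inv\<^bsub>L\<^esub> u = v"
        using that by (metis L.inv_closed L.inv_solve_right L.m_closed L.m_comm)
      then show ?thesis using that by simp
    qed
    from that show ?thesis
      unfolding rels_def
      by (elim UnE CollectE exE conjE) (simp_all add: diff keys_diff_sub h(2) left right bal cl cancel)
  qed
  then have "rels \<subseteq> kernel F L h"
    using rels_sub unfolding kernel_def by blast
  then have K: "K \<subseteq> kernel F L h"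
    unfolding K_eq by (rule F.generate_subgroup_incl[OF _ h.subgroup_kernel])
  obtain \<phi> where "\<phi> \<in> hom (F Mod K) L" "\<And>c. c \<in> carrier F \<Longrightarrow> \<phi> (r_coset F K c) = h c"
    using h.FactGroup_universal_kernel[OF normal_K K] by blast
  then show thesis
    by (intro that[of \<phi>]) (simp_all add: tensor_group_def tensor_class_def h(2))
qed

end

text \<open>
  One formula on cosets gives both the scalar multiplication of the tensor product and its
  functoriality in the first factor, because multiplication by a scalar is linear, \<open>R\<close> being
  commutative. All representatives of a coset have the same image because the formula agrees on
  each of them with the map supplied by the universal property.
\<close>

lemma tensor_coset_map:
  assumes "graded_tensor G R N M" "graded_tensor G R P M"
    and f: "\<And>x. x \<in> carrier N \<Longrightarrow> f x \<in> carrier P"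
    and f_add: "\<And>x y. \<lbrakk>x \<in> carrier N; y \<in> carrier N\<rbrakk> \<Longrightarrow> f (x \<oplus>\<^bsub>N\<^esub> y) = f x \<oplus>\<^bsub>P\<^esub> f y"
    and f_smult: "\<And>a x. \<lbrakk>a \<in> carrier R; x \<in> carrier N\<rbrakk> \<Longrightarrow> f (a \<odot>\<^bsub>N\<^esub> x) = a \<odot>\<^bsub>P\<^esub> f x"
  defines "\<Phi> \<equiv> \<lambda>X. \<Union>c\<in>X. tensor_class R P M (frag_extend (\<lambda>(x, y). frag_of (f x, y)) c)"
  shows "\<Phi> \<in> hom (tensor_group R N M) (tensor_group R P M)"
    and "\<lbrakk>x \<in> carrier N; y \<in> carrier M\<rbrakk> \<Longrightarrow>
      \<Phi> (tensor_class R N M (frag_of (x, y))) = tensor_class R P M (frag_of (f x, y))"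
proof -
  interpret N: graded_tensor G R N M by fact
  interpret P: graded_tensor G R P M by fact
  obtain \<phi> where \<phi>: "\<phi> \<in> hom N.T P.T"
    and \<phi>_pure: "\<And>x y. \<lbrakk>x \<in> carrier N; y \<in> carrier M\<rbrakk> \<Longrightarrow> \<phi> (N.pure x y) = P.pure (f x) y"
    by (rule N.tensor_universal[OF P.comm_group_T, of "\<lambda>x y. P.pure (f x) y"])
      (simp_all add: f f_add f_smult P.pure_add_left P.pure_add_right P.pure_smult)
  interpret \<phi>: group_hom N.T P.T \<phi>
    by (intro group_hom.intro group_hom_axioms.intro \<phi> N.T.is_group P.T.is_group)
  let ?e = "frag_extend (\<lambda>(x, y). frag_of (f x, y))"
  have e: "Poly_Mapping.keys (?e c) \<subseteq> carrier P \<times> carrier M \<and> P.cls (?e c) = \<phi> (N.cls c)"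
    if "Poly_Mapping.keys c \<subseteq> carrier N \<times> carrier M" for c
    using that
  proof (induction c rule: free_Abelian_group_induct[consumes 1, case_names zero diff gen])
    case zero
    then show ?case by (simp add: P.cls_zero N.cls_zero)
  next
    case (diff c d)
    then show ?case
      by (simp add: frag_extend_diff P.keys_diff_sub P.cls_diff N.cls_diff N.cls_closed)
  next
    case (gen a)
    then show ?case by (auto simp: f \<phi>_pure)
  qed
  have eq: "\<Phi> X = \<phi> X" if X: "X \<in> carrier N.T" for X
  proof -
    obtain d where d: "Poly_Mapping.keys d \<subseteq> carrier N \<times> carrier M" "X = N.cls d"
      using X by (auto simp: N.carrier_T)
    have "P.cls (?e c) = \<phi> X" if "c \<in> X" for c
      using e[OF N.mem_cls(1)] N.mem_cls(2) that d by simp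
    moreover have "d \<in> X" using N.self_mem_cls d by simp
    ultimately show ?thesis unfolding \<Phi>_def by blast
  qed
  show "\<Phi> \<in> hom N.T P.T"
    by (rule homI) (simp_all add: eq)
  show "\<Phi> (N.pure x y) = P.pure (f x) y" if "x \<in> carrier N" "y \<in> carrier M"
    using that by (simp add: eq \<phi>_pure)
qed


lemma hom_eq_on_generate:
  assumes "group H" "group L" "\<phi> \<in> hom H L" "\<psi> \<in> hom H L" "S \<subseteq> carrier H"
    and S: "\<And>x. x \<in> S \<Longrightarrow> \<phi> x = \<psi> x" and X: "X \<in> generate H S"
  shows "\<phi> X = \<psi> X"
proof -
  interpret H: group H by fact
  interpret \<phi>: group_hom H L \<phi> by (intro group_hom.intro group_hom_axioms.intro assms)
  interpret \<psi>: group_hom H L \<psi> by (intro group_hom.intro group_hom_axioms.intro assms)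
  from X show ?thesis
  proof induction
    case (eng x y)
    then show ?case using H.generate_in_carrier[OF assms(5)] by simp
  next
    case (inv x)
    then show ?case using assms(5) S by (metis \<phi>.hom_inv \<psi>.hom_inv subsetD)
  qed (use S in simp_all)
qed

lemma hom_generate_sub:
  assumes "group H" "group L" "\<phi> \<in> hom H L" "S \<subseteq> carrier H" "subgroup S' L"
    and S: "\<And>x. x \<in> S \<Longrightarrow> \<phi> x \<in> S'" and X: "X \<in> generate H S"
  shows "\<phi> X \<in> S'"
proof -
  interpret H: group H by fact
  interpret \<phi>: group_hom H L \<phi> by (intro group_hom.intro group_hom_axioms.intro assms)
  interpret S': subgroup S' L by fact
  from X show ?thesis
  proof induction
    case (eng x y)
    then show ?case using H.generate_in_carrier[OF assms(4)] by simp
  next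
    case (inv x)
    then have "x \<in> carrier H" using assms(4) by blast
    then show ?case using S[OF inv] by simp
  qed (use S in simp_all)
qed

context graded_tensor
begin

abbreviation "Ten \<equiv> gr_tensor G R N M"

definition homog_tensors :: "'g \<Rightarrow> ('n \<times> 'm \<Rightarrow>\<^sub>0 int) set set" where
  "homog_tensors g = {pure x y | x y h k. h \<in> carrier G \<and> k \<in> carrier G \<and> h \<otimes>\<^bsub>G\<^esub> k = g \<and>
     x \<in> mod_comp N h \<and> y \<in> mod_comp M k}"

lemma Ten_simps [simp]:
  "carrier Ten = carrier T" "\<zero>\<^bsub>Ten\<^esub> = \<one>\<^bsub>T\<^esub>" "X \<oplus>\<^bsub>Ten\<^esub> Y = X \<otimes>\<^bsub>T\<^esub> Y"
  "mod_comp Ten g = generate T (homog_tensors g)"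
  by (simp_all add: gr_tensor_def homog_tensors_def)

lemma abelian_group_Ten: "abelian_group Ten"
  by (rule abelian_groupI) (auto simp: T.m_ac intro: T.l_inv)

lemma minus_Ten: "X \<in> carrier T \<Longrightarrow> \<ominus>\<^bsub>Ten\<^esub> X = inv\<^bsub>T\<^esub> X"
  by (rule abelian_group.minus_equality[OF abelian_group_Ten]) simp_all

lemma
  assumes a: "a \<in> carrier R"
  shows smult_Ten_hom: "(\<lambda>X. a \<odot>\<^bsub>Ten\<^esub> X) \<in> hom T T"
    and smult_Ten_pure: "\<lbrakk>x \<in> carrier N; y \<in> carrier M\<rbrakk> \<Longrightarrow> a \<odot>\<^bsub>Ten\<^esub> pure x y = pure (a \<odot>\<^bsub>N\<^esub> x) y"
proof -
  have f: "a \<odot>\<^bsub>N\<^esub> (b \<odot>\<^bsub>N\<^esub> x) = b \<odot>\<^bsub>N\<^esub> (a \<odot>\<^bsub>N\<^esub> x)" if "b \<in> carrier R" "x \<in> carrier N" for b x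
    using a that N.R.m_comm[of a b] by (simp add: N.smult_assoc1[symmetric])
  note * = tensor_coset_map[OF graded_tensor_axioms graded_tensor_axioms, of "\<lambda>x. a \<odot>\<^bsub>N\<^esub> x"]
  show "(\<lambda>X. a \<odot>\<^bsub>Ten\<^esub> X) \<in> hom T T"
    using *(1) a f by (simp add: gr_tensor_def N.smult_r_distr)
  show "a \<odot>\<^bsub>Ten\<^esub> pure x y = pure (a \<odot>\<^bsub>N\<^esub> x) y" if "x \<in> carrier N" "y \<in> carrier M"
    using *(2) a f that by (simp add: gr_tensor_def N.smult_r_distr)
qed

lemma smult_Ten [simp]:
  assumes a: "a \<in> carrier R"
  shows "X \<in> carrier T \<Longrightarrow> a \<odot>\<^bsub>Ten\<^esub> X \<in> carrier T"
    and "\<lbrakk>X \<in> carrier T; Y \<in> carrier T\<rbrakk> \<Longrightarrow> a \<odot>\<^bsub>Ten\<^esub> (X \<otimes>\<^bsub>T\<^esub> Y) = (a \<odot>\<^bsub>Ten\<^esub> X) \<otimes>\<^bsub>T\<^esub> (a \<odot>\<^bsub>Ten\<^esub> Y)"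
    and "a \<odot>\<^bsub>Ten\<^esub> \<one>\<^bsub>T\<^esub> = \<one>\<^bsub>T\<^esub>"
  using hom_in_carrier[OF smult_Ten_hom[OF a]] hom_mult[OF smult_Ten_hom[OF a]]
    hom_one[OF smult_Ten_hom[OF a] T.is_group T.is_group] by auto

lemma homog_tensors_sub: "g \<in> carrier G \<Longrightarrow> homog_tensors g \<subseteq> carrier T"
  by (auto simp: homog_tensors_def)

lemma homog_tensorsI:
  "\<lbrakk>h \<in> carrier G; k \<in> carrier G; x \<in> mod_comp N h; y \<in> mod_comp M k\<rbrakk> \<Longrightarrow>
    pure x y \<in> homog_tensors (h \<otimes>\<^bsub>G\<^esub> k)"
  by (auto simp: homog_tensors_def)

text \<open>
  This is the component of degree \<open>g\<close> of $x \otimes y$. Once it is known to be bilinear, the universal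
  property turns it into the projection of the tensor product to degree \<open>g\<close>, which is what shows
  that the homogeneous tensors form a direct sum.
\<close>

definition pure_cmp :: "'g \<Rightarrow> 'n \<Rightarrow> 'm \<Rightarrow> ('n \<times> 'm \<Rightarrow>\<^sub>0 int) set" where
  "pure_cmp g x y = gfinprod T (\<lambda>h. pure (N.mcmp N x h) (N.mcmp M y (inv\<^bsub>G\<^esub> h \<otimes>\<^bsub>G\<^esub> g))) (carrier G)"

lemma pure_cmp_closed:
  "\<lbrakk>g \<in> carrier G; x \<in> carrier N; y \<in> carrier M\<rbrakk> \<Longrightarrow> pure_cmp g x y \<in> carrier T"
  unfolding pure_cmp_def by (intro T.gfinprod_closed) auto

lemma pure_cmp_finite:
  assumes "g \<in> carrier G" "x \<in> carrier N" "y \<in> carrier M"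
  shows "finite {h \<in> carrier G. pure (N.mcmp N x h) (N.mcmp M y (inv\<^bsub>G\<^esub> h \<otimes>\<^bsub>G\<^esub> g)) \<noteq> \<one>\<^bsub>T\<^esub>}"
  using assms by (intro finite_subset[OF _ N.MD.cmp_finite[OF assms(2)]]) (auto simp: pure_zero_left)

lemma pure_cmp_add_left:
  assumes "g \<in> carrier G" "x \<in> carrier N" "x' \<in> carrier N" "y \<in> carrier M"
  shows "pure_cmp g (x \<oplus>\<^bsub>N\<^esub> x') y = pure_cmp g x y \<otimes>\<^bsub>T\<^esub> pure_cmp g x' y"
proof -
  let ?s = "\<lambda>x h. pure (N.mcmp N x h) (N.mcmp M y (inv\<^bsub>G\<^esub> h \<otimes>\<^bsub>G\<^esub> g))"
  have "pure_cmp g (x \<oplus>\<^bsub>N\<^esub> x') y = gfinprod T (\<lambda>h. ?s x h \<otimes>\<^bsub>T\<^esub> ?s x' h) (carrier G)"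
    unfolding pure_cmp_def using assms
    by (intro T.gfinprod_cong) (auto simp: simp_implies_def N.MD.cmp_add pure_add_left)
  also have "\<dots> = pure_cmp g x y \<otimes>\<^bsub>T\<^esub> pure_cmp g x' y"
    using assms pure_cmp_finite T.gfinprod_distrib[of "carrier G" "?s x" "?s x'"]
    by (simp add: image_subset_iff pure_cmp_def)
  finally show ?thesis .
qed

lemma pure_cmp_add_right:
  assumes "g \<in> carrier G" "x \<in> carrier N" "y \<in> carrier M" "y' \<in> carrier M"
  shows "pure_cmp g x (y \<oplus>\<^bsub>M\<^esub> y') = pure_cmp g x y \<otimes>\<^bsub>T\<^esub> pure_cmp g x y'"
proof -
  let ?s = "\<lambda>y h. pure (N.mcmp N x h) (N.mcmp M y (inv\<^bsub>G\<^esub> h \<otimes>\<^bsub>G\<^esub> g))"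
  have "pure_cmp g x (y \<oplus>\<^bsub>M\<^esub> y') = gfinprod T (\<lambda>h. ?s y h \<otimes>\<^bsub>T\<^esub> ?s y' h) (carrier G)"
    unfolding pure_cmp_def using assms
    by (intro T.gfinprod_cong) (auto simp: simp_implies_def M.MD.cmp_add pure_add_right)
  also have "\<dots> = pure_cmp g x y \<otimes>\<^bsub>T\<^esub> pure_cmp g x y'"
    using assms pure_cmp_finite T.gfinprod_distrib[of "carrier G" "?s y" "?s y'"]
    by (simp add: image_subset_iff pure_cmp_def)
  finally show ?thesis .
qed

lemma pure_cmp_homog:
  assumes x: "x \<in> mod_comp N h" "h \<in> carrier G" and y: "y \<in> mod_comp M k" "k \<in> carrier G"
    and g: "g \<in> carrier G"
  shows "pure_cmp g x y = (if h \<otimes>\<^bsub>G\<^esub> k = g then pure x y else \<one>\<^bsub>T\<^esub>)"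
proof -
  have xy: "x \<in> carrier N" "y \<in> carrier M" using x y by blast+
  have "pure_cmp g x y = pure x (N.mcmp M y (inv\<^bsub>G\<^esub> h \<otimes>\<^bsub>G\<^esub> g))"
    unfolding pure_cmp_def
    by (subst T.gfinprod_single[of _ h]) (use x y g xy in \<open>auto simp: N.MD.cmp_homog pure_zero_left\<close>)
  then show ?thesis
    using M.MD.cmp_homog[OF y, of "inv\<^bsub>G\<^esub> h \<otimes>\<^bsub>G\<^esub> g"] N.shift_eq_iff(1)[of k h g] x y g xy
    by (auto simp: pure_zero_right)
qed

text \<open>
  Both sides are additive in \<open>a\<close>, \<open>x\<close> and \<open>y\<close>, so all three may be taken homogeneous, one after
  the other. Then either both sides vanish or both are a balanced pair of pure tensors.
\<close>

lemma pure_cmp_balanced: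
  assumes g: "g \<in> carrier G" and a: "a \<in> carrier R" and x: "x \<in> carrier N" and y: "y \<in> carrier M"
  shows "pure_cmp g (a \<odot>\<^bsub>N\<^esub> x) y = pure_cmp g x (a \<odot>\<^bsub>M\<^esub> y)"
proof -
  note [simp] = pure_cmp_closed[OF g] pure_cmp_add_left[OF g] pure_cmp_add_right[OF g]
  have 1: "pure_cmp g (a \<odot>\<^bsub>N\<^esub> x) y = pure_cmp g x (a \<odot>\<^bsub>M\<^esub> y)"
    if "a \<in> ring_comp R l" "l \<in> carrier G" "x \<in> mod_comp N h" "h \<in> carrier G" "y \<in> mod_comp M k" "k \<in> carrier G"
    for a l x h y k
  proof -
    have "a \<odot>\<^bsub>N\<^esub> x \<in> mod_comp N (l \<otimes>\<^bsub>G\<^esub> h)" "a \<odot>\<^bsub>M\<^esub> y \<in> mod_comp M (l \<otimes>\<^bsub>G\<^esub> k)"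
      using that N.mod_comp_smult M.mod_comp_smult by blast+
    moreover have "l \<otimes>\<^bsub>G\<^esub> h \<otimes>\<^bsub>G\<^esub> k = h \<otimes>\<^bsub>G\<^esub> (l \<otimes>\<^bsub>G\<^esub> k)"
      using that by (simp add: N.G.m_ac)
    moreover have "pure (a \<odot>\<^bsub>N\<^esub> x) y = pure x (a \<odot>\<^bsub>M\<^esub> y)"
      using that N.MD.comp_sub M.MD.comp_sub N.RD.comp_sub by (intro pure_smult)
    ultimately show ?thesis
      using that g by (simp add: pure_cmp_homog)
  qed
  have 2: "pure_cmp g (a \<odot>\<^bsub>N\<^esub> x) y = pure_cmp g x (a \<odot>\<^bsub>M\<^esub> y)"
    if "a \<in> ring_comp R l" "l \<in> carrier G" "x \<in> mod_comp N h" "h \<in> carrier G" "y \<in> carrier M" for a l x h y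
    by (rule M.MD.additive_ext[OF T.is_group, of "\<lambda>y. pure_cmp g (a \<odot>\<^bsub>N\<^esub> x) y" "\<lambda>y. pure_cmp g x (a \<odot>\<^bsub>M\<^esub> y)"])
      (use that 1 N.MD.comp_sub[OF that(3,4)] N.RD.comp_sub[OF that(1,2)] in \<open>auto simp: M.smult_r_distr\<close>)
  have 3: "pure_cmp g (a \<odot>\<^bsub>N\<^esub> x) y = pure_cmp g x (a \<odot>\<^bsub>M\<^esub> y)"
    if "a \<in> ring_comp R l" "l \<in> carrier G" "x \<in> carrier N" "y \<in> carrier M" for a l x y
    by (rule N.MD.additive_ext[OF T.is_group, of "\<lambda>x. pure_cmp g (a \<odot>\<^bsub>N\<^esub> x) y" "\<lambda>x. pure_cmp g x (a \<odot>\<^bsub>M\<^esub> y)"])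
      (use that 2 N.RD.comp_sub[OF that(1,2)] in \<open>auto simp: N.smult_r_distr\<close>)
  show ?thesis
    by (rule N.RD.additive_ext[OF T.is_group, of "\<lambda>a. pure_cmp g (a \<odot>\<^bsub>N\<^esub> x) y" "\<lambda>a. pure_cmp g x (a \<odot>\<^bsub>M\<^esub> y)"])
      (use assms 3 in \<open>auto simp: N.smult_l_distr M.smult_l_distr\<close>)
qed

lemma graded_module_Ten: "graded_module G R Ten"
proof -
  have "\<exists>\<phi>\<in>hom T T. \<forall>x\<in>carrier N. \<forall>y\<in>carrier M. \<phi> (pure x y) = pure_cmp g x y"
    if "g \<in> carrier G" for g
    by (rule tensor_universal[OF comm_group_T, of "pure_cmp g"])
      (use that in \<open>auto simp: pure_cmp_closed pure_cmp_add_left pure_cmp_add_right pure_cmp_balanced\<close>)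
  then obtain p where p: "\<And>g. g \<in> carrier G \<Longrightarrow> p g \<in> hom T T"
    and p_pure: "\<And>g x y. \<lbrakk>g \<in> carrier G; x \<in> carrier N; y \<in> carrier M\<rbrakk> \<Longrightarrow> p g (pure x y) = pure_cmp g x y"
    by metis
  have sub: "subgroup (generate T (homog_tensors g)) T" if "g \<in> carrier G" for g
    using homog_tensors_sub[OF that] by (rule T.generate_is_subgroup)
  have incl: "pure x y \<in> generate T (homog_tensors (h \<otimes>\<^bsub>G\<^esub> k))"
    if "h \<in> carrier G" "k \<in> carrier G" "x \<in> mod_comp N h" "y \<in> mod_comp M k" for x y h k
    using that by (intro generate.incl) (auto simp: homog_tensors_def)
  have *: "is_direct_sum (carrier G) Ten (mod_comp Ten) \<and>
    (\<forall>g\<in>carrier G. \<forall>X\<in>carrier Ten. N.mcmp Ten X g = p g X)"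
  proof (rule is_direct_sumI[of Ten "carrier G" "mod_comp Ten" p])
    show "abelian_group Ten" by (rule abelian_group_Ten)
    show "additive_subgroup (mod_comp Ten g) Ten" if "g \<in> carrier G" for g
    proof -
      interpret S: subgroup "generate T (homog_tensors g)" T by (rule sub[OF that])
      show ?thesis
        by (rule abelian_group.additive_subgroupI[OF abelian_group_Ten])
          (simp_all add: S.subset minus_Ten)
    qed
    show "p g X \<in> carrier Ten" if "g \<in> carrier G" "X \<in> carrier Ten" for g X
      using hom_in_carrier[OF p[OF that(1)]] that by simp
    show "p g (X \<oplus>\<^bsub>Ten\<^esub> Y) = p g X \<oplus>\<^bsub>Ten\<^esub> p g Y"
      if "g \<in> carrier G" "X \<in> carrier Ten" "Y \<in> carrier Ten" for g X Y
      using hom_mult[OF p[OF that(1)]] that by simp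
    show "p g X = X" if g: "g \<in> carrier G" and X: "X \<in> mod_comp Ten g" for g X
    proof -
      have "p g X = (\<lambda>X. X) X"
        by (rule hom_eq_on_generate[OF T.is_group T.is_group p[OF g] _ homog_tensors_sub[OF g]])
          (use X in \<open>auto simp: hom_def homog_tensors_def p_pure pure_cmp_homog\<close>)
      then show ?thesis .
    qed
    show "p h X = \<zero>\<^bsub>Ten\<^esub>"
      if g: "g \<in> carrier G" and h: "h \<in> carrier G" and X: "X \<in> mod_comp Ten g" and ne: "h \<noteq> g" for g h X
    proof -
      have "p h X = (\<lambda>X. \<one>\<^bsub>T\<^esub>) X"
        by (rule hom_eq_on_generate[OF T.is_group T.is_group p[OF h] _ homog_tensors_sub[OF g]])
          (use X h ne in \<open>auto simp: hom_def homog_tensors_def p_pure pure_cmp_homog\<close>)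
      then show ?thesis by simp
    qed
    fix P X
    assume X: "X \<in> carrier Ten" and P0: "P \<zero>\<^bsub>Ten\<^esub>"
      and Ph: "\<And>g X. \<lbrakk>g \<in> carrier G; X \<in> mod_comp Ten g\<rbrakk> \<Longrightarrow> P X"
      and Pa: "\<And>X Y. \<lbrakk>X \<in> carrier Ten; Y \<in> carrier Ten; P X; P Y\<rbrakk> \<Longrightarrow> P (X \<oplus>\<^bsub>Ten\<^esub> Y)"
    have P_pure: "P (pure x y)" if x: "x \<in> carrier N" and y: "y \<in> carrier M" for x y
      using x
    proof (induction rule: N.MD.homog_induct)
      case zero
      then show ?case using P0 y by (simp add: pure_zero_left)
    next
      case (homog h x)
      then have x: "x \<in> carrier N" by blast
      from y show ?case
      proof (induction rule: M.MD.homog_induct)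
        case zero
        then show ?case using P0 x by (simp add: pure_zero_right)
      next
        case (homog k y)
        then show ?case
          using Ph[of "h \<otimes>\<^bsub>G\<^esub> k" "pure x y"] incl[of h k x y] \<open>h \<in> carrier G\<close> \<open>x \<in> mod_comp N h\<close> by simp
      next
        case (add y y')
        then show ?case using Pa[of "pure x y" "pure x y'"] x by (simp add: pure_add_right)
      qed
    next
      case (add x x')
      then show ?case using Pa[of "pure x y" "pure x' y"] y by (simp add: pure_add_left)
    qed
    have "X \<in> carrier T" using X by simp
    then show "P X"
      by (induction rule: tensor_induct) (use P0 P_pure Pa in auto)
  qed
  show ?thesis
  proof (rule N.graded_moduleI)
    fix g h a X assume gh: "g \<in> carrier G" "h \<in> carrier G" and a: "a \<in> ring_comp R g" and X: "X \<in> mod_comp Ten h"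
    have aR: "a \<in> carrier R" using a gh by blast
    have "a \<odot>\<^bsub>Ten\<^esub> X \<in> generate T (homog_tensors (g \<otimes>\<^bsub>G\<^esub> h))"
    proof (rule hom_generate_sub[OF T.is_group T.is_group smult_Ten_hom[OF aR] homog_tensors_sub[OF gh(2)] sub])
      fix Y assume "Y \<in> homog_tensors h"
      then obtain x y k l where Y: "Y = pure x y" "k \<in> carrier G" "l \<in> carrier G" "k \<otimes>\<^bsub>G\<^esub> l = h"
        "x \<in> mod_comp N k" "y \<in> mod_comp M l"
        by (auto simp: homog_tensors_def)
      then have xy: "x \<in> carrier N" "y \<in> carrier M" by blast+
      have "g \<otimes>\<^bsub>G\<^esub> h = g \<otimes>\<^bsub>G\<^esub> k \<otimes>\<^bsub>G\<^esub> l" using Y gh by (auto simp: N.G.m_assoc)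
      then show "a \<odot>\<^bsub>Ten\<^esub> Y \<in> generate T (homog_tensors (g \<otimes>\<^bsub>G\<^esub> h))"
        using incl[of "g \<otimes>\<^bsub>G\<^esub> k" l "a \<odot>\<^bsub>N\<^esub> x" y] N.mod_comp_smult[of g k a x] Y gh a
        by (simp add: smult_Ten_pure[OF aR xy])
    qed (use gh X in auto)
    then show "a \<odot>\<^bsub>Ten\<^esub> X \<in> mod_comp Ten (g \<otimes>\<^bsub>G\<^esub> h)" by simp
  next
    fix a b X assume ab: "a \<in> carrier R" "b \<in> carrier R" and X: "X \<in> carrier Ten"
    then have "X \<in> carrier T" by simp
    then show "(a \<oplus>\<^bsub>R\<^esub> b) \<odot>\<^bsub>Ten\<^esub> X = a \<odot>\<^bsub>Ten\<^esub> X \<oplus>\<^bsub>Ten\<^esub> b \<odot>\<^bsub>Ten\<^esub> X"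
      by (induction rule: tensor_induct)
        (use ab in \<open>simp_all add: smult_Ten_pure N.smult_l_distr pure_add_left T.m_ac\<close>)
    have "X \<in> carrier T" using X by simp
    then show "(a \<otimes>\<^bsub>R\<^esub> b) \<odot>\<^bsub>Ten\<^esub> X = a \<odot>\<^bsub>Ten\<^esub> (b \<odot>\<^bsub>Ten\<^esub> X)"
      by (induction rule: tensor_induct)
        (use ab in \<open>simp_all add: smult_Ten_pure N.smult_assoc1\<close>)
  next
    fix X assume "X \<in> carrier Ten"
    then have "X \<in> carrier T" by simp
    then show "\<one>\<^bsub>R\<^esub> \<odot>\<^bsub>Ten\<^esub> X = X"
      by (induction rule: tensor_induct) (simp_all add: smult_Ten_pure)
  qed (use abelian_group_Ten * in auto)
qed

end

lemma
  assumes N: "graded_tensor G R N M" and P: "graded_tensor G R P M" and u: "u \<in> gr_hom G R N P"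
  shows tensor_map_gr_hom: "tensor_map R N P M u \<in> gr_hom G R (gr_tensor G R N M) (gr_tensor G R P M)"
    and tensor_map_hom: "tensor_map R N P M u \<in> hom (tensor_group R N M) (tensor_group R P M)"
    and tensor_map_pure: "\<lbrakk>x \<in> carrier N; y \<in> carrier M\<rbrakk> \<Longrightarrow>
      tensor_map R N P M u (tensor_class R N M (frag_of (x, y))) = tensor_class R P M (frag_of (u x, y))"
proof -
  interpret N: graded_tensor G R N M by fact
  interpret P: graded_tensor G R P M by fact
  note uD = gr_homD[OF u]
  let ?u = "tensor_map R N P M u"
  let ?v = "\<lambda>X. \<Union>c\<in>X. tensor_class R P M (frag_extend (\<lambda>(x, y). frag_of (u x, y)) c)"
  have v: "?v \<in> hom N.T P.T" and v_pure: "\<And>x y. \<lbrakk>x \<in> carrier N; y \<in> carrier M\<rbrakk> \<Longrightarrow> ?v (N.pure x y) = P.pure (u x) y"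
    using tensor_coset_map[OF N P, of u] uD(2-4) by blast+
  have uv: "?u X = ?v X" if "X \<in> carrier N.T" for X
    using that by (simp add: tensor_map_def)
  show hom: "?u \<in> hom N.T P.T"
    using v by (auto simp: hom_def uv Pi_def)
  show pure: "?u (N.pure x y) = P.pure (u x) y" if "x \<in> carrier N" "y \<in> carrier M" for x y
    using that v_pure uv by simp
  note u_cl = hom_in_carrier[OF hom] and u_mult = hom_mult[OF hom]
    and u_one = hom_one[OF hom N.T.is_group P.T.is_group]
  show "?u \<in> gr_hom G R N.Ten P.Ten"
  proof (rule gr_homI)
    fix a X assume a: "a \<in> carrier R" and "X \<in> carrier N.Ten"
    then have "X \<in> carrier N.T" by simp
    then show "?u (a \<odot>\<^bsub>N.Ten\<^esub> X) = a \<odot>\<^bsub>P.Ten\<^esub> ?u X"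
      by (induction rule: N.tensor_induct)
        (use a uD(2,4) in \<open>simp_all add: N.smult_Ten_pure P.smult_Ten_pure pure u_mult u_one u_cl\<close>)
  next
    fix g X assume g: "g \<in> carrier G" and X: "X \<in> mod_comp N.Ten g"
    have "?u X \<in> generate P.T (P.homog_tensors g)"
    proof (rule hom_generate_sub[OF N.T.is_group P.T.is_group hom N.homog_tensors_sub[OF g]])
      show "subgroup (generate P.T (P.homog_tensors g)) P.T"
        using P.homog_tensors_sub[OF g] by (rule P.T.generate_is_subgroup)
    next
      fix Y assume "Y \<in> N.homog_tensors g"
      then obtain x y k l where Y: "Y = N.pure x y" "k \<in> carrier G" "l \<in> carrier G" "k \<otimes>\<^bsub>G\<^esub> l = g"
        "x \<in> mod_comp N k" "y \<in> mod_comp M l"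
        by (auto simp: N.homog_tensors_def)
      then have "x \<in> carrier N" "y \<in> carrier M" by blast+
      then show "?u Y \<in> generate P.T (P.homog_tensors g)"
        using Y uD(5) P.homog_tensorsI[of k l "u x" y] by (auto simp: pure intro: generate.incl)
    qed (use X in simp)
    then show "?u X \<in> mod_comp P.Ten g" by simp
  qed (use u_cl u_mult in \<open>auto simp: tensor_map_def\<close>)
qed

text \<open>
  Modulo the image of $A \otimes M$, the class of $b \otimes y$ depends only on \<open>v b\<close> and \<open>y\<close>. This
  defines a map from $C \otimes M$ to the quotient of $B \otimes M$ by that image, whose composition with
  $v \otimes 1$ is the projection; so the kernel of $v \otimes 1$ is contained in the image.
\<close>

lemma tensor_right_exact:
  assumes A: "graded_tensor G R A M" and B: "graded_tensor G R B M" and C: "graded_tensor G R C M"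
    and u: "u \<in> gr_hom G R A B" and v: "v \<in> gr_hom G R B C"
    and ex: "u ` carrier A = {y \<in> carrier B. v y = \<zero>\<^bsub>C\<^esub>}" and surj: "v ` carrier B = carrier C"
  shows "tensor_map R A B M u ` carrier (gr_tensor G R A M) =
      {Y \<in> carrier (gr_tensor G R B M). tensor_map R B C M v Y = \<zero>\<^bsub>gr_tensor G R C M\<^esub>}"
    and "tensor_map R B C M v ` carrier (gr_tensor G R B M) = carrier (gr_tensor G R C M)"
proof -
  interpret A: graded_tensor G R A M by fact
  interpret B: graded_tensor G R B M by fact
  interpret C: graded_tensor G R C M by fact
  let ?u = "tensor_map R A B M u" and ?v = "tensor_map R B C M v"
  note u_hom = tensor_map_hom[OF A B u] and v_hom = tensor_map_hom[OF B C v]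
  note u_pure = tensor_map_pure[OF A B u] and v_pure = tensor_map_pure[OF B C v]
  note uD = gr_homD[OF u] and vD = gr_homD[OF v]
  interpret u: group_hom A.T B.T ?u
    by (intro group_hom.intro group_hom_axioms.intro u_hom A.T.is_group B.T.is_group)
  interpret v: group_hom B.T C.T ?v
    by (intro group_hom.intro group_hom_axioms.intro v_hom B.T.is_group C.T.is_group)
  let ?I = "?u ` carrier A.T"
  have I: "subgroup ?I B.T" by (rule u.img_is_subgroup)
  let ?Q = "B.T Mod ?I"
  have Q: "comm_group ?Q" by (rule B.T.abelian_FactGroup[OF I])
  interpret Q: comm_group ?Q by fact
  let ?q = "\<lambda>X. ?I #>\<^bsub>B.T\<^esub> X"
  have q_hom: "?q \<in> hom B.T ?Q"
    by (rule normal.r_coset_hom_Mod[OF B.T.subgroup_imp_normal[OF I]])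
  interpret q: group_hom B.T ?Q ?q
    by (intro group_hom.intro group_hom_axioms.intro q_hom B.T.is_group Q.is_group)
  have q_I: "?q X = \<one>\<^bsub>?Q\<^esub>" if "X \<in> ?I" for X
    using B.T.coset_join2[OF _ I that] subgroup.subset[OF I] that by auto
  define s where "s = inv_into (carrier B) v"
  have s: "s c \<in> carrier B" "v (s c) = c" if "c \<in> carrier C" for c
    using that surj by (auto simp: s_def inv_into_into f_inv_into_f)
  have q_s: "?q (B.pure b y) = ?q (B.pure (s (v b)) y)" if b: "b \<in> carrier B" and y: "y \<in> carrier M" for b y
  proof -
    have vb: "v b \<in> carrier C" using vD(2) b by simp
    let ?d = "b \<oplus>\<^bsub>B\<^esub> \<ominus>\<^bsub>B\<^esub> s (v b)"
    have "v ?d = \<zero>\<^bsub>C\<^esub>"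
      using b s[OF vb] vb vD(3)
        A.N.gr_hom_minus[OF B.N.graded_module_axioms C.N.graded_module_axioms v, of "s (v b)"]
      by (simp add: C.N.M.r_neg)
    then have "?d \<in> u ` carrier A" using ex b s[OF vb] by simp
    then obtain a where a: "a \<in> carrier A" "?d = u a" by auto
    have "b = ?d \<oplus>\<^bsub>B\<^esub> s (v b)" using b s[OF vb] by (simp add: B.N.M.a_assoc B.N.M.l_neg)
    then have "B.pure b y = B.pure (u a) y \<otimes>\<^bsub>B.T\<^esub> B.pure (s (v b)) y"
      using B.pure_add_left[of ?d "s (v b)" y] a uD(2)[OF a(1)] b s[OF vb] y by simp
    moreover have "?q (B.pure (u a) y) = \<one>\<^bsub>?Q\<^esub>"
      by (rule q_I) (use a y u_pure in \<open>auto intro!: image_eqI[of _ _ "A.pure a y"]\<close>)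
    ultimately show ?thesis
      using a uD(2) s[OF vb] y q.hom_mult[of "B.pure (u a) y" "B.pure (s (v b)) y"]
        q.hom_closed[of "B.pure (s (v b)) y"]
      by (simp del: mult_FactGroup one_FactGroup)
  qed
  obtain \<phi> where \<phi>: "\<phi> \<in> hom C.T ?Q"
    and \<phi>_pure: "\<And>c y. \<lbrakk>c \<in> carrier C; y \<in> carrier M\<rbrakk> \<Longrightarrow> \<phi> (C.pure c y) = ?q (B.pure (s c) y)"
  proof (rule C.tensor_universal[OF Q, of "\<lambda>c y. ?q (B.pure (s c) y)"])
    fix c c' y assume *: "c \<in> carrier C" "c' \<in> carrier C" "y \<in> carrier M"
    have "?q (B.pure (s (c \<oplus>\<^bsub>C\<^esub> c')) y) = ?q (B.pure (s c \<oplus>\<^bsub>B\<^esub> s c') y)"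
      using q_s[of "s c \<oplus>\<^bsub>B\<^esub> s c'" y] * s vD(3) by simp
    then show "?q (B.pure (s (c \<oplus>\<^bsub>C\<^esub> c')) y) = ?q (B.pure (s c) y) \<otimes>\<^bsub>?Q\<^esub> ?q (B.pure (s c') y)"
      using * s by (simp add: B.pure_add_left del: mult_FactGroup)
  next
    fix c y y' assume "c \<in> carrier C" "y \<in> carrier M" "y' \<in> carrier M"
    then show "?q (B.pure (s c) (y \<oplus>\<^bsub>M\<^esub> y')) = ?q (B.pure (s c) y) \<otimes>\<^bsub>?Q\<^esub> ?q (B.pure (s c) y')"
      using s by (simp add: B.pure_add_right del: mult_FactGroup)
  next
    fix a c y assume *: "a \<in> carrier R" "c \<in> carrier C" "y \<in> carrier M"
    have "?q (B.pure (s (a \<odot>\<^bsub>C\<^esub> c)) y) = ?q (B.pure (a \<odot>\<^bsub>B\<^esub> s c) y)"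
      using q_s[of "a \<odot>\<^bsub>B\<^esub> s c" y] * s vD(4) by simp
    then show "?q (B.pure (s (a \<odot>\<^bsub>C\<^esub> c)) y) = ?q (B.pure (s c) (a \<odot>\<^bsub>M\<^esub> y))"
      using * s by (simp add: B.pure_smult)
  qed (use s in auto)
  interpret \<phi>: group_hom C.T ?Q \<phi>
    by (intro group_hom.intro group_hom_axioms.intro \<phi> C.T.is_group Q.is_group)
  have \<phi>_v: "\<phi> (?v Y) = ?q Y" if "Y \<in> carrier B.T" for Y
    using that
  proof (induction rule: B.tensor_induct)
    case one
    then show ?case by (simp del: one_FactGroup)
  next
    case (pure b y)
    then show ?case using q_s[of b y] vD(2) by (simp add: v_pure \<phi>_pure)
  next
    case (mult X Y)
    then show ?case by (simp del: mult_FactGroup)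
  qed
  have vu: "?v (?u X) = \<one>\<^bsub>C.T\<^esub>" if "X \<in> carrier A.T" for X
    using that
  proof (induction rule: A.tensor_induct)
    case (pure x y)
    then have "v (u x) = \<zero>\<^bsub>C\<^esub>" using ex by auto
    then show ?case using pure uD(2) by (simp add: u_pure v_pure C.pure_zero_left)
  qed simp_all
  have ker: "Y \<in> ?I" if "Y \<in> carrier B.T" "?v Y = \<one>\<^bsub>C.T\<^esub>" for Y
  proof -
    have "?q Y = \<phi> (?v Y)" by (rule \<phi>_v[OF that(1), symmetric])
    also have "\<dots> = \<one>\<^bsub>?Q\<^esub>" unfolding that(2) by (rule \<phi>.hom_one)
    also have "\<dots> = ?I" by (rule one_FactGroup)
    finally have eq: "?q Y = ?I" .
    show ?thesis using B.T.rcos_self[OF that(1) I] unfolding eq .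
  qed
  show "?u ` carrier A.Ten = {Y \<in> carrier B.Ten. ?v Y = \<zero>\<^bsub>C.Ten\<^esub>}"
    using vu ker by auto
  have "Z \<in> ?v ` carrier B.T" if "Z \<in> carrier C.T" for Z
    using that
  proof (induction rule: C.tensor_induct)
    case one
    then show ?case using v.hom_one B.T.one_closed by (metis image_eqI)
  next
    case (pure c y)
    then show ?case using v_pure[of "s c" y] s by (intro image_eqI[of _ _ "B.pure (s c) y"]) auto
  next
    case (mult X Y)
    then obtain X' Y' where "X' \<in> carrier B.T" "Y' \<in> carrier B.T" "X = ?v X'" "Y = ?v Y'" by auto
    then show ?case by (intro image_eqI[of _ _ "X' \<otimes>\<^bsub>B.T\<^esub> Y'"]) auto
  qed
  then show "?v ` carrier B.Ten = carrier C.Ten"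
    by auto
qed


section \<open>Hom-tensor adjunction\<close>

locale tensor_hom = graded_tensor G R N M + Hom: graded_module_pair G R M E
  for G :: "('g, 'j) monoid_scheme" and R :: "('r, 'g, 'k) gring_scheme"
    and N :: "('r, 'n, 'g) gmodule" and M :: "('r, 'm, 'g) gmodule" and E :: "('r, 'e, 'g) gmodule"
begin

text \<open>
  A morphism \<open>f\<close> from \<open>N\<close> to the graded Hom module corresponds to the morphism sending
  $x \otimes y$ to $f(x)(y)$, where $f(x)$ is read as a linear map by summing its components. The
  degree is right because this sum has a single term for homogeneous \<open>x\<close>.
\<close>

lemma untranspose:
  assumes f: "f \<in> gr_hom G R N Hom.Hom"
  obtains k where "k \<in> gr_hom G R Ten E"
    "\<And>x y. \<lbrakk>x \<in> carrier N; y \<in> carrier M\<rbrakk> \<Longrightarrow> k (pure x y) = Hom.total (f x) y"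
proof -
  note fD = gr_homD[OF f]
  obtain \<phi> where \<phi>: "\<phi> \<in> hom T (add_monoid E)"
    and \<phi>_pure: "\<And>x y. \<lbrakk>x \<in> carrier N; y \<in> carrier M\<rbrakk> \<Longrightarrow> \<phi> (pure x y) = Hom.total (f x) y"
    by (rule tensor_universal[OF Hom.E.M.a_comm_group, of "\<lambda>x y. Hom.total (f x) y"])
      (use fD in \<open>auto simp: Hom.total_closed Hom.total_add_left Hom.total_add_right Hom.total_smult\<close>)
  have \<phi>_cl: "\<phi> X \<in> carrier E" if "X \<in> carrier T" for X
    using hom_in_carrier[OF \<phi> that] by simp
  have \<phi>_add: "\<phi> (X \<otimes>\<^bsub>T\<^esub> Y) = \<phi> X \<oplus>\<^bsub>E\<^esub> \<phi> Y" if "X \<in> carrier T" "Y \<in> carrier T" for X Y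
    using hom_mult[OF \<phi> that] by simp
  have \<phi>_one: "\<phi> \<one>\<^bsub>T\<^esub> = \<zero>\<^bsub>E\<^esub>"
    using hom_one[OF \<phi> T.is_group Hom.E.M.a_group] by simp
  let ?k = "\<lambda>X\<in>carrier T. \<phi> X"
  show thesis
  proof (rule that)
    show "?k (pure x y) = Hom.total (f x) y" if "x \<in> carrier N" "y \<in> carrier M" for x y
      using that \<phi>_pure by simp
    show "?k \<in> gr_hom G R Ten E"
    proof (rule gr_homI)
      fix a X assume a: "a \<in> carrier R" and "X \<in> carrier Ten"
      then have X: "X \<in> carrier T" by simp
      then have "\<phi> (a \<odot>\<^bsub>Ten\<^esub> X) = a \<odot>\<^bsub>E\<^esub> \<phi> X"
        by (induction rule: tensor_induct)
          (use a fD(2,4) in \<open>simp_all add: \<phi>_one \<phi>_add \<phi>_cl \<phi>_pure smult_Ten_pure Hom.total_smult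
              Hom.E.smult_r_distr\<close>)
      then show "?k (a \<odot>\<^bsub>Ten\<^esub> X) = a \<odot>\<^bsub>E\<^esub> ?k X" using a X by simp
    next
      fix g X assume g: "g \<in> carrier G" and X: "X \<in> mod_comp Ten g"
      have "\<phi> X \<in> mod_comp E g"
      proof (rule hom_generate_sub[OF T.is_group Hom.E.M.a_group \<phi> homog_tensors_sub[OF g]])
        show "subgroup (mod_comp E g) (add_monoid E)"
          by (rule additive_subgroup.a_subgroup[OF Hom.E.MD.comp_subgroup[OF g]])
      next
        fix Y assume "Y \<in> homog_tensors g"
        then obtain x y k l where Y: "Y = pure x y" "k \<in> carrier G" "l \<in> carrier G" "k \<otimes>\<^bsub>G\<^esub> l = g"
          "x \<in> mod_comp N k" "y \<in> mod_comp M l"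
          by (auto simp: homog_tensors_def)
        then have xy: "x \<in> carrier N" "y \<in> carrier M" by blast+
        have "\<phi> Y = f x k y"
          using Y xy fD(5)[of k x] Hom.total_homog[of "f x" k y] by (simp add: \<phi>_pure)
        then show "\<phi> Y \<in> mod_comp E g"
          using Hom.HomD(6)[OF fD(2)[OF xy(1)], of k l y] Y by simp
      qed (use X in simp)
      moreover have "X \<in> carrier T"
        using X T.generate_in_carrier[OF homog_tensors_sub[OF g]] by simp
      ultimately show "?k X \<in> mod_comp E g" by simp
    qed (simp_all add: \<phi>_cl \<phi>_add)
  qed
qed

text \<open>
  Conversely, the component of degree \<open>g\<close> of the linear map $y \mapsto k(b \otimes y)$ is obtained by
  replacing \<open>b\<close> with its component of degree \<open>g\<close>.
\<close>

definition transpose :: "(('n \<times> 'm \<Rightarrow>\<^sub>0 int) set \<Rightarrow> 'e) \<Rightarrow> 'n \<Rightarrow> 'g \<Rightarrow> 'm \<Rightarrow> 'e" where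
  "transpose k = (\<lambda>b\<in>carrier N. \<lambda>g\<in>carrier G. \<lambda>y\<in>carrier M. k (pure (N.mcmp N b g) y))"

context
  fixes k
  assumes k: "k \<in> gr_hom G R Ten E"
begin

lemma gr_hom_tensor_simps:
  "X \<in> carrier T \<Longrightarrow> k X \<in> carrier E"
  "\<lbrakk>X \<in> carrier T; Y \<in> carrier T\<rbrakk> \<Longrightarrow> k (X \<otimes>\<^bsub>T\<^esub> Y) = k X \<oplus>\<^bsub>E\<^esub> k Y"
  "\<lbrakk>a \<in> carrier R; X \<in> carrier T\<rbrakk> \<Longrightarrow> k (a \<odot>\<^bsub>Ten\<^esub> X) = a \<odot>\<^bsub>E\<^esub> k X"
  "k \<one>\<^bsub>T\<^esub> = \<zero>\<^bsub>E\<^esub>"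
  using gr_homD(2-4)[OF k] N.gr_hom_zero[OF graded_module_Ten Hom.E.graded_module_axioms k] by simp_all

lemma transpose_closed:
  assumes b: "b \<in> carrier N"
  shows "transpose k b \<in> carrier Hom.Hom"
proof (rule Hom.HomI)
  show "finite {g \<in> carrier G. \<exists>y\<in>carrier M. transpose k b g y \<noteq> \<zero>\<^bsub>E\<^esub>}"
    by (rule finite_subset[OF _ N.MD.cmp_finite[OF b]])
      (use b in \<open>auto simp: transpose_def pure_zero_left gr_hom_tensor_simps\<close>)
next
  fix g a y assume *: "g \<in> carrier G" "a \<in> carrier R" "y \<in> carrier M"
  then have "pure (N.mcmp N b g) (a \<odot>\<^bsub>M\<^esub> y) = a \<odot>\<^bsub>Ten\<^esub> pure (N.mcmp N b g) y"
    using b by (simp add: smult_Ten_pure pure_smult)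
  then show "transpose k b g (a \<odot>\<^bsub>M\<^esub> y) = a \<odot>\<^bsub>E\<^esub> transpose k b g y"
    using * b by (simp add: transpose_def gr_hom_tensor_simps)
next
  fix g h y assume *: "g \<in> carrier G" "h \<in> carrier G" "y \<in> mod_comp M h"
  then have "pure (N.mcmp N b g) y \<in> mod_comp Ten (g \<otimes>\<^bsub>G\<^esub> h)"
    using b homog_tensorsI[OF *(1,2) N.MD.cmp_in[OF b *(1)] *(3)] by (simp add: generate.incl)
  then have "k (pure (N.mcmp N b g) y) \<in> mod_comp E (g \<otimes>\<^bsub>G\<^esub> h)"
    using * by (intro gr_homD(5)[OF k]) simp_all
  then show "transpose k b g y \<in> mod_comp E (g \<otimes>\<^bsub>G\<^esub> h)"
    using * b M.MD.comp_sub[OF *(3,2)] by (simp add: transpose_def)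
qed (use b in \<open>auto simp: transpose_def gr_hom_tensor_simps pure_add_right\<close>)

lemma transpose_add:
  assumes "b \<in> carrier N" "c \<in> carrier N"
  shows "transpose k (b \<oplus>\<^bsub>N\<^esub> c) = transpose k b \<oplus>\<^bsub>Hom.Hom\<^esub> transpose k c"
  by (rule Hom.Hom_eqI)
    (use assms in \<open>auto simp: transpose_def Hom.Hom_simps(2) N.MD.cmp_add pure_add_left gr_hom_tensor_simps\<close>)

lemma transpose_smult:
  assumes a: "a \<in> carrier R" and b: "b \<in> carrier N"
  shows "transpose k (a \<odot>\<^bsub>N\<^esub> b) = a \<odot>\<^bsub>Hom.Hom\<^esub> transpose k b"
proof -
  interpret H: graded_module G R Hom.Hom by (rule Hom.graded_module_Hom)
  have homog_eq: "transpose k (a \<odot>\<^bsub>N\<^esub> b) = a \<odot>\<^bsub>Hom.Hom\<^esub> transpose k b"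
    if a: "a \<in> ring_comp R h" "h \<in> carrier G" for a h
  proof (rule Hom.Hom_eqI)
    have aR: "a \<in> carrier R" using a by blast
    fix g y assume g: "g \<in> carrier G" and y: "y \<in> carrier M"
    have "g \<otimes>\<^bsub>G\<^esub> inv\<^bsub>G\<^esub> h = inv\<^bsub>G\<^esub> h \<otimes>\<^bsub>G\<^esub> g" using g a by (simp add: N.G.m_comm)
    then show "transpose k (a \<odot>\<^bsub>N\<^esub> b) g y = (a \<odot>\<^bsub>Hom.Hom\<^esub> transpose k b) g y"
      using a aR g y b N.smult_cmp[OF a b g]
      by (simp add: Hom.smult_Hom_homog[OF a transpose_closed[OF b] g y])
        (simp add: transpose_def smult_Ten_pure[symmetric] gr_hom_tensor_simps)
  qed (use b N.RD.comp_sub[OF a] in \<open>auto simp: transpose_def Hom.smult_Hom_ext\<close>)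
  from a show ?thesis
  proof (induction rule: N.RD.homog_induct)
    case zero
    show ?case by (rule homog_eq[of _ "\<one>\<^bsub>G\<^esub>"]) simp_all
  next
    case (homog h a)
    then show ?case by (intro homog_eq)
  next
    case (add x y)
    then show ?case
      using b by (simp add: N.smult_l_distr H.smult_l_distr transpose_add transpose_closed)
  qed
qed

lemma transpose_homog:
  assumes g: "g \<in> carrier G" and b: "b \<in> mod_comp N g"
  shows "transpose k b \<in> mod_comp Hom.Hom g"
  using N.MD.comp_sub[OF b g] transpose_closed[OF N.MD.comp_sub[OF b g]] g b
  by (auto simp: Hom.Hom_simps(3) transpose_def N.MD.cmp_homog pure_zero_left gr_hom_tensor_simps)

lemma transpose_gr_hom: "transpose k \<in> gr_hom G R N Hom.Hom"
  by (rule gr_homI)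
    (use transpose_closed transpose_add transpose_smult transpose_homog in \<open>auto simp: transpose_def\<close>)

lemma total_transpose:
  assumes b: "b \<in> carrier N" and y: "y \<in> carrier M"
  shows "Hom.total (transpose k b) y = k (pure b y)"
proof (rule N.MD.additive_ext[OF Hom.E.M.a_group, of "\<lambda>b. Hom.total (transpose k b) y" "\<lambda>b. k (pure b y)"])
  fix g b assume gb: "g \<in> carrier G" "b \<in> mod_comp N g"
  show "Hom.total (transpose k b) y = k (pure b y)"
    using Hom.total_homog[OF transpose_homog[OF gb] gb(1) y] gb y N.MD.comp_sub[OF gb(2,1)]
    by (simp add: transpose_def N.MD.cmp_homog)
qed (use b y in \<open>simp_all add: Hom.total_closed transpose_closed transpose_add Hom.total_add_left
      pure_add_left gr_hom_tensor_simps\<close>)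

end

end

section \<open>Flat modules and injective Hom modules\<close>

text \<open>
  The cokernel is formed on chosen representatives of the cosets of the image, so that it stays in
  the type of \<open>B\<close> and can serve as a test module.
\<close>

lemma (in graded_ring) gr_cokernel:
  fixes A :: "('r, 'a, 'g) gmodule" and B :: "('r, 'b, 'g) gmodule"
  assumes A: "gmod A" and B: "gmod B" and u: "u \<in> ghom A B" "inj_on u (carrier A)"
  obtains C :: "('r, 'b, 'g) gmodule" and v where "gr_short_exact G R A B C u v"
proof -
  interpret A: graded_module G R A by fact
  interpret B: graded_module G R B by fact
  note uD = gr_homD[OF u(1)]
  define I where "I = u ` carrier A"
  have I_sub: "x \<in> carrier B" if "x \<in> I" for x
    using that uD(2) by (auto simp: I_def)
  have I_zero: "\<zero>\<^bsub>B\<^esub> \<in> I"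
    using gr_hom_zero[OF A B u(1)] by (force simp: I_def)
  have I_add: "x \<oplus>\<^bsub>B\<^esub> y \<in> I" if "x \<in> I" "y \<in> I" for x y
    using that by (auto simp: I_def uD(3)[symmetric])
  have I_smult: "a \<odot>\<^bsub>B\<^esub> x \<in> I" if "a \<in> carrier R" "x \<in> I" for a x
    using that by (auto simp: I_def uD(4)[symmetric])
  have I_cmp: "mcmp B x g \<in> I" if "x \<in> I" "g \<in> carrier G" for x g
    using that by (auto simp: I_def gr_hom_cmp[OF A B u(1), symmetric])
  have I_minus: "\<ominus>\<^bsub>B\<^esub> x \<in> I" if "x \<in> I" for x
    using that I_sub I_smult by (simp add: B.uminus_eq_smult)
  define D where "D x y = x \<oplus>\<^bsub>B\<^esub> \<ominus>\<^bsub>B\<^esub> y" for x y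
  have D_refl: "D x x \<in> I" if "x \<in> carrier B" for x
    using that I_zero by (simp add: D_def B.M.r_neg)
  have D_sym: "D y x \<in> I" if "D x y \<in> I" "x \<in> carrier B" "y \<in> carrier B" for x y
    using that I_minus[of "D x y"] by (simp add: D_def B.M.minus_add B.M.a_comm)
  have D_trans: "D x z \<in> I" if "D x y \<in> I" "D y z \<in> I" "x \<in> carrier B" "y \<in> carrier B" "z \<in> carrier B" for x y z
  proof -
    have "D x y \<oplus>\<^bsub>B\<^esub> D y z = x \<oplus>\<^bsub>B\<^esub> (\<ominus>\<^bsub>B\<^esub> y \<oplus>\<^bsub>B\<^esub> y) \<oplus>\<^bsub>B\<^esub> \<ominus>\<^bsub>B\<^esub> z"
      using that(3-5) by (simp add: D_def B.M.a_assoc del: B.M.l_neg)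
    also have "\<dots> = D x z" using that(3-5) by (simp add: D_def B.M.l_neg)
    finally show ?thesis using I_add[OF that(1,2)] by simp
  qed
  define q where "q x = (SOME y. y \<in> carrier B \<and> D x y \<in> I)" for x
  have q: "q x \<in> carrier B \<and> D x (q x) \<in> I" if "x \<in> carrier B" for x
    unfolding q_def by (rule someI[of _ x]) (use that D_refl in auto)
  have q_iff: "q x = q y \<longleftrightarrow> D x y \<in> I" if "x \<in> carrier B" "y \<in> carrier B" for x y
  proof
    assume "q x = q y"
    then show "D x y \<in> I" using q that D_sym D_trans by metis
  next
    assume xy: "D x y \<in> I"
    then have "D x z \<in> I \<longleftrightarrow> D y z \<in> I" if "z \<in> carrier B" for z
      using D_trans D_sym \<open>x \<in> carrier B\<close> \<open>y \<in> carrier B\<close> that by blast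
    then show "q x = q y" unfolding q_def by metis
  qed
  interpret C: subquotient G R B "carrier B" q
  proof (intro subquotient.intro subquotient_axioms.intro B)
    fix x y z assume *: "x \<in> carrier B" "y \<in> carrier B" "z \<in> carrier B" "q x = q y"
    have "D (x \<oplus>\<^bsub>B\<^esub> z) (y \<oplus>\<^bsub>B\<^esub> z) = x \<oplus>\<^bsub>B\<^esub> \<ominus>\<^bsub>B\<^esub> y \<oplus>\<^bsub>B\<^esub> (z \<oplus>\<^bsub>B\<^esub> \<ominus>\<^bsub>B\<^esub> z)"
      using *(1-3) by (simp only: D_def B.M.minus_add B.M.a_ac B.M.a_closed B.M.a_inv_closed)
    then have "D (x \<oplus>\<^bsub>B\<^esub> z) (y \<oplus>\<^bsub>B\<^esub> z) = D x y"
      using *(1-3) by (simp add: D_def B.M.r_neg)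
    then show "q (x \<oplus>\<^bsub>B\<^esub> z) = q (y \<oplus>\<^bsub>B\<^esub> z)" using * by (simp add: q_iff)
  next
    fix a x y assume *: "a \<in> carrier R" "x \<in> carrier B" "y \<in> carrier B" "q x = q y"
    have "D (a \<odot>\<^bsub>B\<^esub> x) (a \<odot>\<^bsub>B\<^esub> y) = a \<odot>\<^bsub>B\<^esub> D x y"
      using *(1-3) by (simp add: D_def B.smult_r_distr B.smult_r_minus)
    then show "q (a \<odot>\<^bsub>B\<^esub> x) = q (a \<odot>\<^bsub>B\<^esub> y)" using * I_smult by (simp add: q_iff)
  next
    fix x y g assume *: "x \<in> carrier B" "y \<in> carrier B" "g \<in> carrier G" "q x = q y"
    have "D (mcmp B x g) (mcmp B y g) = mcmp B (D x y) g"
      using *(1-3) by (simp add: D_def B.MD.cmp_add B.MD.cmp_minus)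
    then show "q (mcmp B x g) = q (mcmp B y g)" using * I_cmp by (simp add: q_iff)
  qed auto
  let ?v = "\<lambda>x\<in>carrier B. q x"
  have v: "?v \<in> ghom B C.Q"
    by (rule gr_homI) (use B.MD.comp_sub in auto)
  have minus_zero: "\<ominus>\<^bsub>B\<^esub> \<zero>\<^bsub>B\<^esub> = \<zero>\<^bsub>B\<^esub>" using B.uminus_eq_smult[of "\<zero>\<^bsub>B\<^esub>"] by simp
  have "u ` carrier A = {y \<in> carrier B. ?v y = \<zero>\<^bsub>C.Q\<^esub>}"
    using I_sub by (auto simp: I_def[symmetric] q_iff D_def minus_zero)
  then have "gr_short_exact G R A B C.Q u ?v"
    unfolding gr_short_exact_def using A B C.graded_module_Q u v by simp
  then show thesis by (rule that)
qed

context graded_module_pair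
begin

text \<open>
  To extend \<open>f\<close> along \<open>u\<close>, extend the corresponding morphism from $A \otimes M$ to \<open>E\<close> along
  $u \otimes 1$, which is a monomorphism by flatness, and transpose back.
\<close>

lemma Hom_injective_if_flat:
  assumes small: "carrier R \<lesssim> (UNIV :: 'u set)" and inj: "gr_injective TYPE('u) G R E"
    and flat: "gr_flat TYPE('u) G R M"
  shows "gr_injective TYPE('u) G R Hom"
  unfolding gr_injective_def
proof (intro conjI allI impI ballI)
  show "graded_module G R Hom" by (rule graded_module_Hom)
  fix A B :: "('r, 'u, 'g) gmodule" and u f
  assume A: "graded_module G R A" and B: "graded_module G R B"
    and u: "u \<in> gr_hom G R A B" "inj_on u (carrier A)" and f: "f \<in> gr_hom G R A Hom"
  interpret A: tensor_hom G R A M E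
    by (intro tensor_hom.intro graded_tensor.intro A M.graded_module_axioms graded_module_pair_axioms)
  interpret B: tensor_hom G R B M E
    by (intro tensor_hom.intro graded_tensor.intro B M.graded_module_axioms graded_module_pair_axioms)
  note uD = gr_homD[OF u(1)] and fD = gr_homD[OF f]
  let ?u = "tensor_map R A B M u"
  obtain C :: "('r, 'u, 'g) gmodule" and v where "gr_short_exact G R A B C u v"
    using M.gr_cokernel[OF A B u] by blast
  then have "gr_short_exact G R A.Ten B.Ten (gr_tensor G R C M) ?u (tensor_map R B C M v)"
    using flat unfolding gr_flat_def by blast
  then have tu: "?u \<in> gr_hom G R A.Ten B.Ten" "inj_on ?u (carrier A.Ten)"
    unfolding gr_short_exact_def by blast+
  note u_pure = tensor_map_pure[OF A.graded_tensor_axioms B.graded_tensor_axioms u(1)]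
  obtain k where k: "k \<in> gr_hom G R A.Ten E"
    and k_pure: "\<And>x y. \<lbrakk>x \<in> carrier A; y \<in> carrier M\<rbrakk> \<Longrightarrow> k (A.pure x y) = total (f x) y"
    using A.untranspose[OF f] by blast
  obtain h where h: "h \<in> gr_hom G R B.Ten E" and hk: "\<And>X. X \<in> carrier A.Ten \<Longrightarrow> h (?u X) = k X"
    using M.gr_injective_extend[OF small inj A.graded_module_Ten B.graded_module_Ten tu k] by blast
  have "B.transpose h (u x) = f x" if x: "x \<in> carrier A" for x
  proof (rule Hom_eqI)
    fix g y assume g: "g \<in> carrier G" and y: "y \<in> carrier M"
    let ?x = "M.mcmp A x g"
    have xg: "?x \<in> carrier A" "?x \<in> mod_comp A g"
      using x g A.N.MD.cmp_in by auto
    have "B.transpose h (u x) g y = h (B.pure (u ?x) y)"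
      using x g y uD(2) M.gr_hom_cmp[OF A B u(1) x g] by (simp add: B.transpose_def)
    also have "\<dots> = k (A.pure ?x y)"
      using hk[of "A.pure ?x y"] xg y by (simp add: u_pure)
    also have "\<dots> = f ?x g y"
      using total_homog[OF fD(5)[OF g xg(2)] g y] xg y by (simp add: k_pure)
    also have "\<dots> = f x g y"
      using M.gr_hom_cmp[OF A graded_module_Hom f x g] cmp_Hom[OF fD(2)[OF x] g y] by simp
    finally show "B.transpose h (u x) g y = f x g y" .
  qed (use B.transpose_closed[OF h uD(2)[OF x]] fD(2)[OF x] HomD(1,2) in auto)
  then have "compose (carrier A) (B.transpose h) u = f"
    using fD(1) by (auto simp: compose_def extensional_def fun_eq_iff)
  then show "\<exists>h\<in>gr_hom G R B Hom. compose (carrier A) h u = f"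
    using B.transpose_gr_hom[OF h] by blast
qed

text \<open>
  By right exactness only the injectivity of $u \otimes 1$ is at stake. If it killed a nonzero element,
  it would kill a nonzero homogeneous \<open>Z\<close>, and some \<open>h\<close> from $A \otimes M$ to \<open>E\<close> would not vanish at \<open>Z\<close>.
  Extending the transpose of \<open>h\<close> along \<open>u\<close> and going back factors \<open>h\<close> through $u \otimes 1$, so that
  \<open>h\<close> vanishes at \<open>Z\<close> after all.
\<close>

lemma flat_if_Hom_injective:
  assumes small: "carrier R \<lesssim> (UNIV :: 'u set)" and inj: "gr_injective TYPE('u) G R E"
    and cogen: "gr_cogenerator TYPE('u) G R E" and inj_Hom: "gr_injective TYPE('u) G R Hom"
  shows "gr_flat TYPE('u) G R M"
  unfolding gr_flat_def
proof (intro conjI allI impI)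
  show "graded_module G R M" by (rule M.graded_module_axioms)
  fix A B C :: "('r, 'u, 'g) gmodule" and u v
  assume ex: "gr_short_exact G R A B C u v"
  then have A: "graded_module G R A" and B: "graded_module G R B" and C: "graded_module G R C"
    and u: "u \<in> gr_hom G R A B" "inj_on u (carrier A)" and v: "v \<in> gr_hom G R B C"
    and uv: "u ` carrier A = {y \<in> carrier B. v y = \<zero>\<^bsub>C\<^esub>}" "v ` carrier B = carrier C"
    unfolding gr_short_exact_def by auto
  interpret A: tensor_hom G R A M E
    by (intro tensor_hom.intro graded_tensor.intro A M.graded_module_axioms graded_module_pair_axioms)
  interpret B: tensor_hom G R B M E
    by (intro tensor_hom.intro graded_tensor.intro B M.graded_module_axioms graded_module_pair_axioms)
  interpret C: graded_tensor G R C M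
    by (intro graded_tensor.intro C M.graded_module_axioms)
  interpret TA: graded_module G R A.Ten by (rule A.graded_module_Ten)
  interpret TB: graded_module G R B.Ten by (rule B.graded_module_Ten)
  note gt = A.graded_tensor_axioms B.graded_tensor_axioms C.graded_tensor_axioms
  let ?u = "tensor_map R A B M u" and ?v = "tensor_map R B C M v"
  note tu = tensor_map_gr_hom[OF gt(1,2) u(1)] and tv = tensor_map_gr_hom[OF gt(2,3) v]
  note u_pure = tensor_map_pure[OF gt(1,2) u(1)]
  have "X = \<zero>\<^bsub>A.Ten\<^esub>" if X: "X \<in> carrier A.Ten" and uX: "?u X = \<zero>\<^bsub>B.Ten\<^esub>" for X
  proof (rule TA.MD.zero_if_cmp_zero[OF X])
    fix g assume g: "g \<in> carrier G"
    let ?Z = "M.mcmp A.Ten X g"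
    have Z: "?Z \<in> mod_comp A.Ten g" "?Z \<in> carrier A.Ten"
      using TA.MD.cmp_in[OF X g] TA.MD.cmp_closed[OF X g] by blast+
    have uZ: "?u ?Z = \<zero>\<^bsub>B.Ten\<^esub>"
      using M.gr_hom_cmp[OF A.graded_module_Ten B.graded_module_Ten tu X g] TB.MD.cmp_zero[OF g]
      unfolding uX by simp
    show "?Z = \<zero>\<^bsub>A.Ten\<^esub>"
    proof (rule ccontr)
      assume "?Z \<noteq> \<zero>\<^bsub>A.Ten\<^esub>"
      then obtain h where h: "h \<in> gr_hom G R A.Ten E" "h ?Z \<noteq> \<zero>\<^bsub>E\<^esub>"
        using M.gr_cogenerator_separates[OF small inj cogen A.graded_module_Ten g Z(1)] by blast
      obtain H where H: "H \<in> gr_hom G R B Hom" "\<And>x. x \<in> carrier A \<Longrightarrow> H (u x) = A.transpose h x"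
        using M.gr_injectiveD[OF inj_Hom A B u A.transpose_gr_hom[OF h(1)]] by blast
      obtain k where k: "k \<in> gr_hom G R B.Ten E"
        and k_pure: "\<And>b y. \<lbrakk>b \<in> carrier B; y \<in> carrier M\<rbrakk> \<Longrightarrow> k (B.pure b y) = total (H b) y"
        using B.untranspose[OF H(1)] by blast
      note tuD = gr_homD[OF tu, simplified]
      have "k (?u Y) = h Y" if "Y \<in> carrier A.T" for Y
        using that
      proof (induction rule: A.tensor_induct)
        case one
        then show ?case
          using M.gr_hom_zero[OF A.graded_module_Ten B.graded_module_Ten tu]
          by (simp add: A.gr_hom_tensor_simps[OF h(1)] B.gr_hom_tensor_simps[OF k])
      next
        case (pure x y)
        then show ?case
          using gr_homD(2)[OF u(1)] by (simp add: u_pure k_pure H(2) A.total_transpose[OF h(1)])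
      next
        case (mult X Y)
        then show ?case
          using tuD(2,3) by (simp add: A.gr_hom_tensor_simps[OF h(1)] B.gr_hom_tensor_simps[OF k])
      qed
      from this[of ?Z] have "h ?Z = \<zero>\<^bsub>E\<^esub>"
        using Z uZ by (simp add: B.gr_hom_tensor_simps[OF k])
      with h(2) show False by blast
    qed
  qed
  then have "inj_on ?u (carrier A.Ten)"
    using M.gr_hom_inj_iff[OF A.graded_module_Ten B.graded_module_Ten tu] by blast
  then show "gr_short_exact G R A.Ten B.Ten C.Ten ?u ?v"
    unfolding gr_short_exact_def
    using tu tv A.graded_module_Ten B.graded_module_Ten C.graded_module_Ten
      tensor_right_exact[OF gt u(1) v uv] by blast
qed

end

theorem mainTheorem12:
  fixes G :: "('g, 'j) monoid_scheme"
    and R :: "('r, 'g, 'k) gring_scheme"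
    and E :: "('r, 'e, 'g) gmodule"
    and M :: "('r, 'm, 'g) gmodule"
  assumes "graded_ring G R"
    and "carrier R \<lesssim> (UNIV :: 'u set)"
    and "gr_injective TYPE('u) G R E"
    and "gr_cogenerator TYPE('u) G R E"
    and "graded_module G R M"
  shows "gr_flat TYPE('u) G R M \<longleftrightarrow> gr_injective TYPE('u) G R (gr_Hom G R M E)"
proof -
  have "graded_module G R E"
    using assms(3) by (simp add: gr_injective_def)
  then interpret graded_module_pair G R M E
    using assms(5) by (intro graded_module_pair.intro)
  show ?thesis
    using Hom_injective_if_flat flat_if_Hom_injective assms by blast
qed

end
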